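(* Let $X$ be a connected, oriented, non-compact $C^\infty$ Riemannian manifold, $\mathcal D=C_0^\infty(X)$ (real-valued), $\mathcal D'$ its dual, and $\mathcal C_\sigma(\mathcal D')$ the cylinder $\sigma$-algebra on $\mathcal D'$. Let $\rho$ be a measure on $(\Gamma_{X,0},\mathcal B(\Gamma_{X,0}))$ such that: (1) $\rho(\Gamma_X^{(0)})=1$; (2) for every compact $\Lambda\subset X$ there is a constant $C_\Lambda>0$ such that $\rho(\Gamma_\Lambda^{(n)})\le C_\Lambda^n$ for all $n\in\mathbb N$; (3) $\int_{\Gamma_{X,0}}(G\star\overline G)(\eta)\,\rho(d\eta)\ge 0$ for every $G\in\mathcal F_{\rm fin}(\mathcal D)$. Let $\mu$ be the probability measure on $(\mathcal D',\mathcal C_\sigma(\mathcal D'))$ associated with $\rho$, namely the spectral measure for which the map $$\widehat{\mathcal F}_{\rm fin}(\mathcal D)\ni\widehat G\mapsto(K\widehat G)(\omega)=\sum_{n=0}^\infty\langle G^{(n)},{:}\omega^{\otimes n}{:}\rangle$$ ($G$ any representative of $\widehat G$) is well defined and extends by continuity to a unitary isomorphism $K:\mathcal H_\rho\to L^2(\mathcal D',\mathcal C_\sigma(\mathcal D'),d\mu)$ with $KA_\varphi^\sim K^{-1}=\langle\varphi,\cdot\rangle\,\cdot$ (multiplication operator) for all $\varphi\in\mathcal D$. Suppose that the configuration space $\Gamma_X\subset\mathcal D'$ is a set of full $\mu$-measure. Then the operator $K$ coincides with the $K$-transform between functions of finite and infinite configurations, i.e. for each $G\in\mathcal F_{\rm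 fin}(\mathcal D)$, $$(K\widehat G)(\gamma)=\sum_{\eta\Subset\gamma}G(\eta)\quad\text{for }\mu\text{-a.e. }\gamma\in\Gamma_X,$$ and $\rho$ is the correlation measure of $\mu$.
   Context: **Function spaces.** $\mathcal D=C_0^\infty(X)$ carries its usual nuclear topology; $\mathcal D_{\mathbb C}$ is its complexification. $\mathcal F_0(\mathcal D)=\mathbb C$ and, for $n\ge1$, $\mathcal F_n(\mathcal D)=\mathcal D_{\mathbb C}^{\widehat\otimes n}$ ($\widehat\otimes$ = symmetric tensor product), i.e. the space of complex-valued symmetric $C^\infty$ functions on $X^n$ with compact support. $\mathcal F_{\rm fin}(\mathcal D)=\bigoplus_{n\ge0}\mathcal F_n(\mathcal D)$ is the topological direct sum: elements are finite sequences $G=(G^{(0)},\dots,G^{(n)},0,0,\dots)$, and convergence means uniform finiteness and coordinate-wise convergence. $G^{(n)}\in\mathcal F_n(\mathcal D)$ is identified with the sequence having $G^{(n)}$ at place $n$ and $0$ elsewhere; in particular $\varphi\in\mathcal D$ is an element of $\mathcal F_{\rm fin}(\mathcal D)$. Pairings $\langle\cdot,\cdot\rangle$ between (tensor powers of) $\mathcal D$ and $\mathcal D'$ are extended complex-bilinearly. **Finite configurations.** $\ddot\Gamma_{X,0}=\bigsqcup_{n\ge0}\ddot\Gamma_X^{(n)}$, where $\ddot\Gamma_X^{(0)}=\{\varnothing\}$ and $\ddot\Gamma_X^{(n)}=X^n/S_n$ with the quotient topology (disjoint-union topology on $\ddot\Gamma_{X,0}$); elements are written $[x_1,\dots,x_n]$.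 Each $G\in\mathcal F_{\rm fin}(\mathcal D)$ is a function on $\ddot\Gamma_{X,0}$ via $G(\varnothing)=G^{(0)}$, $G([x_1,\dots,x_n])=G^{(n)}(x_1,\dots,x_n)$. $\Gamma_{X,0}\subset\ddot\Gamma_{X,0}$ (relative topology) consists of $\varnothing$ and all $[x_1,\dots,x_n]$ with pairwise distinct $x_i$, identified with finite subsets of $X$; $\Gamma_X^{(n)}$ is the set of $n$-point elements of $\Gamma_{X,0}$, and for $\Lambda\subset X$, $\Gamma_\Lambda^{(n)}$ is the set of $n$-point subsets of $\Lambda$. **Convolution.** For $G_1,G_2\in\mathcal F_{\rm fin}(\mathcal D)$, $$(G_1\star G_2)(\eta)=\sum_{(\xi_1,\xi_2,\xi_3)\in\mathcal P_3(\eta)}G_1(\xi_1\cup\xi_2)\,G_2(\xi_2\cup\xi_3),$$ where for $\eta=[x_1,\dots,x_n]$ the sum is over all ordered triples of pairwise disjoint, possibly empty, subsets of $\{1,\dots,n\}$ with union $\{1,\dots,n\}$, and an index set $\xi$ is identified with the class $[x_i]_{i\in\xi}$ (and $\varnothing$ with $\varnothing$). One has $G_1\star G_2\in\mathcal F_{\rm fin}(\mathcal D)$. **Hilbert space and operators.** $a_\rho(G_1,G_2)=\int_{\Gamma_{X,0}}(G_1\star G_2)(\eta)\,\rho(d\eta)$. $\widehat{\mathcal F}_{\rm fin}(\mathcal D)=\mathcal F_{\rm fin}(\mathcal D)/\{G':a_\rho(G',\overline{G'})=0\}$, with classes denoted $\widehat G$; $\mathcal H_\rho$ is the complex Hilbert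 space obtained by completing $\widehat{\mathcal F}_{\rm fin}(\mathcal D)$ in the scalar product $(\widehat G_1,\widehat G_2)_{\mathcal H_\rho}=a_\rho(G_1,\overline{G_2})$. For $\varphi\in\mathcal D$, $A_\varphi$ is the (well-defined) operator in $\mathcal H_\rho$ with domain $\widehat{\mathcal F}_{\rm fin}(\mathcal D)$ given by $A_\varphi\widehat G=\widehat{\varphi\star G}$; under (1)–(3) it is essentially selfadjoint, and $A_\varphi^\sim$ denotes its closure. Under (1)–(3) a probability measure $\mu$ with the properties described in the claim exists. **Wick powers.** For $\omega\in\mathcal D'$, ${:}\omega^{\otimes n}{:}\in\mathcal D'^{\widehat\otimes n}$ is defined by ${:}\omega^{\otimes 0}{:}=1$, ${:}\omega^{\otimes1}{:}=\omega$, and, for all $\varphi\in\mathcal D$, $$\langle\varphi^{\otimes(n+1)},{:}\omega^{\otimes(n+1)}{:}\rangle=\tfrac1{n+1}\big[\langle\varphi^{\otimes(n+1)},{:}\omega^{\otimes n}{:}\,\widehat\otimes\,\omega\rangle-n\langle(\varphi^2)\widehat\otimes\varphi^{\otimes(n-1)},{:}\omega^{\otimes n}{:}\rangle\big].$$ **Configuration space, $K$-transform, correlation measure.** $\Gamma_X=\{\gamma\subset X: |\gamma\cap\Lambda|<\infty\text{ for each compact }\Lambda\subset X\}$. Each $\gamma\in\Gamma_X$ is identified with the Radon measure $\sum_{x\in\gamma}\delta_x$ (zero measure if $\gamma=\varnothing$), hence with an element of $\mathcal D'$; $\Gamma_X$ is a measurable subset of $\mathcal D'$. The $K$-transform of a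 function $G$ on $\Gamma_{X,0}$ is the function $\gamma\mapsto\sum_{\eta\Subset\gamma}G(\eta)$ on $\Gamma_X$, the sum being over all finite subsets $\eta$ of $\gamma$ (whenever it makes sense, e.g. for $G\ge0$ measurable or $G\in\mathcal F_{\rm fin}(\mathcal D)$). The correlation measure of a probability measure $\mu$ on $\Gamma_X$ is the measure $\rho_\mu$ on $\Gamma_{X,0}$ determined by $\int_{\Gamma_X}\sum_{\eta\Subset\gamma}G(\eta)\,\mu(d\gamma)=\int_{\Gamma_{X,0}}G(\eta)\,\rho_\mu(d\eta)$ for all measurable $G\ge0$ on $\Gamma_{X,0}$. *)

theory Defs
  imports "HOL-Probability.Probability" "HOL-Library.Multiset"
begin

section \<open>Smooth functions in coordinates\<close>

text \<open>
  A point of a power \<open>S\<^sup>n\<close> is encoded as a function on \<open>nat\<close>, of which only the values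
  at \<open>0, \<dots>, n - 1\<close> matter, and a function on \<open>S\<^sup>n\<close> as a function on \<open>nat \<Rightarrow> S\<close> that ignores
  the coordinates from \<open>n\<close> on.  The product topology on \<open>nat \<Rightarrow> S\<close> then induces the topology
  of \<open>S\<^sup>n\<close>.

  A pair \<open>(i, k)\<close> stands for the partial derivative in the \<open>k\<close>-th component of the
  \<open>i\<close>-th variable.
\<close>

definition pd_path :: "nat \<times> 'd \<Rightarrow> (nat \<Rightarrow> real^'d::finite) \<Rightarrow> real \<Rightarrow> (nat \<Rightarrow> real^'d)" where
  "pd_path p y t = y(fst p := y (fst p) + t *\<^sub>R axis (snd p) 1)"

definition pd ::
  "nat \<times> 'd \<Rightarrow> ((nat \<Rightarrow> real^'d::finite) \<Rightarrow> 'b::real_normed_vector) \<Rightarrow> (nat \<Rightarrow> real^'d) \<Rightarrow> 'b" where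
  "pd p F y = vector_derivative (\<lambda>t. F (pd_path p y t)) (at 0)"

definition pds ::
  "(nat \<times> 'd) list \<Rightarrow> ((nat \<Rightarrow> real^'d::finite) \<Rightarrow> 'b::real_normed_vector) \<Rightarrow> (nat \<Rightarrow> real^'d) \<Rightarrow> 'b" where
  "pds ps F = foldr pd ps F"

text \<open>All iterated partial derivatives exist and are continuous on \<open>S\<close> (used for open \<open>S\<close>).\<close>

definition smooth_coord ::
  "nat \<Rightarrow> (nat \<Rightarrow> real^'d::finite) set \<Rightarrow> ((nat \<Rightarrow> real^'d) \<Rightarrow> 'b::real_normed_vector) \<Rightarrow> bool" where
  "smooth_coord n S F \<longleftrightarrow>
     (\<forall>ps \<in> lists ({..<n} \<times> UNIV).
        continuous_on S (pds ps F) \<and>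
        (\<forall>p \<in> {..<n} \<times> UNIV. \<forall>y \<in> S. (\<lambda>t. pds ps F (pd_path p y t)) differentiable (at 0)))"

definition smooth_map :: "(real^'d::finite) set \<Rightarrow> (real^'d \<Rightarrow> 'b::real_normed_vector) \<Rightarrow> bool" where
  "smooth_map S f \<longleftrightarrow> smooth_coord 1 {y. y 0 \<in> S} (\<lambda>y. f (y 0))"


section \<open>Oriented Riemannian manifolds\<close>

text \<open>
  The manifold is the whole type \<open>'a\<close>; its smooth structure and its orientation are given by
  an (oriented) atlas, which need not be maximal.
\<close>

type_synonym ('a, 'd) chart = "'a set \<times> ('a \<Rightarrow> real^'d)"

definition target :: "('a, 'd::finite) chart \<Rightarrow> (real^'d) set" where
  "target c = snd c ` fst c"

definition chart_inv :: "('a, 'd::finite) chart \<Rightarrow> real^'d \<Rightarrow> 'a" where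
  "chart_inv c = inv_into (fst c) (snd c)"

definition is_chart :: "('a::topological_space, 'd::finite) chart \<Rightarrow> bool" where
  "is_chart c \<longleftrightarrow> open (fst c) \<and> open (target c) \<and>
     homeomorphism (fst c) (target c) (snd c) (chart_inv c)"

definition transition :: "('a, 'd::finite) chart \<Rightarrow> ('a, 'd) chart \<Rightarrow> real^'d \<Rightarrow> real^'d" where
  "transition c c' = snd c' \<circ> chart_inv c"

definition smooth_atlas :: "('a::topological_space, 'd::finite) chart set \<Rightarrow> bool" where
  "smooth_atlas A \<longleftrightarrow> (\<forall>c\<in>A. is_chart c) \<and> (\<Union>c\<in>A. fst c) = UNIV \<and>
     (\<forall>c\<in>A. \<forall>c'\<in>A. smooth_map (snd c ` (fst c \<inter> fst c')) (transition c c'))"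

definition oriented_atlas :: "('a::topological_space, 'd::finite) chart set \<Rightarrow> bool" where
  "oriented_atlas A \<longleftrightarrow> smooth_atlas A \<and>
     (\<forall>c\<in>A. \<forall>c'\<in>A. \<forall>x \<in> fst c \<inter> fst c'.
        det (matrix (frechet_derivative (transition c c') (at (snd c x)))) > 0)"

text \<open>\<open>g c x\<close> is the inner product on the tangent space at \<open>x\<close>, expressed in the chart \<open>c\<close>.\<close>

definition riemannian_metric ::
  "('a::topological_space, 'd::finite) chart set \<Rightarrow>
   (('a, 'd) chart \<Rightarrow> 'a \<Rightarrow> real^'d \<Rightarrow> real^'d \<Rightarrow> real) \<Rightarrow> bool" where
  "riemannian_metric A g \<longleftrightarrow>
     (\<forall>c\<in>A. \<forall>x\<in>fst c. bilinear (g c x) \<and> (\<forall>v w. g c x v w = g c x w v) \<and>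
        (\<forall>v. v \<noteq> 0 \<longrightarrow> g c x v v > 0)) \<and>
     (\<forall>c\<in>A. \<forall>i j. smooth_map (target c) (\<lambda>y. g c (chart_inv c y) (axis i 1) (axis j 1))) \<and>
     (\<forall>c\<in>A. \<forall>c'\<in>A. \<forall>x \<in> fst c \<inter> fst c'. \<forall>v w.
        g c x v w =
        g c' x (frechet_derivative (transition c c') (at (snd c x)) v)
               (frechet_derivative (transition c c') (at (snd c x)) w))"


section \<open>Test functions on powers of the manifold\<close>

definition local_rep ::
  "(nat \<Rightarrow> ('a, 'd::finite) chart) \<Rightarrow> ((nat \<Rightarrow> 'a) \<Rightarrow> 'b) \<Rightarrow> (nat \<Rightarrow> real^'d) \<Rightarrow> 'b" where
  "local_rep c f y = f (\<lambda>i. chart_inv (c i) (y i))"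

definition smooth_fun ::
  "('a, 'd::finite) chart set \<Rightarrow> nat \<Rightarrow> ((nat \<Rightarrow> 'a) \<Rightarrow> 'b::real_normed_vector) \<Rightarrow> bool" where
  "smooth_fun A n f \<longleftrightarrow>
     (\<forall>c \<in> {..<n} \<rightarrow> A. smooth_coord n {y. \<forall>i<n. y i \<in> target (c i)} (local_rep c f))"

definition supported :: "nat \<Rightarrow> 'a set \<Rightarrow> ((nat \<Rightarrow> 'a) \<Rightarrow> 'b::zero) \<Rightarrow> bool" where
  "supported n L f \<longleftrightarrow> (\<forall>x. f x \<noteq> 0 \<longrightarrow> (\<forall>i<n. x i \<in> L))"

definition test_power ::
  "('a::topological_space, 'd::finite) chart set \<Rightarrow> nat \<Rightarrow>
   ((nat \<Rightarrow> 'a) \<Rightarrow> 'b::real_normed_vector) set" where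
  "test_power A n = {f. (\<forall>x x'. (\<forall>i<n. x i = x' i) \<longrightarrow> f x = f x') \<and> smooth_fun A n f \<and>
     (\<exists>L. compact L \<and> supported n L f)}"

text \<open>
  The usual topology of the space of test functions on \<open>X\<^sup>n\<close>: the locally convex inductive limit
  of its subspaces of functions supported in \<open>L\<^sup>n\<close> (\<open>L\<close> compact), each with the topology of uniform
  convergence of all derivatives on compact sets.  \<open>seminorm_ball A n L P e\<close> is a basic
  neighbourhood of zero in such a subspace; each member of \<open>P\<close> consists of charts
  \<open>c 0, \<dots>, c (n-1)\<close>, compact subsets \<open>B i\<close> of their domains and a mixed partial derivative.
  \<open>lf_nbhd\<close> describes the absolutely convex neighbourhoods of zero in the limit.
\<close>

definition seminorm_indices ::
  "('a::topological_space, 'd::finite) chart set \<Rightarrow> nat \<Rightarrow>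
   ((nat \<Rightarrow> ('a, 'd) chart) \<times> (nat \<Rightarrow> 'a set) \<times> (nat \<times> 'd) list) set" where
  "seminorm_indices A n = {(c, B, ps).
     (\<forall>i<n. c i \<in> A \<and> compact (B i) \<and> B i \<subseteq> fst (c i)) \<and> ps \<in> lists ({..<n} \<times> UNIV)}"

definition seminorm_ball ::
  "('a::topological_space, 'd::finite) chart set \<Rightarrow> nat \<Rightarrow> 'a set \<Rightarrow>
   ((nat \<Rightarrow> ('a, 'd) chart) \<times> (nat \<Rightarrow> 'a set) \<times> (nat \<times> 'd) list) set \<Rightarrow> real \<Rightarrow>
   ((nat \<Rightarrow> 'a) \<Rightarrow> real) set" where
  "seminorm_ball A n L P e = {f \<in> test_power A n. supported n L f \<and>
     (\<forall>(c, B, ps) \<in> P. \<forall>y. (\<forall>i<n. y i \<in> snd (c i) ` B i) \<longrightarrow> \<bar>pds ps (local_rep c f) y\<bar> < e)}"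

definition lf_nbhd ::
  "('a::topological_space, 'd::finite) chart set \<Rightarrow> nat \<Rightarrow> ((nat \<Rightarrow> 'a) \<Rightarrow> real) set \<Rightarrow> bool" where
  "lf_nbhd A n V \<longleftrightarrow> V \<subseteq> test_power A n \<and>
     (\<forall>u\<in>V. \<forall>v\<in>V. \<forall>a b. \<bar>a\<bar> + \<bar>b\<bar> \<le> 1 \<longrightarrow> (\<lambda>x. a * u x + b * v x) \<in> V) \<and>
     (\<forall>L. compact L \<longrightarrow>
        (\<exists>P e. finite P \<and> P \<subseteq> seminorm_indices A n \<and> e > 0 \<and> seminorm_ball A n L P e \<subseteq> V))"

definition test_topology ::
  "('a::topological_space, 'd::finite) chart set \<Rightarrow> nat \<Rightarrow> ((nat \<Rightarrow> 'a) \<Rightarrow> real) topology" where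
  "test_topology A n = topology (\<lambda>U. U \<subseteq> test_power A n \<and>
     (\<forall>f\<in>U. \<exists>V. lf_nbhd A n V \<and> (\<forall>v\<in>V. (\<lambda>x. f x + v x) \<in> U)))"

lemma seminorm_ball_mono:
  assumes "P \<subseteq> Q" "d \<le> e"
  shows "seminorm_ball A n L Q d \<subseteq> seminorm_ball A n L P e"
proof
  fix f assume f: "f \<in> seminorm_ball A n L Q d"
  have "\<bar>pds ps (local_rep c f) y\<bar> < e"
    if "(c, B, ps) \<in> P" "\<forall>i<n. y i \<in> snd (c i) ` B i" for c B ps y
  proof -
    have "(c, B, ps) \<in> Q" using that(1) assms(1) by (rule subsetD[rotated])
    then have "\<bar>pds ps (local_rep c f) y\<bar> < d"
      using f that(2) unfolding seminorm_ball_def by blast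
    then show ?thesis using assms(2) by linarith
  qed
  then show "f \<in> seminorm_ball A n L P e"
    using f unfolding seminorm_ball_def by blast
qed

lemma lf_nbhd_Int:
  assumes "lf_nbhd A n V" "lf_nbhd A n W"
  shows "lf_nbhd A n (V \<inter> W)"
proof -
  have "\<exists>P e. finite P \<and> P \<subseteq> seminorm_indices A n \<and> e > 0 \<and> seminorm_ball A n L P e \<subseteq> V \<inter> W"
    if L: "compact L" for L
  proof -
    obtain P e where P: "finite P" "P \<subseteq> seminorm_indices A n" "e > 0" "seminorm_ball A n L P e \<subseteq> V"
      using assms(1) L unfolding lf_nbhd_def by metis
    obtain Q d where Q: "finite Q" "Q \<subseteq> seminorm_indices A n" "d > 0" "seminorm_ball A n L Q d \<subseteq> W"
      using assms(2) L unfolding lf_nbhd_def by metis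
    have "seminorm_ball A n L (P \<union> Q) (min e d) \<subseteq> seminorm_ball A n L P e"
      "seminorm_ball A n L (P \<union> Q) (min e d) \<subseteq> seminorm_ball A n L Q d"
      by (rule seminorm_ball_mono; simp)+
    then have "seminorm_ball A n L (P \<union> Q) (min e d) \<subseteq> V \<inter> W"
      using P(4) Q(4) by blast
    then show ?thesis
      using P(1-3) Q(1-3) by (intro exI[of _ "P \<union> Q"] exI[of _ "min e d"] conjI) simp_all
  qed
  note nb = this
  have sub: "V \<inter> W \<subseteq> test_power A n"
    using assms(1) unfolding lf_nbhd_def by (elim conjE) (rule le_infI1)
  have V: "\<forall>u\<in>V. \<forall>v\<in>V. \<forall>a b. \<bar>a\<bar> + \<bar>b\<bar> \<le> 1 \<longrightarrow> (\<lambda>x. a * u x + b * v x) \<in> V"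
    using assms(1) unfolding lf_nbhd_def by (elim conjE)
  have W: "\<forall>u\<in>W. \<forall>v\<in>W. \<forall>a b. \<bar>a\<bar> + \<bar>b\<bar> \<le> 1 \<longrightarrow> (\<lambda>x. a * u x + b * v x) \<in> W"
    using assms(2) unfolding lf_nbhd_def by (elim conjE)
  show ?thesis
    unfolding lf_nbhd_def
  proof (intro conjI ballI allI impI)
    fix u v and a b :: real
    assume uv: "u \<in> V \<inter> W" "v \<in> V \<inter> W" "\<bar>a\<bar> + \<bar>b\<bar> \<le> 1"
    show "(\<lambda>x. a * u x + b * v x) \<in> V \<inter> W"
      using V[rule_format, OF _ _ uv(3)] W[rule_format, OF _ _ uv(3)] uv(1,2) by simp
  qed (use sub nb in simp_all)
qed

lemma openin_test_topology:
  "openin (test_topology A n) U \<longleftrightarrow> U \<subseteq> test_power A n \<and>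
     (\<forall>f\<in>U. \<exists>V. lf_nbhd A n V \<and> (\<forall>v\<in>V. (\<lambda>x. f x + v x) \<in> U))"
proof -
  have "istopology (\<lambda>U. U \<subseteq> test_power A n \<and>
     (\<forall>f\<in>U. \<exists>V. lf_nbhd A n V \<and> (\<forall>v\<in>V. (\<lambda>x. f x + v x) \<in> U)))"
    unfolding istopology_def
  proof (intro conjI allI impI ballI)
    fix S T f
    assume S: "S \<subseteq> test_power A n \<and>
        (\<forall>f\<in>S. \<exists>V. lf_nbhd A n V \<and> (\<forall>v\<in>V. (\<lambda>x. f x + v x) \<in> S))"
      and T: "T \<subseteq> test_power A n \<and>
        (\<forall>f\<in>T. \<exists>V. lf_nbhd A n V \<and> (\<forall>v\<in>V. (\<lambda>x. f x + v x) \<in> T))"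
    show "S \<inter> T \<subseteq> test_power A n" using S by blast
    assume f: "f \<in> S \<inter> T"
    obtain V where V: "lf_nbhd A n V" "\<forall>v\<in>V. (\<lambda>x. f x + v x) \<in> S" using S f by blast
    obtain W where W: "lf_nbhd A n W" "\<forall>v\<in>W. (\<lambda>x. f x + v x) \<in> T" using T f by blast
    show "\<exists>V. lf_nbhd A n V \<and> (\<forall>v\<in>V. (\<lambda>x. f x + v x) \<in> S \<inter> T)"
      using lf_nbhd_Int[OF V(1) W(1)] V(2) W(2) by (intro exI[of _ "V \<inter> W"]) auto
  next
    fix \<K> :: "((nat \<Rightarrow> 'a) \<Rightarrow> real) set set"
    assume K: "\<forall>S\<in>\<K>. S \<subseteq> test_power A n \<and>
        (\<forall>f\<in>S. \<exists>V. lf_nbhd A n V \<and> (\<forall>v\<in>V. (\<lambda>x. f x + v x) \<in> S))"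
    then show "\<Union>\<K> \<subseteq> test_power A n" by blast
    fix f assume "f \<in> \<Union>\<K>"
    then obtain S where "S \<in> \<K>" "f \<in> S" by blast
    then obtain V where "lf_nbhd A n V" "\<forall>v\<in>V. (\<lambda>x. f x + v x) \<in> S" using K by blast
    then show "\<exists>V. lf_nbhd A n V \<and> (\<forall>v\<in>V. (\<lambda>x. f x + v x) \<in> \<Union>\<K>)"
      using \<open>S \<in> \<K>\<close> by (intro exI[of _ V] conjI) (simp, blast)
  qed
  then show ?thesis unfolding test_topology_def by simp
qed

definition cont_dual :: "('s \<Rightarrow> real) set \<Rightarrow> ('s \<Rightarrow> real) topology \<Rightarrow> (('s \<Rightarrow> real) \<Rightarrow> real) set" where
  "cont_dual V T = {w \<in> extensional V.
     (\<forall>u\<in>V. \<forall>v\<in>V. \<forall>a b. w (\<lambda>x. a * u x + b * v x) = a * w u + b * w v) \<and>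
     continuous_map T euclideanreal w}"

text \<open>The space \<open>\<D>\<close>, its dual, and the cylinder \<open>\<sigma>\<close>-algebra.\<close>

definition test_fun :: "('a::topological_space, 'd::finite) chart set \<Rightarrow> ('a \<Rightarrow> real) set" where
  "test_fun A = {\<phi>. (\<lambda>x. \<phi> (x 0)) \<in> test_power A 1}"

definition distributions ::
  "('a::topological_space, 'd::finite) chart set \<Rightarrow> (('a \<Rightarrow> real) \<Rightarrow> real) set" where
  "distributions A = cont_dual (test_fun A)
     (pullback_topology (test_fun A) (\<lambda>\<phi> x. \<phi> (x 0)) (test_topology A 1))"

definition cylinder ::
  "('a::topological_space, 'd::finite) chart set \<Rightarrow> (('a \<Rightarrow> real) \<Rightarrow> real) measure" where
  "cylinder A = sigma (distributions A)
     {{\<omega> \<in> distributions A. \<omega> \<phi> \<in> B} | \<phi> B. \<phi> \<in> test_fun A \<and> B \<in> sets borel}"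


section \<open>Finite configurations and symmetric functions\<close>

text \<open>
  A multiset of size \<open>n\<close> is an element of \<open>X\<^sup>n/S\<^sub>n\<close>, so \<open>'a multiset\<close> is the space of multiple finite
  configurations.  \<open>cfg x I\<close> is the class of the family \<open>(x i)\<close>, \<open>i \<in> I\<close>.
\<close>

definition cfg :: "(nat \<Rightarrow> 'a) \<Rightarrow> nat set \<Rightarrow> 'a multiset" where
  "cfg x I = image_mset x (mset_set I)"

text \<open>Disjoint union of the quotient topologies on the sets of multisets of size \<open>n\<close>.\<close>

definition mconf_topology :: "'a::topological_space multiset topology" where
  "mconf_topology = topology (\<lambda>V. \<forall>n. open {x. cfg x {..<n} \<in> V})"

lemma openin_mconf_topology:
  "openin mconf_topology V \<longleftrightarrow> (\<forall>n. open {x. cfg x {..<n} \<in> V})"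
proof -
  have "istopology (\<lambda>V :: 'a multiset set. \<forall>n. open {x. cfg x {..<n} \<in> V})"
    unfolding istopology_def
  proof (intro conjI allI impI)
    fix S T :: "'a multiset set" and n
    assume "\<forall>n. open {x. cfg x {..<n} \<in> S}" "\<forall>n. open {x. cfg x {..<n} \<in> T}"
    then have "open ({x. cfg x {..<n} \<in> S} \<inter> {x. cfg x {..<n} \<in> T})" by blast
    then show "open {x. cfg x {..<n} \<in> S \<inter> T}" by (simp add: Collect_conj_eq)
  next
    fix \<K> :: "'a multiset set set" and n
    assume "\<forall>S\<in>\<K>. \<forall>n. open {x. cfg x {..<n} \<in> S}"
    then have "open (\<Union>S\<in>\<K>. {x. cfg x {..<n} \<in> S})" by blast
    moreover have "(\<Union>S\<in>\<K>. {x. cfg x {..<n} \<in> S}) = {x. cfg x {..<n} \<in> \<Union>\<K>}" by auto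
    ultimately show "open {x. cfg x {..<n} \<in> \<Union>\<K>}" by simp
  qed
  then show ?thesis unfolding mconf_topology_def by simp
qed

text \<open>Simple finite configurations are finite sets, embedded by \<open>mset_set\<close>.\<close>

definition conf_topology :: "'a::topological_space set topology" where
  "conf_topology = pullback_topology {\<eta>. finite \<eta>} mset_set mconf_topology"

definition conf_borel :: "'a::topological_space set measure" where
  "conf_borel = sigma {\<eta>. finite \<eta>} {U. openin conf_topology U}"

definition nconf :: "'a set \<Rightarrow> nat \<Rightarrow> 'a set set" where
  "nconf \<Lambda> n = {\<eta>. finite \<eta> \<and> card \<eta> = n \<and> \<eta> \<subseteq> \<Lambda>}"

text \<open>
  A symmetric function of \<open>n\<close> variables is a function on multisets vanishing off those
  of size \<open>n\<close>.  With complex values, \<open>sym_test A n\<close> is the space \<open>\<F>\<^sub>n(\<D>)\<close>.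
\<close>

definition sym_test ::
  "('a::topological_space, 'd::finite) chart set \<Rightarrow> nat \<Rightarrow> ('a multiset \<Rightarrow> 'b::real_normed_vector) set" where
  "sym_test A n = {F. (\<forall>\<eta>. size \<eta> \<noteq> n \<longrightarrow> F \<eta> = 0) \<and> (\<lambda>x. F (cfg x {..<n})) \<in> test_power A n}"

definition sym_dual ::
  "('a::topological_space, 'd::finite) chart set \<Rightarrow> nat \<Rightarrow> (('a multiset \<Rightarrow> real) \<Rightarrow> real) set" where
  "sym_dual A n = cont_dual (sym_test A n)
     (pullback_topology (sym_test A n) (\<lambda>F x. F (cfg x {..<n})) (test_topology A n))"

text \<open>
  A finite sequence of symmetric functions is a single function on multisets; its \<open>n\<close>-th entry
  is its restriction to multisets of size \<open>n\<close>.
\<close>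

definition part :: "nat \<Rightarrow> ('a multiset \<Rightarrow> 'b::zero) \<Rightarrow> 'a multiset \<Rightarrow> 'b" where
  "part n G \<eta> = (if size \<eta> = n then G \<eta> else 0)"

definition F_fin :: "('a::topological_space, 'd::finite) chart set \<Rightarrow> ('a multiset \<Rightarrow> complex) set" where
  "F_fin A = {G. (\<forall>n. part n G \<in> sym_test A n) \<and> (\<exists>N. \<forall>n>N. part n G = (\<lambda>_. 0))}"

definition tensor_power :: "('a \<Rightarrow> 'b::comm_semiring_1) \<Rightarrow> nat \<Rightarrow> 'a multiset \<Rightarrow> 'b" where
  "tensor_power \<phi> n \<eta> = (if size \<eta> = n then (\<Prod>x\<in>#\<eta>. \<phi> x) else 0)"

definition sym_tensor :: "('a \<Rightarrow> real) \<Rightarrow> ('a multiset \<Rightarrow> real) \<Rightarrow> 'a multiset \<Rightarrow> real" where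
  "sym_tensor f F \<eta> = (\<Sum>x\<in>#\<eta>. f x * F (\<eta> - {#x#})) / size \<eta>"


section \<open>Wick powers\<close>

text \<open>
  The symmetric tensor product of a functional \<open>w\<close> of degree \<open>n\<close> with a distribution \<open>\<omega>\<close>,
  acting on symmetric functions of \<open>n + 1\<close> variables.
\<close>

definition dist_tensor ::
  "nat \<Rightarrow> (('a multiset \<Rightarrow> real) \<Rightarrow> real) \<Rightarrow> (('a \<Rightarrow> real) \<Rightarrow> real) \<Rightarrow> ('a multiset \<Rightarrow> real) \<Rightarrow> real" where
  "dist_tensor n w \<omega> F = w (part n (\<lambda>\<eta>. \<omega> (\<lambda>x. F (add_mset x \<eta>))))"

text \<open>
  A functional in \<open>sym_dual A (Suc n)\<close> is determined by its values on the powers of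
  test functions, hence the definite description.
\<close>

primrec wick ::
  "('a::topological_space, 'd::finite) chart set \<Rightarrow> (('a \<Rightarrow> real) \<Rightarrow> real) \<Rightarrow> nat \<Rightarrow>
   ('a multiset \<Rightarrow> real) \<Rightarrow> real" where
  "wick A \<omega> 0 = restrict (\<lambda>F. F {#}) (sym_test A 0)"
| "wick A \<omega> (Suc n) = (THE w. w \<in> sym_dual A (Suc n) \<and>
     (\<forall>\<phi> \<in> test_fun A.
        w (tensor_power \<phi> (Suc n)) =
          (dist_tensor n (wick A \<omega> n) \<omega> (tensor_power \<phi> (Suc n))
           - real n * wick A \<omega> n (sym_tensor (\<lambda>x. (\<phi> x)\<^sup>2) (tensor_power \<phi> (n - 1))))
          / real (Suc n)))"

definition pairing :: "('a multiset \<Rightarrow> complex) \<Rightarrow> (('a multiset \<Rightarrow> real) \<Rightarrow> real) \<Rightarrow> complex" where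
  "pairing G w = Complex (w (\<lambda>\<eta>. Re (G \<eta>))) (w (\<lambda>\<eta>. Im (G \<eta>)))"

definition wick_series ::
  "('a::topological_space, 'd::finite) chart set \<Rightarrow> ('a multiset \<Rightarrow> complex) \<Rightarrow> (('a \<Rightarrow> real) \<Rightarrow> real) \<Rightarrow> complex" where
  "wick_series A G \<omega> = (\<Sum>n. pairing (part n G) (wick A \<omega> n))"


section \<open>The convolution and the form \<open>a\<^sub>\<rho>\<close>\<close>

definition P3 :: "nat set \<Rightarrow> (nat set \<times> nat set \<times> nat set) set" where
  "P3 I = {(a, b, c). a \<union> b \<union> c = I \<and> a \<inter> b = {} \<and> a \<inter> c = {} \<and> b \<inter> c = {}}"

text \<open>The sum does not depend on the chosen enumeration \<open>x\<close> of \<open>\<eta>\<close>.\<close>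

definition conv ::
  "('a multiset \<Rightarrow> complex) \<Rightarrow> ('a multiset \<Rightarrow> complex) \<Rightarrow> 'a multiset \<Rightarrow> complex"  (infixl "\<star>" 70) where
  "(G\<^sub>1 \<star> G\<^sub>2) \<eta> = (let x = (SOME x. cfg x {..<size \<eta>} = \<eta>) in
     \<Sum>(\<xi>\<^sub>1, \<xi>\<^sub>2, \<xi>\<^sub>3) \<in> P3 {..<size \<eta>}. G\<^sub>1 (cfg x (\<xi>\<^sub>1 \<union> \<xi>\<^sub>2)) * G\<^sub>2 (cfg x (\<xi>\<^sub>2 \<union> \<xi>\<^sub>3)))"

definition a_form ::
  "'a set measure \<Rightarrow> ('a multiset \<Rightarrow> complex) \<Rightarrow> ('a multiset \<Rightarrow> complex) \<Rightarrow> complex" where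
  "a_form \<rho> G\<^sub>1 G\<^sub>2 = (\<integral>\<eta>. (G\<^sub>1 \<star> G\<^sub>2) (mset_set \<eta>) \<partial>\<rho>)"


section \<open>Complex inner product spaces: quotients, completions, operators\<close>

record 'v ipspace =
  carr :: "'v set"
  vadd :: "'v \<Rightarrow> 'v \<Rightarrow> 'v"
  vscale :: "complex \<Rightarrow> 'v \<Rightarrow> 'v"
  vip :: "'v \<Rightarrow> 'v \<Rightarrow> complex"

definition vdist :: "('v, 'm) ipspace_scheme \<Rightarrow> 'v \<Rightarrow> 'v \<Rightarrow> real" where
  "vdist H x y = (let z = vadd H x (vscale H (-1) y) in sqrt (Re (vip H z z)))"

text \<open>The quotient of a space \<open>V\<close> of functions by the kernel of a semi-inner product \<open>s\<close>.\<close>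

definition qclass ::
  "('s \<Rightarrow> complex) set \<Rightarrow> (('s \<Rightarrow> complex) \<Rightarrow> ('s \<Rightarrow> complex) \<Rightarrow> complex) \<Rightarrow> ('s \<Rightarrow> complex) \<Rightarrow>
   ('s \<Rightarrow> complex) set" where
  "qclass V s f = {g \<in> V. s (\<lambda>x. g x - f x) (\<lambda>x. g x - f x) = 0}"

definition quotient_space ::
  "('s \<Rightarrow> complex) set \<Rightarrow> (('s \<Rightarrow> complex) \<Rightarrow> ('s \<Rightarrow> complex) \<Rightarrow> complex) \<Rightarrow>
   ('s \<Rightarrow> complex) set ipspace" where
  "quotient_space V s = \<lparr>
     carr = qclass V s ` V,
     vadd = (\<lambda>X Y. \<Union>f\<in>X. \<Union>g\<in>Y. qclass V s (\<lambda>x. f x + g x)),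
     vscale = (\<lambda>c X. \<Union>f\<in>X. qclass V s (\<lambda>x. c * f x)),
     vip = (\<lambda>X Y. THE z. \<exists>f\<in>X. \<exists>g\<in>Y. z = s f g) \<rparr>"

text \<open>The completion by Cauchy sequences modulo null sequences.\<close>

definition cauchy_seqs :: "('v, 'm) ipspace_scheme \<Rightarrow> (nat \<Rightarrow> 'v) set" where
  "cauchy_seqs P = {u. (\<forall>n. u n \<in> carr P) \<and>
     (\<forall>e>0. \<exists>N. \<forall>m\<ge>N. \<forall>n\<ge>N. vdist P (u m) (u n) < e)}"

definition cclass :: "('v, 'm) ipspace_scheme \<Rightarrow> (nat \<Rightarrow> 'v) \<Rightarrow> (nat \<Rightarrow> 'v) set" where
  "cclass P u = {v \<in> cauchy_seqs P. (\<lambda>n. vdist P (v n) (u n)) \<longlonglongrightarrow> 0}"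

definition completion :: "'v ipspace \<Rightarrow> (nat \<Rightarrow> 'v) set ipspace" where
  "completion P = \<lparr>
     carr = cclass P ` cauchy_seqs P,
     vadd = (\<lambda>X Y. \<Union>u\<in>X. \<Union>v\<in>Y. cclass P (\<lambda>n. vadd P (u n) (v n))),
     vscale = (\<lambda>c X. \<Union>u\<in>X. cclass P (\<lambda>n. vscale P c (u n))),
     vip = (\<lambda>X Y. THE z. \<exists>u\<in>X. \<exists>v\<in>Y. (\<lambda>n. vip P (u n) (v n)) \<longlonglongrightarrow> z) \<rparr>"

definition unitary_iso :: "'v ipspace \<Rightarrow> 'w ipspace \<Rightarrow> ('v \<Rightarrow> 'w) \<Rightarrow> bool" where
  "unitary_iso H H' U \<longleftrightarrow> bij_betw U (carr H) (carr H') \<and>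
     (\<forall>x\<in>carr H. \<forall>y\<in>carr H. U (vadd H x y) = vadd H' (U x) (U y)) \<and>
     (\<forall>c. \<forall>x\<in>carr H. U (vscale H c x) = vscale H' c (U x)) \<and>
     (\<forall>x\<in>carr H. \<forall>y\<in>carr H. vip H' (U x) (U y) = vip H x y)"

text \<open>Operators are represented by their graphs.\<close>

definition op_closure :: "'v ipspace \<Rightarrow> ('v \<times> 'v) set \<Rightarrow> ('v \<times> 'v) set" where
  "op_closure H T = {(x, y) \<in> carr H \<times> carr H. \<exists>u v. (\<forall>n. (u n, v n) \<in> T) \<and>
     (\<lambda>n. vdist H (u n) x) \<longlonglongrightarrow> 0 \<and> (\<lambda>n. vdist H (v n) y) \<longlonglongrightarrow> 0}"

definition op_conj :: "('v \<Rightarrow> 'w) \<Rightarrow> ('v \<times> 'v) set \<Rightarrow> ('w \<times> 'w) set" where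
  "op_conj U T = map_prod U U ` T"


section \<open>The spaces \<open>\<H>\<^sub>\<rho>\<close> and \<open>L\<^sup>2\<close>\<close>

definition F_hat ::
  "('a::topological_space, 'd::finite) chart set \<Rightarrow> 'a set measure \<Rightarrow> ('a multiset \<Rightarrow> complex) set ipspace" where
  "F_hat A \<rho> = quotient_space (F_fin A) (\<lambda>G\<^sub>1 G\<^sub>2. a_form \<rho> G\<^sub>1 (\<lambda>\<eta>. cnj (G\<^sub>2 \<eta>)))"

definition H_rho ::
  "('a::topological_space, 'd::finite) chart set \<Rightarrow> 'a set measure \<Rightarrow>
   (nat \<Rightarrow> ('a multiset \<Rightarrow> complex) set) set ipspace" where
  "H_rho A \<rho> = completion (F_hat A \<rho>)"

definition hat ::
  "('a::topological_space, 'd::finite) chart set \<Rightarrow> 'a set measure \<Rightarrow> ('a multiset \<Rightarrow> complex) \<Rightarrow>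
   (nat \<Rightarrow> ('a multiset \<Rightarrow> complex) set) set" where
  "hat A \<rho> G = cclass (F_hat A \<rho>)
     (\<lambda>_. qclass (F_fin A) (\<lambda>G\<^sub>1 G\<^sub>2. a_form \<rho> G\<^sub>1 (\<lambda>\<eta>. cnj (G\<^sub>2 \<eta>))) G)"

definition A_op ::
  "('a::topological_space, 'd::finite) chart set \<Rightarrow> 'a set measure \<Rightarrow> ('a \<Rightarrow> real) \<Rightarrow>
   ((nat \<Rightarrow> ('a multiset \<Rightarrow> complex) set) set \<times> (nat \<Rightarrow> ('a multiset \<Rightarrow> complex) set) set) set" where
  "A_op A \<rho> \<phi> =
     {(hat A \<rho> G, hat A \<rho> (tensor_power (\<lambda>x. complex_of_real (\<phi> x)) 1 \<star> G)) | G. G \<in> F_fin A}"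

definition sq_integrable :: "'w measure \<Rightarrow> ('w \<Rightarrow> complex) set" where
  "sq_integrable M = {f \<in> borel_measurable M. integrable M (\<lambda>\<omega>. (cmod (f \<omega>))\<^sup>2)}"

definition L2_ip :: "'w measure \<Rightarrow> ('w \<Rightarrow> complex) \<Rightarrow> ('w \<Rightarrow> complex) \<Rightarrow> complex" where
  "L2_ip M f g = (\<integral>\<omega>. f \<omega> * cnj (g \<omega>) \<partial>M)"

definition L2_class :: "'w measure \<Rightarrow> ('w \<Rightarrow> complex) \<Rightarrow> ('w \<Rightarrow> complex) set" where
  "L2_class M = qclass (sq_integrable M) (L2_ip M)"

definition L2 :: "'w measure \<Rightarrow> ('w \<Rightarrow> complex) set ipspace" where
  "L2 M = quotient_space (sq_integrable M) (L2_ip M)"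

definition mult_op ::
  "'w measure \<Rightarrow> ('w \<Rightarrow> real) \<Rightarrow> (('w \<Rightarrow> complex) set \<times> ('w \<Rightarrow> complex) set) set" where
  "mult_op M h = {(L2_class M f, L2_class M (\<lambda>\<omega>. complex_of_real (h \<omega>) * f \<omega>)) | f.
     f \<in> sq_integrable M \<and> (\<lambda>\<omega>. complex_of_real (h \<omega>) * f \<omega>) \<in> sq_integrable M}"


section \<open>Infinite configurations, \<open>K\<close>-transform, correlation measure\<close>

definition configs :: "'a::topological_space set set" where
  "configs = {\<gamma>. \<forall>\<Lambda>. compact \<Lambda> \<longrightarrow> finite (\<gamma> \<inter> \<Lambda>)}"

text \<open>The distribution \<open>\<Sum>\<^sub>x\<^sub>\<in>\<^sub>\<gamma> \<delta>\<^sub>x\<close> identified with \<open>\<gamma>\<close>, and the inverse of this identification.\<close>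

definition dist_of :: "('a::topological_space, 'd::finite) chart set \<Rightarrow> 'a set \<Rightarrow> ('a \<Rightarrow> real) \<Rightarrow> real" where
  "dist_of A \<gamma> = restrict (\<lambda>\<phi>. \<Sum>\<^sub>\<infinity>x\<in>\<gamma>. \<phi> x) (test_fun A)"

definition config_of :: "('a::topological_space, 'd::finite) chart set \<Rightarrow> (('a \<Rightarrow> real) \<Rightarrow> real) \<Rightarrow> 'a set" where
  "config_of A = the_inv_into configs (dist_of A)"

definition K_transform ::
  "('a set \<Rightarrow> 'b::{comm_monoid_add, t2_space}) \<Rightarrow> 'a set \<Rightarrow> 'b" where
  "K_transform G \<gamma> = (\<Sum>\<^sub>\<infinity>\<eta> | finite \<eta> \<and> \<eta> \<subseteq> \<gamma>. G \<eta>)"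

definition is_correlation_measure ::
  "('a::topological_space, 'd::finite) chart set \<Rightarrow> (('a \<Rightarrow> real) \<Rightarrow> real) measure \<Rightarrow> 'a set measure \<Rightarrow> bool" where
  "is_correlation_measure A \<mu> \<rho> \<longleftrightarrow> sets \<rho> = sets conf_borel \<and>
     (\<forall>G :: 'a set \<Rightarrow> ennreal. G \<in> borel_measurable conf_borel \<longrightarrow>
        (\<integral>\<^sup>+\<omega> \<in> dist_of A ` configs. K_transform G (config_of A \<omega>) \<partial>\<mu>) = (\<integral>\<^sup>+\<eta>. G \<eta> \<partial>\<rho>))"

end

theory Submission
  imports Defs
begin

text \<open>
  The hypotheses give \<open>K (\<phi> \<star> G) = \<langle>\<phi>, \<cdot>\<rangle> K G\<close> and \<open>K 1 = 1\<close>, and the \<open>K\<close>-transform has the same two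
  properties, because it turns \<open>\<star>\<close> into the pointwise product.  Hence the two maps agree on the
  algebra generated by \<open>\<D>\<close> under \<open>\<star>\<close>, which contains all symmetrised products
  \<open>\<phi>\<^sub>1 \<otimes> \<dots> \<otimes> \<phi>\<^sub>n\<close>.  By the Stone--Weierstrass theorem every element of \<open>\<F>\<^sub>n(\<D>)\<close> is a uniform
  limit of linear combinations of such products with common compact support; since
  \<open>a\<^sub>\<rho>(G, cnj G)\<close> is bounded by a multiple of \<open>(sup \<bar>G\<bar>)\<^sup>2\<close> and \<open>K\<close> is isometric, the agreement
  extends to \<open>\<F>\<^sub>f\<^sub>i\<^sub>n(\<D>)\<close>.  In particular the Wick powers of degree at least \<open>2\<close> are never computed.

  As \<open>a\<^sub>\<rho>(G, 1) = \<integral> G d\<rho>\<close>, the identity defining the correlation measure holds for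
  \<open>G \<in> \<F>\<^sub>f\<^sub>i\<^sub>n(\<D>)\<close>; the indicator of an open set of configurations is an increasing limit of such
  \<open>G\<close>, and a Dynkin system argument gives all measurable functions.
\<close>

section \<open>Smooth functions\<close>

text \<open>The link between \<open>\<star>\<close> and tensor products is
  \<open>\<phi> \<star> G = ins \<phi> G + lin \<phi> G\<close>: joining a new point raises the
  degree, while hitting a point already present only multiplies by a sum of values of
  \<open>\<phi>\<close>. On products of test functions the second term stays in the span of the same
  degree, so the first is reached by subtraction and induction on the degree. All estimates are made
  on simple configurations \<open>mset_set \<eta>\<close>, the only ones seen by
  \<open>\<rho>\<close> and by the K-transform. The bound on the form then combines the number of
  triples in \<open>P3\<close> with the finite mass of the configurations of boundedly many points
  in a compact set. Three obstacles shape the rest. Nonzero constants are not test functions on a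
  non-compact manifold, so Stone--Weierstrass runs over functions that multiply test functions into
  test functions. The total mass of \<open>\<rho>\<close> may be infinite, so complements in the
  Dynkin argument are taken inside sets of finite mass. The Wick series is not evaluated, so its
  linearity is recovered from the isometry, almost everywhere.\<close>

lemma pd_path_0 [simp]: "pd_path p y 0 = y"
  by (simp add: pd_path_def)

lemma continuous_pd_path: "continuous_on UNIV (pd_path p y)"
proof (rule continuous_on_coordinatewise_then_product)
  fix i show "continuous_on UNIV (\<lambda>t. pd_path p y t i)"
    by (cases "i = fst p") (auto simp: pd_path_def intro!: continuous_intros)
qed

lemma open_pd_path: "open S \<Longrightarrow> open {t. pd_path p y t \<in> S}"
  using continuous_open_vimage[of S "pd_path p y"] continuous_pd_path[of p y]
  by (auto simp: continuous_on_eq_continuous_at vimage_def)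

text \<open>Smoothness speaks of all finite lists of derivatives. If \<open>C\<close> contains, for
  each member, functions that are its partial derivatives on \<open>S\<close>, then by induction on
  the list every iterated derivative agrees on \<open>S\<close> with a member of \<open>C\<close>.
  Most closure properties below are instances with a suitable \<open>C\<close>.\<close>

lemma smooth_coord_coinduct:
  assumes "open S" "F \<in> C"
    and cont: "\<And>F. F \<in> C \<Longrightarrow> continuous_on S F"
    and step: "\<And>F p. F \<in> C \<Longrightarrow> p \<in> {..<n} \<times> UNIV \<Longrightarrow>
      \<exists>F'\<in>C. \<forall>y\<in>S. ((\<lambda>t. F (pd_path p y t)) has_vector_derivative F' y) (at 0)"
  shows "smooth_coord n S F"
proof -
  \<comment> \<open>The derivative at \<open>0\<close> only sees small times, for which the path
    stays in the open set \<open>S\<close>; agreement on \<open>S\<close> is therefore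
    enough.\<close>
  have trans: "((\<lambda>t. H (pd_path p y t)) has_vector_derivative D) (at 0)"
    if "\<And>y. y \<in> S \<Longrightarrow> H y = H' y" "((\<lambda>t. H' (pd_path p y t)) has_vector_derivative D) (at 0)" "y \<in> S"
    for H H' :: "(nat \<Rightarrow> real^'a) \<Rightarrow> 'b" and p y D
    by (rule has_vector_derivative_transform_within_open[OF that(2) open_pd_path[OF \<open>open S\<close>, of p y]])
      (use that in auto)
  have ex: "\<exists>F'\<in>C. \<forall>y\<in>S. pds ps F y = F' y" if "ps \<in> lists ({..<n} \<times> UNIV)" for ps
    using that
  proof (induction ps)
    case Nil
    then show ?case using \<open>F \<in> C\<close> by (auto simp: pds_def)
  next
    case (Cons p ps)
    obtain F' where F': "F' \<in> C" "\<forall>y\<in>S. pds ps F y = F' y" using Cons by blast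
    obtain F'' where F'': "F'' \<in> C"
      "\<forall>y\<in>S. ((\<lambda>t. F' (pd_path p y t)) has_vector_derivative F'' y) (at 0)"
      using step[OF F'(1) Cons.hyps(1)] by blast
    have "pds (p # ps) F y = F'' y" if "y \<in> S" for y
    proof -
      have "((\<lambda>t. pds ps F (pd_path p y t)) has_vector_derivative F'' y) (at 0)"
        using F'(2) F''(2) that by (intro trans[of "pds ps F" F' p y "F'' y"]) auto
      then show ?thesis by (simp add: pds_def pd_def vector_derivative_at)
    qed
    then show ?case using F'' by blast
  qed
  show ?thesis unfolding smooth_coord_def
  proof (intro ballI conjI)
    fix ps assume ps: "ps \<in> lists ({..<n} \<times> (UNIV :: 'a set))"
    obtain F' where F': "F' \<in> C" "\<forall>y\<in>S. pds ps F y = F' y" using ex[OF ps] by blast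
    show "continuous_on S (pds ps F)"
      using cont[OF F'(1)] F'(2) continuous_on_cong[of S S "pds ps F" F'] by simp
    fix p y assume p: "p \<in> {..<n} \<times> (UNIV :: 'a set)" and y: "y \<in> S"
    obtain F'' where "((\<lambda>t. F' (pd_path p y t)) has_vector_derivative F'' y) (at 0)"
      using step[OF F'(1) p] y by blast
    then have "((\<lambda>t. pds ps F (pd_path p y t)) has_vector_derivative F'' y) (at 0)"
      using F'(2) y by (intro trans[of "pds ps F" F' p y "F'' y"]) auto
    then show "(\<lambda>t. pds ps F (pd_path p y t)) differentiable at 0"
      by (rule differentiableI_vector)
  qed
qed

lemma smooth_coord_continuous: "smooth_coord n S F \<Longrightarrow> continuous_on S F"
  unfolding smooth_coord_def by (drule bspec[of _ _ "[]"]) (auto simp: pds_def)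

lemma smooth_coord_has_pd:
  assumes "smooth_coord n S F" "p \<in> {..<n} \<times> UNIV" "y \<in> S"
  shows "((\<lambda>t. F (pd_path p y t)) has_vector_derivative pd p F y) (at 0)"
proof -
  have "(\<lambda>t. pds [] F (pd_path p y t)) differentiable (at 0)"
    using assms unfolding smooth_coord_def by (meson lists.Nil)
  then show ?thesis by (simp add: pds_def pd_def vector_derivative_works)
qed

lemma smooth_coord_pd:
  assumes "smooth_coord n S F" "p \<in> {..<n} \<times> UNIV"
  shows "smooth_coord n S (pd p F)"
  unfolding smooth_coord_def
proof
  fix ps assume "ps \<in> lists ({..<n} \<times> (UNIV::'a set))"
  \<comment> \<open>The list is folded from the right, so the derivative taken before all others
    stands at its end.\<close>
  then have "ps @ [p] \<in> lists ({..<n} \<times> UNIV)" using assms(2) by auto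
  moreover have "pds (ps @ [p]) F = pds ps (pd p F)" by (simp add: pds_def)
  ultimately show "continuous_on S (pds ps (pd p F)) \<and>
    (\<forall>q\<in>{..<n} \<times> UNIV. \<forall>y\<in>S. (\<lambda>t. pds ps (pd p F) (pd_path q y t)) differentiable at 0)"
    using assms(1) unfolding smooth_coord_def by metis
qed

lemma smooth_coord_Un:
  "\<lbrakk>smooth_coord n S F; smooth_coord n T F; open S; open T\<rbrakk> \<Longrightarrow> smooth_coord n (S \<union> T) F"
  unfolding smooth_coord_def by (meson Un_iff continuous_on_open_Un)

lemma smooth_coord_cong:
  assumes "open S" "smooth_coord n S F" "\<And>y. y \<in> S \<Longrightarrow> F y = G y"
  shows "smooth_coord n S G"
proof (rule smooth_coord_coinduct[where C = "{G. \<exists>F. smooth_coord n S F \<and> (\<forall>y\<in>S. F y = G y)}"])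
  show "G \<in> {G. \<exists>F. smooth_coord n S F \<and> (\<forall>y\<in>S. F y = G y)}" using assms by auto
next
  fix G :: "(nat \<Rightarrow> real^'a) \<Rightarrow> 'b"
  assume "G \<in> {G. \<exists>F. smooth_coord n S F \<and> (\<forall>y\<in>S. F y = G y)}"
  then obtain F where F: "smooth_coord n S F" "\<forall>y\<in>S. F y = G y" by auto
  show "continuous_on S G" using smooth_coord_continuous[OF F(1)] F(2) continuous_on_cong by metis
  fix p :: "nat \<times> 'a" assume p: "p \<in> {..<n} \<times> UNIV"
  have "((\<lambda>t. G (pd_path p y t)) has_vector_derivative pd p F y) (at 0)" if "y \<in> S" for y
    by (rule has_vector_derivative_transform_within_open
        [OF smooth_coord_has_pd[OF F(1) p that] open_pd_path[OF \<open>open S\<close>, of p y]])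
      (use that F in auto)
  then show "\<exists>F'\<in>{G. \<exists>F. smooth_coord n S F \<and> (\<forall>y\<in>S. F y = G y)}.
      \<forall>y\<in>S. ((\<lambda>t. G (pd_path p y t)) has_vector_derivative F' y) (at 0)"
    using smooth_coord_pd[OF F(1) p] by blast
qed fact

lemma smooth_coord_const: "open S \<Longrightarrow> smooth_coord n S (\<lambda>_. c)"
  by (rule smooth_coord_coinduct[where C = "range (\<lambda>c _. c)"])
    (auto intro!: derivative_eq_intros continuous_intros)

lemma smooth_coord_linear:
  assumes "open S" "smooth_coord n S F" "bounded_linear h"
  shows "smooth_coord n S (\<lambda>y. h (F y))"
proof (rule smooth_coord_coinduct[where C = "{\<lambda>y. h (F y) | F. smooth_coord n S F}"])
  show "(\<lambda>y. h (F y)) \<in> {\<lambda>y. h (F y) | F. smooth_coord n S F}" using assms by auto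
next
  fix G assume "G \<in> {\<lambda>y. h (F y) | F. smooth_coord n S F}"
  then obtain F where G: "G = (\<lambda>y. h (F y))" and F: "smooth_coord n S F" by auto
  show "continuous_on S G" unfolding G
    using bounded_linear.continuous_on[OF assms(3) smooth_coord_continuous[OF F]] .
  fix p :: "nat \<times> 'a" assume p: "p \<in> {..<n} \<times> UNIV"
  show "\<exists>F'\<in>{\<lambda>y. h (F y) | F. smooth_coord n S F}.
      \<forall>y\<in>S. ((\<lambda>t. G (pd_path p y t)) has_vector_derivative F' y) (at 0)"
    using smooth_coord_pd[OF F p] bounded_linear.has_vector_derivative[OF assms(3) smooth_coord_has_pd[OF F p]]
    by (intro bexI[of _ "\<lambda>y. h (pd p F y)"]) (auto simp: G)
qed fact

text \<open>The Leibniz rule turns one product into a sum of products, so the class for the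
  coinduction has to be closed under both operations.\<close>

inductive_set smooth_algebra :: "nat \<Rightarrow> (nat \<Rightarrow> real^'d::finite) set \<Rightarrow>
    ((nat \<Rightarrow> real^'d) \<Rightarrow> 'b::real_normed_algebra) set" for n S where
  base: "smooth_coord n S F \<Longrightarrow> F \<in> smooth_algebra n S"
| add: "F \<in> smooth_algebra n S \<Longrightarrow> G \<in> smooth_algebra n S \<Longrightarrow> (\<lambda>y. F y + G y) \<in> smooth_algebra n S"
| mult: "F \<in> smooth_algebra n S \<Longrightarrow> G \<in> smooth_algebra n S \<Longrightarrow> (\<lambda>y. F y * G y) \<in> smooth_algebra n S"

lemma smooth_algebra_smooth:
  assumes "open S" "F \<in> smooth_algebra n S"
  shows "smooth_coord n S F"
proof (rule smooth_coord_coinduct[OF assms])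
  fix F :: "(nat \<Rightarrow> real^'a) \<Rightarrow> 'b" assume "F \<in> smooth_algebra n S"
  then show "continuous_on S F"
    by induction (auto intro: smooth_coord_continuous continuous_on_add continuous_on_mult)
next
  fix F :: "(nat \<Rightarrow> real^'a) \<Rightarrow> 'b" and p :: "nat \<times> 'a"
  assume "F \<in> smooth_algebra n S" and p: "p \<in> {..<n} \<times> UNIV"
  then show "\<exists>F'\<in>smooth_algebra n S.
    \<forall>y\<in>S. ((\<lambda>t. F (pd_path p y t)) has_vector_derivative F' y) (at 0)"
  proof induction
    case (base F)
    then show ?case using smooth_coord_pd smooth_coord_has_pd smooth_algebra.base p by blast
  next
    case (add F G)
    then obtain F' G' where "F' \<in> smooth_algebra n S" "G' \<in> smooth_algebra n S"
      "\<forall>y\<in>S. ((\<lambda>t. F (pd_path p y t)) has_vector_derivative F' y) (at 0)"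
      "\<forall>y\<in>S. ((\<lambda>t. G (pd_path p y t)) has_vector_derivative G' y) (at 0)" by blast
    then show ?case
      by (intro bexI[of _ "\<lambda>y. F' y + G' y"])
        (auto intro: smooth_algebra.add has_vector_derivative_add)
  next
    case (mult F G)
    then obtain F' G' where *: "F' \<in> smooth_algebra n S" "G' \<in> smooth_algebra n S"
      "\<forall>y\<in>S. ((\<lambda>t. F (pd_path p y t)) has_vector_derivative F' y) (at 0)"
      "\<forall>y\<in>S. ((\<lambda>t. G (pd_path p y t)) has_vector_derivative G' y) (at 0)" by blast
    have "((\<lambda>t. F (pd_path p y t) * G (pd_path p y t)) has_vector_derivative F y * G' y + F' y * G y) (at 0)"
      if "y \<in> S" for y
      using has_vector_derivative_mult[OF *(3)[rule_format, OF that] *(4)[rule_format, OF that]] by simp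
    then show ?case using * mult
      by (intro bexI[of _ "\<lambda>y. F y * G' y + F' y * G y"])
        (auto intro!: smooth_algebra.add smooth_algebra.mult)
  qed
qed

lemma smooth_coord_add:
  fixes F G :: "(nat \<Rightarrow> real^'d::finite) \<Rightarrow> 'b::real_normed_algebra"
  shows "open S \<Longrightarrow> smooth_coord n S F \<Longrightarrow> smooth_coord n S G \<Longrightarrow> smooth_coord n S (\<lambda>y. F y + G y)"
  by (rule smooth_algebra_smooth[OF _ smooth_algebra.add[OF smooth_algebra.base smooth_algebra.base]])

lemma smooth_coord_mult:
  fixes F G :: "(nat \<Rightarrow> real^'d::finite) \<Rightarrow> 'b::real_normed_algebra"
  shows "open S \<Longrightarrow> smooth_coord n S F \<Longrightarrow> smooth_coord n S G \<Longrightarrow> smooth_coord n S (\<lambda>y. F y * G y)"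
  by (rule smooth_algebra_smooth[OF _ smooth_algebra.mult[OF smooth_algebra.base smooth_algebra.base]])

lemma smooth_coord_sum:
  fixes F :: "'i \<Rightarrow> (nat \<Rightarrow> real^'d::finite) \<Rightarrow> 'b::real_normed_algebra"
  assumes "open S" "\<And>i. i \<in> I \<Longrightarrow> smooth_coord n S (F i)"
  shows "smooth_coord n S (\<lambda>y. \<Sum>i\<in>I. F i y)"
  using assms
  by (induction I rule: infinite_finite_induct) (auto simp: smooth_coord_const smooth_coord_add)

text \<open>By the chain rule the derivative of \<open>h (u y) * v y\<close> is
  \<open>h' (u y) * (pd p u y * v y) + h (u y) * pd p v y\<close>, a sum of two terms of the same
  shape. This makes the class stable under differentiation.\<close>

inductive_set smooth_comp :: "nat \<Rightarrow> (nat \<Rightarrow> real^'d::finite) set \<Rightarrow> (real \<Rightarrow> real) set \<Rightarrow>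
    ((nat \<Rightarrow> real^'d) \<Rightarrow> real) \<Rightarrow> ((nat \<Rightarrow> real^'d) \<Rightarrow> real) set" for n S H u where
  base: "h \<in> H \<Longrightarrow> smooth_coord n S v \<Longrightarrow> (\<lambda>y. h (u y) * v y) \<in> smooth_comp n S H u"
| add: "F \<in> smooth_comp n S H u \<Longrightarrow> G \<in> smooth_comp n S H u \<Longrightarrow>
    (\<lambda>y. F y + G y) \<in> smooth_comp n S H u"

lemma smooth_coord_compose:
  assumes "open S" "smooth_coord n S u" "h \<in> H"
    and H: "\<And>h. h \<in> H \<Longrightarrow> \<exists>h'\<in>H. \<forall>t. (h has_real_derivative h' t) (at t)"
  shows "smooth_coord n S (\<lambda>y. h (u y))"
proof (rule smooth_coord_coinduct[where C = "smooth_comp n S H u", OF \<open>open S\<close>])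
  show "(\<lambda>y. h (u y)) \<in> smooth_comp n S H u"
    using smooth_comp.base[OF \<open>h \<in> H\<close> smooth_coord_const[OF \<open>open S\<close>, of n 1], of u]
    by (simp only: mult_1_right)
next
  fix F assume "F \<in> smooth_comp n S H u"
  then show "continuous_on S F"
  proof induction
    case (base h v)
    obtain h' where "\<forall>t. (h has_real_derivative h' t) (at t)"
      using H[OF base(1)] by blast
    then have "continuous_on UNIV h" by (intro DERIV_continuous_on[where D = h']) (simp add: has_field_derivative_at_within)
    then have "continuous_on S (\<lambda>y. h (u y))"
      by (rule continuous_on_compose2[OF _ smooth_coord_continuous[OF assms(2)]]) simp
    then show ?case using smooth_coord_continuous[OF base(2)] by (rule continuous_on_mult)
  qed (rule continuous_on_add)
next
  fix F and p :: "nat \<times> 'a"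
  assume "F \<in> smooth_comp n S H u" and p: "p \<in> {..<n} \<times> UNIV"
  then show "\<exists>F'\<in>smooth_comp n S H u.
    \<forall>y\<in>S. ((\<lambda>t. F (pd_path p y t)) has_vector_derivative F' y) (at 0)"
  proof induction
    case (base h v)
    obtain h' where h': "h' \<in> H" "\<forall>t. (h has_real_derivative h' t) (at t)"
      using H[OF base(1)] by blast
    let ?F = "\<lambda>y. h' (u y) * (pd p u y * v y) + h (u y) * pd p v y"
    have "((\<lambda>t. h (u (pd_path p y t)) * v (pd_path p y t)) has_vector_derivative ?F y) (at 0)"
      if "y \<in> S" for y
    proof -
      note 1 = smooth_coord_has_pd[OF assms(2) p that] smooth_coord_has_pd[OF base(2) p that]
      note 1 = this[folded has_real_derivative_iff_has_vector_derivative]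
      have "((\<lambda>t. h (u (pd_path p y t))) has_real_derivative h' (u y) * pd p u y) (at 0)"
        using DERIV_chain2[OF h'(2)[rule_format, of "u (pd_path p y 0)"] 1(1)] by simp
      from DERIV_mult[OF this 1(2)] show ?thesis
        by (simp add: has_real_derivative_iff_has_vector_derivative algebra_simps)
    qed
    moreover have "?F \<in> smooth_comp n S H u"
    proof (rule smooth_comp.add)
      show "(\<lambda>y. h' (u y) * (pd p u y * v y)) \<in> smooth_comp n S H u"
        by (rule smooth_comp.base[OF h'(1)
              smooth_coord_mult[OF assms(1) smooth_coord_pd[OF assms(2) p] base(2)]])
      show "(\<lambda>y. h (u y) * pd p v y) \<in> smooth_comp n S H u"
        by (rule smooth_comp.base[OF base(1) smooth_coord_pd[OF base(2) p]])
    qed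
    ultimately show ?case by (rule rev_bexI[of ?F, rotated, OF ballI])
  next
    case (add F G)
    then obtain F' G' where "F' \<in> smooth_comp n S H u" "G' \<in> smooth_comp n S H u"
      "\<forall>y\<in>S. ((\<lambda>t. F (pd_path p y t)) has_vector_derivative F' y) (at 0)"
      "\<forall>y\<in>S. ((\<lambda>t. G (pd_path p y t)) has_vector_derivative G' y) (at 0)" by blast
    then show ?case
      by (intro bexI[of _ "\<lambda>y. F' y + G' y"])
        (auto intro: smooth_comp.add has_vector_derivative_add)
  qed
qed

lemma continuous_reindex: "continuous_on UNIV (\<lambda>x::'i \<Rightarrow> 'a::topological_space. x \<circ> \<tau>)"
  by (rule continuous_on_coordinatewise_then_product) (auto intro: continuous_on_product_coordinates)

text \<open>The derivative in the variable \<open>\<tau> j\<close> is the derivative of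
  \<open>F\<close> in its variable \<open>j\<close>, injectivity ensuring that no other argument
  moves. A variable that is no \<open>\<tau> j\<close> with \<open>j < m\<close> does not affect the
  value; therefore the zero function joins the class, and dependence on the first \<open>m\<close>
  arguments is part of it.\<close>

lemma smooth_coord_reindex:
  fixes F :: "(nat \<Rightarrow> real^'d::finite) \<Rightarrow> 'b::real_normed_vector"
  assumes "open S" "smooth_coord m T F" "inj \<tau>" "\<And>y. y \<in> S \<Longrightarrow> y \<circ> \<tau> \<in> T"
    and loc: "\<And>y y'. (\<And>i. i < m \<Longrightarrow> y i = y' i) \<Longrightarrow> F y = F y'"
  shows "smooth_coord n S (\<lambda>y. F (y \<circ> \<tau>))"
proof -
  let ?loc = "\<lambda>F :: (nat \<Rightarrow> real^'d) \<Rightarrow> 'b. \<forall>y y'. (\<forall>i<m. y i = y' i) \<longrightarrow> F y = F y'"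
  let ?C = "{\<lambda>y. F (y \<circ> \<tau>) | F. smooth_coord m T F \<and> ?loc F} \<union> {\<lambda>_. 0}"
  show ?thesis
  proof (rule smooth_coord_coinduct[where C = ?C])
    show "(\<lambda>y. F (y \<circ> \<tau>)) \<in> ?C"
    proof (rule UnI1, rule CollectI, rule exI[of _ F], intro conjI)
      show "?loc F" by (intro allI impI, rule loc) simp
      show "smooth_coord m T F" by (rule assms(2))
    qed (rule refl)
  next
    fix G assume "G \<in> ?C"
    then show "continuous_on S G"
    proof
      assume "G \<in> {\<lambda>y. F (y \<circ> \<tau>) | F. smooth_coord m T F \<and> ?loc F}"
      then obtain F where G: "G = (\<lambda>y. F (y \<circ> \<tau>))" "smooth_coord m T F" by auto
      show ?thesis unfolding G(1)
        by (rule continuous_on_compose2[OF smooth_coord_continuous[OF G(2)]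
              continuous_on_subset[OF continuous_reindex]]) (use assms(4) in auto)
    qed auto
  next
    fix G and p :: "nat \<times> 'd" assume "G \<in> ?C" and p: "p \<in> {..<n} \<times> UNIV"
    from this(1) show "\<exists>F'\<in>?C. \<forall>y\<in>S. ((\<lambda>t. G (pd_path p y t)) has_vector_derivative F' y) (at 0)"
    proof
      assume "G \<in> {\<lambda>y. F (y \<circ> \<tau>) | F. smooth_coord m T F \<and> ?loc F}"
      then obtain F where G: "G = (\<lambda>y. F (y \<circ> \<tau>))" and F: "smooth_coord m T F" "?loc F" by auto
      show ?thesis
      proof (cases "fst p \<in> \<tau> ` {..<m}")
        case True
        then obtain j where j: "j < m" "fst p = \<tau> j" by auto
        let ?q = "(j, snd p)"
        have path: "pd_path p y t \<circ> \<tau> = pd_path ?q (y \<circ> \<tau>) t" for y t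
          using \<open>inj \<tau>\<close> j by (auto simp: pd_path_def fun_eq_iff inj_eq)
        have "pd ?q F y = pd ?q F y'" if "\<forall>i<m. y i = y' i" for y y'
        proof -
          have "F (pd_path ?q y t) = F (pd_path ?q y' t)" for t
            using F(2) that j by (simp add: pd_path_def)
          then show ?thesis by (simp add: pd_def)
        qed
        moreover have "((\<lambda>t. G (pd_path p y t)) has_vector_derivative pd ?q F (y \<circ> \<tau>)) (at 0)"
          if "y \<in> S" for y
          unfolding G path by (rule smooth_coord_has_pd[OF F(1)]) (use j that assms(4) in auto)
        moreover have "smooth_coord m T (pd ?q F)" by (rule smooth_coord_pd[OF F(1)]) (use j in auto)
        ultimately show ?thesis by (intro bexI[of _ "\<lambda>y. pd ?q F (y \<circ> \<tau>)"]) auto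
      next
        case False
        have "(pd_path p y t \<circ> \<tau>) i = (y \<circ> \<tau>) i" if "i < m" for y t i
        proof -
          have "\<tau> i \<noteq> fst p" using False that by (metis imageI lessThan_iff)
          then show ?thesis by (simp add: pd_path_def)
        qed
        then have "G (pd_path p y t) = G y" for y t
          unfolding G by (intro F(2)[rule_format])
        then show ?thesis by (intro bexI[of _ "\<lambda>_. 0"]) auto
      qed
    next
      assume "G \<in> {\<lambda>_. 0}"
      then show ?thesis by (intro bexI[of _ "\<lambda>_. 0"]) auto
    qed
  qed fact
qed

lemma open_coord: "open U \<Longrightarrow> open {f :: 'i \<Rightarrow> 'b::topological_space. f i \<in> U}"
  using open_vimage[of U "\<lambda>f. f i"] by (auto simp: vimage_def intro: continuous_on_product_coordinates)

text \<open>The Hausdorff property of function types is required by the Stone--Weierstrass theorem.\<close>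

instance "fun" :: (type, t0_space) t0_space
proof
  fix f g :: "'a \<Rightarrow> 'b"
  assume "f \<noteq> g"
  then obtain i where "f i \<noteq> g i" by auto
  then obtain U where U: "open U" "(f i \<in> U) \<noteq> (g i \<in> U)" using separation_t0[of "f i" "g i"] by blast
  show "\<exists>U. open U \<and> \<not> (f \<in> U \<longleftrightarrow> g \<in> U)"
    using open_coord[OF U(1), of i] U(2) by (intro exI[of _ "{f. f i \<in> U}"]) auto
qed

instance "fun" :: (type, t1_space) t1_space
proof
  fix f g :: "'a \<Rightarrow> 'b"
  assume "f \<noteq> g"
  then obtain i where "f i \<noteq> g i" by auto
  then obtain U where U: "open U" "f i \<in> U" "g i \<notin> U" using separation_t1[of "f i" "g i"] by blast
  show "\<exists>U. open U \<and> f \<in> U \<and> g \<notin> U"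
    using open_coord[OF U(1), of i] U by (intro exI[of _ "{f. f i \<in> U}"]) auto
qed

instance "fun" :: (type, t2_space) t2_space
proof
  fix f g :: "'a \<Rightarrow> 'b"
  assume "f \<noteq> g"
  then obtain i where "f i \<noteq> g i" by auto
  then obtain U V where UV: "open U" "open V" "f i \<in> U" "g i \<in> V" "U \<inter> V = {}" using separation_t2[of "f i" "g i"] by blast
  then show "\<exists>U V. open U \<and> open V \<and> f \<in> U \<and> g \<in> V \<and> U \<inter> V = {}"
    using open_coord[OF UV(1), of i] open_coord[OF UV(2), of i]
    by (intro exI[of _ "{f. f i \<in> U}"] exI[of _ "{f. f i \<in> V}"]) auto
qed

section \<open>Smoothness of \<open>exp (- (1 / t))\<close> extended by \<open>0\<close>\<close>

definition bump_class :: "(real \<Rightarrow> real) set" where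
  "bump_class = {\<lambda>t. if t > 0 then poly p (1 / t) * exp (- (1 / t)) else 0 | p. True}"

lemma poly_exp_tendsto_0: "((\<lambda>s::real. poly q s * exp (- s)) \<longlongrightarrow> 0) at_top"
proof -
  have "((\<lambda>s. \<Sum>i\<le>degree q. coeff q i * (s ^ i / exp s)) \<longlongrightarrow> 0) at_top"
    by (intro tendsto_null_sum tendsto_mult_right_zero tendsto_power_div_exp_0)
  moreover have "(\<lambda>s. \<Sum>i\<le>degree q. coeff q i * (s ^ i / exp s)) = (\<lambda>s::real. poly q s * exp (- s))"
    by (auto simp: poly_altdef sum_distrib_right exp_minus divide_inverse mult.assoc fun_eq_iff)
  ultimately show ?thesis by simp
qed

text \<open>Differentiation only changes the polynomial in \<open>1 / t\<close>, so the class
  contains all derivatives of its members; at \<open>0\<close> every member is flat because the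
  exponential beats each power.\<close>

lemma bump_class_deriv:
  assumes "h \<in> bump_class"
  shows "\<exists>h'\<in>bump_class. \<forall>t. (h has_real_derivative h' t) (at t)"
proof -
  let ?h = "\<lambda>p t. if t > 0 then poly p (1 / t) * exp (- (1 / t)) else (0::real)"
  obtain p where h: "h = ?h p" using assms by (auto simp: bump_class_def)
  \<comment> \<open>With \<open>s = 1 / t\<close>, the derivative of \<open>p(s) exp(-s)\<close> in
    \<open>t\<close> is \<open>s^2 (p(s) - p'(s)) exp(-s)\<close>.\<close>
  define q where "q = [:0, 0, 1:] * (p - pderiv p)"
  have "(h has_real_derivative ?h q t) (at t)" for t
  proof -
    consider "t > 0" | "t < 0" | "t = 0" by linarith
    then show ?thesis
    proof cases
      case 1
      have "((\<lambda>t. poly p (1 / t) * exp (- (1 / t))) has_real_derivative ?h q t) (at t)"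
        using 1 by (auto intro!: derivative_eq_intros simp: q_def field_simps power2_eq_square)
      then show ?thesis
        by (rule has_field_derivative_transform_within_open[of _ _ _ "{0<..}"]) (use 1 h in auto)
    next
      case 2
      have "((\<lambda>t. 0) has_real_derivative ?h q t) (at t)" using 2 by auto
      then show ?thesis
        by (rule has_field_derivative_transform_within_open[of _ _ _ "{..<0}"]) (use 2 h in auto)
    next
      case 3
      let ?d = "\<lambda>x. (h (0 + x) - h 0) / x"
      have "(?d \<longlongrightarrow> 0) (at_left 0)"
        by (rule Lim_transform_eventually[OF tendsto_const])
          (auto simp: eventually_at_left_field h intro!: exI[of _ "-1"])
      moreover have "(?d \<longlongrightarrow> 0) (at_right 0)"
      proof (rule Lim_transform_eventually)
        \<comment> \<open>The difference quotient at \<open>0\<close> is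
          \<open>s p(s) exp(-s)\<close> with \<open>s = 1 / x\<close>, again a polynomial times the
          exponential.\<close>
        show "((\<lambda>x. poly ([:0, 1:] * p) (inverse x) * exp (- inverse x)) \<longlongrightarrow> 0) (at_right (0::real))"
          by (rule filterlim_compose[OF poly_exp_tendsto_0 filterlim_inverse_at_top_right])
        show "\<forall>\<^sub>F x in at_right 0. poly ([:0, 1:] * p) (inverse x) * exp (- inverse x) = ?d x"
          by (auto simp: eventually_at_right_field h divide_inverse intro!: exI[of _ 1])
      qed
      ultimately have "(?d \<longlongrightarrow> 0) (at 0)" by (rule filterlim_split_at)
      then show ?thesis using 3 by (simp add: DERIV_def)
    qed
  qed
  then show ?thesis by (intro bexI[of _ "?h q"]) (auto simp: bump_class_def)
qed

section \<open>Test functions\<close>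

lemma atlas_open_fst: "smooth_atlas A \<Longrightarrow> c \<in> A \<Longrightarrow> open (fst c)"
  and atlas_open_target: "smooth_atlas A \<Longrightarrow> c \<in> A \<Longrightarrow> open (target c)"
  and atlas_homeomorphism: "smooth_atlas A \<Longrightarrow> c \<in> A \<Longrightarrow>
    homeomorphism (fst c) (target c) (snd c) (chart_inv c)"
  by (auto simp: smooth_atlas_def is_chart_def)

lemma atlas_cover: "smooth_atlas A \<Longrightarrow> \<exists>c\<in>A. x \<in> fst c"
  unfolding smooth_atlas_def by blast

lemma chart_inv_chart:
  "smooth_atlas A \<Longrightarrow> c \<in> A \<Longrightarrow> x \<in> fst c \<Longrightarrow> chart_inv c (snd c x) = x"
  and chart_inv_in: "smooth_atlas A \<Longrightarrow> c \<in> A \<Longrightarrow> y \<in> target c \<Longrightarrow> chart_inv c y \<in> fst c"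
  using atlas_homeomorphism[of A c] by (auto simp: homeomorphism_def)

lemma chart_image_open:
  assumes "smooth_atlas A" "c \<in> A" "open U"
  shows "open (snd c ` (fst c \<inter> U))"
proof -
  have "openin (top_of_set (target c)) (snd c ` (fst c \<inter> U))"
    by (rule homeomorphism_imp_open_map[OF atlas_homeomorphism[OF assms(1,2)]])
      (use assms in \<open>auto intro: openin_open_Int\<close>)
  then show ?thesis using atlas_open_target[OF assms(1,2)] openin_open_eq by blast
qed

text \<open>In a chart \<open>b\<close> around \<open>x\<close>, apply the flat function to
  \<open>r^2\<close> minus the squared distance of the coordinates. The support lies in the preimage
  \<open>L\<close> of a closed ball; it is compact, hence closed in the Hausdorff space, so
  extension by zero is smooth: each chart domain is the union of its overlap with \<open>b\<close>
  and its part outside \<open>L\<close>.\<close>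

lemma exists_bump:
  fixes A :: "('a::t2_space, 'd::finite) chart set"
  assumes A: "smooth_atlas A" and "open U" "x \<in> U"
  shows "\<exists>\<phi>\<in>test_fun A. (\<forall>z. \<phi> z \<ge> 0) \<and> \<phi> x > 0 \<and> (\<exists>L. compact L \<and> L \<subseteq> U \<and> (\<forall>z. \<phi> z \<noteq> 0 \<longrightarrow> z \<in> L))"
proof -
  obtain b where b: "b \<in> A" "x \<in> fst b" using atlas_cover[OF A] by blast
  let ?y = "snd b x"
  have "open (snd b ` (fst b \<inter> U))" "?y \<in> snd b ` (fst b \<inter> U)"
    using chart_image_open[OF A b(1) \<open>open U\<close>] b \<open>x \<in> U\<close> by auto
  then obtain r where r: "r > 0" "cball ?y r \<subseteq> snd b ` (fst b \<inter> U)"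
    using open_contains_cball by blast
  then have rt: "cball ?y r \<subseteq> target b" by (auto simp: target_def)
  define L where "L = chart_inv b ` cball ?y r"
  have L: "compact L" unfolding L_def
    by (rule compact_continuous_image)
      (use atlas_homeomorphism[OF A b(1)] rt in \<open>auto simp: homeomorphism_def intro: continuous_on_subset\<close>)
  have LU: "L \<subseteq> U" unfolding L_def using r(2) chart_inv_chart[OF A b(1)] by fastforce
  define h where "h t = (if t > 0 then exp (- (1 / t)) else (0::real))" for t
  have "h = (\<lambda>t. if t > 0 then poly 1 (1 / t) * exp (- (1 / t)) else 0)" by (auto simp: h_def)
  then have h: "h \<in> bump_class" unfolding bump_class_def by blast
  define \<phi> where "\<phi> z = (if z \<in> fst b then h (r\<^sup>2 - (norm (snd b z - ?y))\<^sup>2) else 0)" for z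
  have supp: "z \<in> L" if "\<phi> z \<noteq> 0" for z
  proof -
    have z: "z \<in> fst b" "(norm (snd b z - ?y))\<^sup>2 < r\<^sup>2"
      using that by (auto simp: \<phi>_def h_def split: if_splits)
    then have "norm (snd b z - ?y) < r" using r(1) power2_less_imp_less by fastforce
    then have "snd b z \<in> cball ?y r" by (simp add: dist_norm norm_minus_commute)
    then show ?thesis unfolding L_def using chart_inv_chart[OF A b(1) z(1)] by force
  qed
  have "smooth_coord 1 {y. \<forall>i<1. y i \<in> target (c i)} (local_rep c (\<lambda>z. \<phi> (z 0)))"
    if c: "c \<in> {..<1} \<rightarrow> A" for c
  proof -
    let ?c = "c 0"
    have cA: "?c \<in> A" using c by auto
    let ?S = "{y::nat \<Rightarrow> real^'d. y 0 \<in> snd ?c ` (fst ?c \<inter> fst b)}"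
    let ?T = "{y::nat \<Rightarrow> real^'d. y 0 \<in> snd ?c ` (fst ?c \<inter> (- L))}"
    have S: "open ?S" by (intro open_coord chart_image_open[OF A cA] atlas_open_fst[OF A b(1)])
    have T: "open ?T"
      by (intro open_coord chart_image_open[OF A cA]) (use L compact_imp_closed in auto)
    have "smooth_map (snd ?c ` (fst ?c \<inter> fst b)) (transition ?c b)"
      using A b cA unfolding smooth_atlas_def by blast
    then have tr: "smooth_coord 1 ?S (\<lambda>y. transition ?c b (y 0))" by (simp add: smooth_map_def)
    \<comment> \<open>The squared norm is expanded into coordinates, so that smoothness of the
      transition map passes through sums and products.\<close>
    have comp: "smooth_coord 1 ?S (\<lambda>y. transition ?c b (y 0) $ j + - (?y $ j))" for j
      by (intro smooth_coord_add S smooth_coord_const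
          smooth_coord_linear[OF S tr bounded_linear_vec_nth])
    have "smooth_coord 1 ?S (\<lambda>y. \<Sum>j\<in>UNIV. (transition ?c b (y 0) $ j + - (?y $ j)) *
        (transition ?c b (y 0) $ j + - (?y $ j)))"
      by (intro smooth_coord_sum S smooth_coord_mult comp)
    then have "smooth_coord 1 ?S (\<lambda>y. r\<^sup>2 + (-1) * (\<Sum>j\<in>UNIV. (transition ?c b (y 0) $ j + - (?y $ j)) *
        (transition ?c b (y 0) $ j + - (?y $ j))))"
      by (intro smooth_coord_add smooth_coord_mult S smooth_coord_const)
    then have "smooth_coord 1 ?S (\<lambda>y. h (r\<^sup>2 + (-1) * (\<Sum>j\<in>UNIV. (transition ?c b (y 0) $ j + - (?y $ j)) *
        (transition ?c b (y 0) $ j + - (?y $ j)))))"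
      by (rule smooth_coord_compose[OF S _ h bump_class_deriv])
    then have 1: "smooth_coord 1 ?S (local_rep c (\<lambda>z. \<phi> (z 0)))"
    proof (rule smooth_coord_cong[OF S])
      fix y assume "y \<in> ?S"
      then obtain z where z: "y 0 = snd ?c z" "z \<in> fst ?c" "z \<in> fst b" by auto
      have *: "(norm v)\<^sup>2 = (\<Sum>j\<in>UNIV. v $ j * v $ j)" for v :: "real^'d"
        by (simp add: power2_norm_eq_inner inner_vec_def)
      show "h (r\<^sup>2 + (-1) * (\<Sum>j\<in>UNIV. (transition ?c b (y 0) $ j + - (?y $ j)) *
        (transition ?c b (y 0) $ j + - (?y $ j)))) = local_rep c (\<lambda>z. \<phi> (z 0)) y"
        using z by (simp add: local_rep_def \<phi>_def transition_def chart_inv_chart[OF A cA] *)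
    qed
    have 2: "smooth_coord 1 ?T (local_rep c (\<lambda>z. \<phi> (z 0)))"
    proof (rule smooth_coord_cong[OF T smooth_coord_const[OF T]])
      fix y assume "y \<in> ?T"
      then obtain z where z: "y 0 = snd ?c z" "z \<in> fst ?c" "z \<notin> L" by auto
      then show "0 = local_rep c (\<lambda>z. \<phi> (z 0)) y"
        using supp[of z] by (auto simp: local_rep_def chart_inv_chart[OF A cA])
    qed
    have "L \<subseteq> fst b" unfolding L_def using rt chart_inv_in[OF A b(1)] by blast
    then have "{y. \<forall>i<1. y i \<in> target (c i)} = ?S \<union> ?T" by (auto simp: target_def)
    then show ?thesis using smooth_coord_Un[OF 1 2 S T] by simp
  qed
  then have "\<phi> \<in> test_fun A"
    unfolding test_fun_def test_power_def smooth_fun_def supported_def using L supp by auto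
  moreover have "\<phi> z \<ge> 0" for z by (simp add: \<phi>_def h_def)
  moreover have "\<phi> x > 0" using b(2) r(1) by (simp add: \<phi>_def h_def)
  ultimately show ?thesis using L LU supp by blast
qed

definition coord_open :: "nat \<Rightarrow> (nat \<Rightarrow> ('a, 'd::finite) chart) \<Rightarrow> (nat \<Rightarrow> real^'d) set" where
  "coord_open n c = {y. \<forall>i<n. y i \<in> target (c i)}"

lemma open_coord_open:
  assumes "smooth_atlas A" "c \<in> {..<n} \<rightarrow> A"
  shows "open (coord_open n c)"
proof -
  have "coord_open n c = (\<Inter>i\<in>{..<n}. {y. y i \<in> target (c i)})" by (auto simp: coord_open_def)
  also have "open \<dots>"
    using assms by (intro open_INT ballI open_coord atlas_open_target) auto
  finally show ?thesis .
qed

lemma test_power_iff: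
  "f \<in> test_power A n \<longleftrightarrow> (\<forall>x x'. (\<forall>i<n. x i = x' i) \<longrightarrow> f x = f x') \<and>
     (\<forall>c \<in> {..<n} \<rightarrow> A. smooth_coord n (coord_open n c) (local_rep c f)) \<and>
     (\<exists>L. compact L \<and> supported n L f)"
  by (auto simp: test_power_def smooth_fun_def coord_open_def)

lemma test_power_local:
  assumes "f \<in> test_power A n" "\<And>i. i < n \<Longrightarrow> x i = x' i"
  shows "f x = f x'"
  using assms unfolding test_power_iff by simp

context
  fixes A :: "('a::t2_space, 'd::finite) chart set"
  assumes A: "smooth_atlas A"
begin

lemma test_power_zero: "(\<lambda>_. 0) \<in> test_power A n"
proof -
  have "smooth_coord n (coord_open n c) (local_rep c (\<lambda>_. 0))" if "c \<in> {..<n} \<rightarrow> A" for c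
    using smooth_coord_const[OF open_coord_open[OF A that], of n 0] unfolding local_rep_def .
  then show ?thesis by (auto simp: test_power_iff supported_def intro!: exI[of _ "{}"])
qed

lemma test_power_linear:
  assumes f: "f \<in> test_power A n" and h: "bounded_linear h"
  shows "(\<lambda>x. h (f x)) \<in> test_power A n"
proof -
  have "smooth_coord n (coord_open n c) (local_rep c (\<lambda>x. h (f x)))" if "c \<in> {..<n} \<rightarrow> A" for c
    using smooth_coord_linear[OF open_coord_open[OF A that] _ h, of n "local_rep c f"] f that
    by (auto simp: test_power_iff local_rep_def[abs_def])
  moreover have "h 0 = 0" using h by (rule linear_simps)
  then have "supported n L (\<lambda>x. h (f x))" if "supported n L f" for L
    using that unfolding supported_def by metis
  moreover have "h (f x) = h (f x')" if "\<forall>i<n. x i = x' i" for x x'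
    using test_power_local[OF f] that by metis
  ultimately show ?thesis using f unfolding test_power_iff by blast
qed

lemma test_power_add:
  fixes f g :: "(nat \<Rightarrow> 'a) \<Rightarrow> 'b::real_normed_algebra"
  assumes f: "f \<in> test_power A n" and g: "g \<in> test_power A n"
  shows "(\<lambda>x. f x + g x) \<in> test_power A n"
proof -
  have "smooth_coord n (coord_open n c) (local_rep c (\<lambda>x. f x + g x))" if "c \<in> {..<n} \<rightarrow> A" for c
    using smooth_coord_add[OF open_coord_open[OF A that], of n "local_rep c f" "local_rep c g"] f g that
    by (auto simp: test_power_iff local_rep_def[abs_def])
  moreover have "\<exists>L. compact L \<and> supported n L (\<lambda>x. f x + g x)"
  proof -
    obtain L L' where "compact L" "supported n L f" "compact L'" "supported n L' g"
      using f g unfolding test_power_iff by blast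
    then show ?thesis
      by (intro exI[of _ "L \<union> L'"]) (auto simp: supported_def compact_Un; metis add_0)
  qed
  moreover have "f x + g x = f x' + g x'" if "\<forall>i<n. x i = x' i" for x x'
    using test_power_local[OF f, of x x'] test_power_local[OF g, of x x'] that by simp
  ultimately show ?thesis unfolding test_power_iff by blast
qed

lemma local_rep_reindex: "local_rep c (\<lambda>x. f (x \<circ> \<tau>)) y = local_rep (c \<circ> \<tau>) f (y \<circ> \<tau>)"
  by (simp add: local_rep_def comp_def)

lemma smooth_fun_reindex:
  assumes f: "f \<in> test_power A m" and "inj \<tau>" "\<tau> ` {..<m} \<subseteq> {..<n}" and c: "c \<in> {..<n} \<rightarrow> A"
  shows "smooth_coord n (coord_open n c) (local_rep c (\<lambda>x. f (x \<circ> \<tau>)))"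
proof -
  have c': "c \<circ> \<tau> \<in> {..<m} \<rightarrow> A"
  proof
    fix i assume "i \<in> {..<m}"
    then have "\<tau> i \<in> {..<n}" using assms(3) by blast
    then show "(c \<circ> \<tau>) i \<in> A" using c by auto
  qed
  have "smooth_coord n (coord_open n c) (\<lambda>y. local_rep (c \<circ> \<tau>) f (y \<circ> \<tau>))"
  proof (rule smooth_coord_reindex[where m = m and T = "coord_open m (c \<circ> \<tau>)"])
    show "smooth_coord m (coord_open m (c \<circ> \<tau>)) (local_rep (c \<circ> \<tau>) f)"
      using f c' unfolding test_power_iff by blast
    show "y \<circ> \<tau> \<in> coord_open m (c \<circ> \<tau>)" if "y \<in> coord_open n c" for y
      using that assms(3) unfolding coord_open_def by (auto simp: image_subset_iff)
    show "local_rep (c \<circ> \<tau>) f y = local_rep (c \<circ> \<tau>) f y'" if "\<And>i. i < m \<Longrightarrow> y i = y' i" for y y'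
    proof -
      show ?thesis unfolding local_rep_def by (rule test_power_local[OF f]) (simp add: that)
    qed
  qed (rule open_coord_open[OF A c] assms(2))+
  moreover have "local_rep c (\<lambda>x. f (x \<circ> \<tau>)) = (\<lambda>y. local_rep (c \<circ> \<tau>) f (y \<circ> \<tau>))"
    by (rule ext) (rule local_rep_reindex)
  ultimately show ?thesis by simp
qed

text \<open>Covers the pointwise product (\<open>\<sigma> = \<tau> = id\<close>) and the tensor
  product in different variables. The injections jointly reach every variable below
  \<open>n\<close>, so where the product is nonzero each coordinate lies in one of the two compact
  supports.\<close>

lemma test_power_mult:
  fixes f g :: "(nat \<Rightarrow> 'a) \<Rightarrow> 'b::real_normed_algebra"
  assumes f: "f \<in> test_power A m" and g: "g \<in> test_power A k"
    and \<sigma>: "inj \<sigma>" "\<sigma> ` {..<m} \<subseteq> {..<n}" and \<tau>: "inj \<tau>" "\<tau> ` {..<k} \<subseteq> {..<n}"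
    and un: "{..<n} \<subseteq> \<sigma> ` {..<m} \<union> \<tau> ` {..<k}"
  shows "(\<lambda>x. f (x \<circ> \<sigma>) * g (x \<circ> \<tau>)) \<in> test_power A n"
proof -
  have "smooth_coord n (coord_open n c) (local_rep c (\<lambda>x. f (x \<circ> \<sigma>) * g (x \<circ> \<tau>)))"
    if "c \<in> {..<n} \<rightarrow> A" for c
    using smooth_coord_mult[OF open_coord_open[OF A that] smooth_fun_reindex[OF f \<sigma> that]
        smooth_fun_reindex[OF g \<tau> that]]
    by (simp add: local_rep_def[abs_def])
  moreover have "\<exists>L. compact L \<and> supported n L (\<lambda>x. f (x \<circ> \<sigma>) * g (x \<circ> \<tau>))"
  proof -
    obtain L L' where L: "compact L" "supported m L f" "compact L'" "supported k L' g"
      using f g unfolding test_power_iff by blast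
    have "x i \<in> L \<union> L'" if "f (x \<circ> \<sigma>) * g (x \<circ> \<tau>) \<noteq> 0" "i < n" for x i
    proof -
      have "f (x \<circ> \<sigma>) \<noteq> 0" "g (x \<circ> \<tau>) \<noteq> 0" using that by auto
      then have "\<forall>j<m. x (\<sigma> j) \<in> L" "\<forall>j<k. x (\<tau> j) \<in> L'"
        using L unfolding supported_def by fastforce+
      moreover have "i \<in> \<sigma> ` {..<m} \<union> \<tau> ` {..<k}" using un that by auto
      ultimately show ?thesis by auto
    qed
    then show ?thesis using L by (intro exI[of _ "L \<union> L'"]) (auto simp: supported_def compact_Un)
  qed
  moreover have "f (x \<circ> \<sigma>) * g (x \<circ> \<tau>) = f (x' \<circ> \<sigma>) * g (x' \<circ> \<tau>)" if "\<forall>i<n. x i = x' i" for x x'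
  proof -
    have "f (x \<circ> \<sigma>) = f (x' \<circ> \<sigma>)" "g (x \<circ> \<tau>) = g (x' \<circ> \<tau>)"
      using that \<sigma>(2) \<tau>(2)
      by (auto intro!: test_power_local[OF f] test_power_local[OF g] simp: image_subset_iff)
    then show ?thesis by simp
  qed
  ultimately show ?thesis unfolding test_power_iff by blast
qed

lemma test_power_continuous:
  assumes f: "f \<in> test_power A n"
  shows "continuous_on UNIV f"
  unfolding continuous_on_eq_continuous_at[OF open_UNIV]
proof
  fix x :: "nat \<Rightarrow> 'a"
  have "\<forall>i. \<exists>c\<in>A. x i \<in> fst c" using atlas_cover[OF A] by simp
  then obtain c where c: "\<And>i. c i \<in> A" "\<And>i. x i \<in> fst (c i)" by metis
  let ?N = "{x. \<forall>i<n. x i \<in> fst (c i)}"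
  have "?N = (\<Inter>i\<in>{..<n}. {x. x i \<in> fst (c i)})" by auto
  also have "open \<dots>" using c by (intro open_INT ballI open_coord atlas_open_fst[OF A]) auto
  finally have N: "open ?N" .
  \<comment> \<open>The function ignores the coordinates from \<open>n\<close> on; a constant there
    keeps \<open>?r\<close> continuous.\<close>
  let ?r = "\<lambda>x i. if i < n then snd (c i) (x i) else 0"
  have r: "continuous_on ?N ?r"
  proof (rule continuous_on_coordinatewise_then_product)
    fix i
    show "continuous_on ?N (\<lambda>x. ?r x i)"
    proof (cases "i < n")
      case True
      have "continuous_on (fst (c i)) (snd (c i))"
        using atlas_homeomorphism[OF A c(1)] by (simp add: homeomorphism_def)
      then have "continuous_on ?N (\<lambda>x. snd (c i) (x i))"
        by (rule continuous_on_compose2) (use True in \<open>auto intro: continuous_on_subset[OF continuous_on_product_coordinates]\<close>)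
      then show ?thesis using True by simp
    qed simp
  qed
  have "continuous_on (coord_open n c) (local_rep c f)"
    using f c(1) smooth_coord_continuous unfolding test_power_iff by blast
  then have "continuous_on ?N (\<lambda>x. local_rep c f (?r x))"
    by (rule continuous_on_compose2[OF _ r]) (auto simp: coord_open_def target_def)
  moreover have "local_rep c f (?r x') = f x'" if "x' \<in> ?N" for x'
  proof -
    show ?thesis unfolding local_rep_def
      by (rule test_power_local[OF f]) (use that chart_inv_chart[OF A c(1)] in simp)
  qed
  ultimately have "continuous_on ?N f" by (rule continuous_on_eq)
  then show "isCont f x" using N c(2) by (auto simp: continuous_on_eq_continuous_at)
qed

end

text \<open>Points of \<open>L^n\<close> are encoded with infinitely many free coordinates, and the
  set of all of them need not be compact. Freezing the coordinates from \<open>n\<close> on gives a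
  compact copy, by Tychonoff.\<close>

lemma compact_power:
  assumes "compact L"
  shows "compact {x :: nat \<Rightarrow> 'a::topological_space. (\<forall>i<n. x i \<in> L) \<and> (\<forall>i\<ge>n. x i = a)}"
proof -
  have eq: "{x :: nat \<Rightarrow> 'a. (\<forall>i<n. x i \<in> L) \<and> (\<forall>i\<ge>n. x i = a)} = PiE UNIV (\<lambda>i. if i < n then L else {a})"
    by (auto simp: PiE_iff split: if_splits; metis leI)
  have "compactin (product_topology (\<lambda>i::nat. euclidean) UNIV) (PiE UNIV (\<lambda>i. if i < n then L else {a}))"
    unfolding compactin_PiE using assms by auto
  then show ?thesis unfolding eq euclidean_product_topology by simp
qed

lemma test_power_bounded:
  fixes A :: "('a::t2_space, 'd::finite) chart set"
  assumes A: "smooth_atlas A" and f: "f \<in> test_power A n"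
  shows "\<exists>B. \<forall>x. norm (f x) \<le> B"
proof -
  obtain L where L: "compact L" "supported n L f" using f unfolding test_power_iff by blast
  let ?S = "{x. (\<forall>i<n. x i \<in> L) \<and> (\<forall>i\<ge>n. x i = undefined)}"
  have "compact (f ` ?S)"
    by (rule compact_continuous_image[OF continuous_on_subset[OF test_power_continuous[OF A f]] compact_power[OF L(1)]]) simp
  from compact_imp_bounded[OF this] obtain B where B: "\<forall>z\<in>f ` ?S. norm z \<le> B"
    unfolding bounded_iff by blast
  have "norm (f x) \<le> max B 0" for x
  proof (cases "f x = 0")
    case False
    let ?x = "\<lambda>i. if i < n then x i else undefined"
    have "f x = f ?x" by (rule test_power_local[OF f]) simp
    moreover have "?x \<in> ?S" using False L(2) by (auto simp: supported_def)
    then have "norm (f ?x) \<le> B" using B by blast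
    ultimately show ?thesis by simp
  qed auto
  then show ?thesis by blast
qed

section \<open>Functions of finite configurations\<close>

lemma size_cfg [simp]: "size (cfg x I) = card I"
  by (simp add: cfg_def)

lemma set_mset_cfg [simp]: "finite I \<Longrightarrow> set_mset (cfg x I) = x ` I"
  by (simp add: cfg_def)

lemma cfg_reindex: "inj_on \<tau> I \<Longrightarrow> cfg (x \<circ> \<tau>) I = cfg x (\<tau> ` I)"
  by (simp add: cfg_def image_mset_mset_set[symmetric] multiset.map_comp)

lemma cfg_cong: "(\<And>i. i \<in> I \<Longrightarrow> x i = x' i) \<Longrightarrow> cfg x I = cfg x' I"
  unfolding cfg_def by (cases "finite I") (auto intro: image_mset_cong)

lemma cfg_diff: "finite I \<Longrightarrow> i \<in> I \<Longrightarrow> cfg x (I - {i}) = cfg x I - {#x i#}"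
  by (simp add: cfg_def mset_set.remove[of I i])

lemma sum_mset_cfg: "(\<Sum>y\<in>#cfg x I. f y) = (\<Sum>i\<in>I. f (x i))"
  by (simp add: cfg_def multiset.map_comp comp_def sum_unfold_sum_mset)

lemma cfg_nth: "cfg (\<lambda>i. xs ! i) {..<length xs} = mset xs"
proof -
  have "mset xs = mset (map ((!) xs) [0..<length xs])" by (simp add: map_nth)
  then show ?thesis by (simp add: cfg_def atLeast0LessThan)
qed

lemma exists_enum: "\<exists>x. cfg x {..<size \<eta>} = \<eta>"
proof -
  obtain xs where "mset xs = \<eta>" using ex_mset by blast
  then show ?thesis using cfg_nth[of xs] by auto
qed

lemma P3_subset: "P3 I \<subseteq> Pow I \<times> Pow I \<times> Pow I"
  by (auto simp: P3_def)

lemma finite_P3: "finite I \<Longrightarrow> finite (P3 I)"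
  by (rule finite_subset[OF P3_subset]) auto

lemma image_P3:
  assumes "p permutes I" "(a, b, c) \<in> P3 I"
  shows "(p ` a, p ` b, p ` c) \<in> P3 I"
proof -
  have "inj p" using permutes_inj[OF assms(1)] .
  then have "p ` a \<inter> p ` b = {}" "p ` a \<inter> p ` c = {}" "p ` b \<inter> p ` c = {}"
    using assms(2) by (auto simp: P3_def image_Int[symmetric])
  moreover have "p ` a \<union> p ` b \<union> p ` c = I"
    using assms by (auto simp: P3_def image_Un[symmetric] permutes_image)
  ultimately show ?thesis by (simp add: P3_def)
qed

text \<open>Two enumerations of the same multiset differ by a permutation of the indices, and this
  permutation acts bijectively on \<open>P3\<close>. Hence the enumeration chosen inside the
  definition can be replaced by any other.\<close>

lemma conv_cfg:
  "(G\<^sub>1 \<star> G\<^sub>2) (cfg x {..<n}) =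
     (\<Sum>(a, b, c)\<in>P3 {..<n}. G\<^sub>1 (cfg x (a \<union> b)) * G\<^sub>2 (cfg x (b \<union> c)))"
proof -
  let ?x = "SOME x'. cfg x' {..<n} = cfg x {..<n}"
  have "cfg ?x {..<n} = cfg x {..<n}" by (rule someI[of _ x]) simp
  then obtain p where p: "p permutes {..<n}" and px: "\<And>i. i \<in> {..<n} \<Longrightarrow> ?x i = x (p i)"
    unfolding cfg_def by (rule image_mset_eq_implies_permutes[OF finite_lessThan]) blast
  have q: "inv p permutes {..<n}" by (rule permutes_inv[OF p])
  have eq: "cfg ?x a = cfg x (p ` a)" if "a \<subseteq> {..<n}" for a
  proof -
    have "cfg ?x a = cfg (x \<circ> p) a" using that px by (intro cfg_cong) auto
    then show ?thesis using permutes_inj_on[OF p] by (simp add: cfg_reindex)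
  qed
  have "(G\<^sub>1 \<star> G\<^sub>2) (cfg x {..<n}) =
     (\<Sum>(a, b, c)\<in>P3 {..<n}. G\<^sub>1 (cfg ?x (a \<union> b)) * G\<^sub>2 (cfg ?x (b \<union> c)))"
    by (simp add: conv_def Let_def)
  also have "\<dots> = (\<Sum>(a, b, c)\<in>P3 {..<n}. G\<^sub>1 (cfg x (a \<union> b)) * G\<^sub>2 (cfg x (b \<union> c)))"
  proof (rule sum.reindex_bij_witness[where i = "\<lambda>(a, b, c). (inv p ` a, inv p ` b, inv p ` c)"
        and j = "\<lambda>(a, b, c). (p ` a, p ` b, p ` c)"])
    fix t assume "t \<in> P3 {..<n}"
    then obtain a b c where t: "t = (a, b, c)" "(a, b, c) \<in> P3 {..<n}" by (cases t) auto
    then have sub: "a \<union> b \<subseteq> {..<n}" "b \<union> c \<subseteq> {..<n}" by (auto simp: P3_def)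
    show "(case case t of (a, b, c) \<Rightarrow> (p ` a, p ` b, p ` c) of
         (a, b, c) \<Rightarrow> G\<^sub>1 (cfg x (a \<union> b)) * G\<^sub>2 (cfg x (b \<union> c))) =
       (case t of (a, b, c) \<Rightarrow> G\<^sub>1 (cfg ?x (a \<union> b)) * G\<^sub>2 (cfg ?x (b \<union> c)))"
      by (simp add: t eq[OF sub(1)] eq[OF sub(2)] image_Un)
    show "(case t of (a, b, c) \<Rightarrow> (p ` a, p ` b, p ` c)) \<in> P3 {..<n}"
      using image_P3[OF p t(2)] by (simp add: t)
    show "(case t of (a, b, c) \<Rightarrow> (inv p ` a, inv p ` b, inv p ` c)) \<in> P3 {..<n}"
      using image_P3[OF q t(2)] by (simp add: t)
    show "(case case t of (a, b, c) \<Rightarrow> (p ` a, p ` b, p ` c) of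
        (a, b, c) \<Rightarrow> (inv p ` a, inv p ` b, inv p ` c)) = t"
      "(case case t of (a, b, c) \<Rightarrow> (inv p ` a, inv p ` b, inv p ` c) of
        (a, b, c) \<Rightarrow> (p ` a, p ` b, p ` c)) = t"
      by (simp_all add: t image_image permutes_inverses[OF p])
  qed
  finally show ?thesis .
qed

text \<open>Continuity for \<open>mconf_topology\<close>: a map out of a disjoint union of quotients
  is continuous iff all its lifts to the powers are.\<close>

definition mset_cont :: "('a::topological_space multiset \<Rightarrow> 'b::topological_space) \<Rightarrow> bool" where
  "mset_cont G \<longleftrightarrow> (\<forall>n. continuous_on UNIV (\<lambda>x. G (cfg x {..<n})))"

definition bsupp :: "nat \<Rightarrow> 'a set \<Rightarrow> ('a multiset \<Rightarrow> 'b::zero) \<Rightarrow> bool" where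
  "bsupp N L G \<longleftrightarrow> (\<forall>\<eta>. G \<eta> \<noteq> 0 \<longrightarrow> size \<eta> \<le> N \<and> set_mset \<eta> \<subseteq> L)"

lemma mset_cont_cfg:
  assumes "mset_cont G" "finite I"
  shows "continuous_on UNIV (\<lambda>x. G (cfg x I))"
proof -
  obtain \<tau> where \<tau>: "bij_betw \<tau> {..<card I} I"
    using ex_bij_betw_nat_finite[OF \<open>finite I\<close>] by (auto simp: atLeast0LessThan)
  then have "cfg x I = cfg (x \<circ> \<tau>) {..<card I}" for x :: "nat \<Rightarrow> 'a"
    by (simp add: cfg_reindex bij_betw_def)
  moreover have "continuous_on UNIV (\<lambda>x. G (cfg (x \<circ> \<tau>) {..<card I}))"
    using assms(1) unfolding mset_cont_def
    by (intro continuous_on_compose2[OF _ continuous_reindex, of UNIV "\<lambda>x. G (cfg x {..<card I})"]) auto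
  ultimately show ?thesis by simp
qed

lemma mset_cont_conv:
  assumes "mset_cont G\<^sub>1" "mset_cont G\<^sub>2"
  shows "mset_cont (G\<^sub>1 \<star> G\<^sub>2)"
  unfolding mset_cont_def conv_cfg
proof (intro allI continuous_on_sum)
  fix n t assume "t \<in> P3 {..<n}"
  moreover obtain a b c where abc: "t = (a, b, c)" by (cases t)
  ultimately have "a \<union> b \<subseteq> {..<n}" "b \<union> c \<subseteq> {..<n}" by (auto simp: P3_def)
  then have t: "t = (a, b, c)" "finite (a \<union> b)" "finite (b \<union> c)"
    using abc by (auto intro: finite_subset[OF _ finite_lessThan[of n]])
  show "continuous_on UNIV (\<lambda>x. case t of (a, b, c) \<Rightarrow> G\<^sub>1 (cfg x (a \<union> b)) * G\<^sub>2 (cfg x (b \<union> c)))"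
    unfolding t(1) prod.case
    by (intro continuous_on_mult mset_cont_cfg[OF assms(1) t(2)] mset_cont_cfg[OF assms(2) t(3)])
qed

text \<open>In a nonzero term both factors are nonzero, and \<open>a \<union> b\<close> and
  \<open>b \<union> c\<close> together exhaust the indices; so the bounds on the sizes add and all
  points lie in \<open>L\<close>.\<close>

lemma bsupp_conv:
  assumes "bsupp N L G\<^sub>1" "bsupp M L G\<^sub>2"
  shows "bsupp (N + M) L (G\<^sub>1 \<star> G\<^sub>2)"
  unfolding bsupp_def
proof (intro allI impI)
  fix \<eta> assume nz: "(G\<^sub>1 \<star> G\<^sub>2) \<eta> \<noteq> 0"
  obtain x where x: "cfg x {..<size \<eta>} = \<eta>" using exists_enum by blast
  let ?n = "size \<eta>"
  have "(\<Sum>(a, b, c)\<in>P3 {..<?n}. G\<^sub>1 (cfg x (a \<union> b)) * G\<^sub>2 (cfg x (b \<union> c))) \<noteq> 0"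
    using nz conv_cfg[of G\<^sub>1 G\<^sub>2 x ?n] x by simp
  then obtain t where t: "t \<in> P3 {..<?n}"
    "(case t of (a, b, c) \<Rightarrow> G\<^sub>1 (cfg x (a \<union> b)) * G\<^sub>2 (cfg x (b \<union> c))) \<noteq> 0"
    using sum.neutral[of "P3 {..<?n}"] by blast
  obtain a b c where abc: "t = (a, b, c)" by (cases t)
  have un: "(a \<union> b) \<union> (b \<union> c) = {..<?n}" using t(1) abc by (auto simp: P3_def)
  then have fin: "finite (a \<union> b)" "finite (b \<union> c)" by (metis finite_Un finite_lessThan)+
  have "G\<^sub>1 (cfg x (a \<union> b)) \<noteq> 0" "G\<^sub>2 (cfg x (b \<union> c)) \<noteq> 0" using t(2) abc by auto
  then have *: "card (a \<union> b) \<le> N" "x ` (a \<union> b) \<subseteq> L" "card (b \<union> c) \<le> M" "x ` (b \<union> c) \<subseteq> L"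
    using assms(1)[unfolded bsupp_def, rule_format, of "cfg x (a \<union> b)"]
      assms(2)[unfolded bsupp_def, rule_format, of "cfg x (b \<union> c)"]
    unfolding size_cfg set_mset_cfg[OF fin(1)] set_mset_cfg[OF fin(2)] by simp_all
  have "?n \<le> card (a \<union> b) + card (b \<union> c)" using card_Un_le[of "a \<union> b" "b \<union> c"] un by simp
  moreover have "set_mset \<eta> = x ` {..<?n}" using x set_mset_cfg[of "{..<?n}" x] by simp
  then have "set_mset \<eta> \<subseteq> L" using * un by (metis image_Un le_sup_iff)
  ultimately show "size \<eta> \<le> N + M \<and> set_mset \<eta> \<subseteq> L" using * by simp
qed

text \<open>Parts of a simple configuration are simple, so the convolution there is controlled by
  values on simple configurations. The approximations below are uniform exactly on these.\<close>

lemma norm_conv_le: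
  fixes B\<^sub>1 B\<^sub>2 :: real
  assumes "\<And>\<eta>. finite \<eta> \<Longrightarrow> norm (G\<^sub>1 (mset_set \<eta>)) \<le> B\<^sub>1"
    "\<And>\<eta>. finite \<eta> \<Longrightarrow> norm (G\<^sub>2 (mset_set \<eta>)) \<le> B\<^sub>2" and "finite \<eta>"
  shows "norm ((G\<^sub>1 \<star> G\<^sub>2) (mset_set \<eta>)) \<le> card (P3 {..<card \<eta>}) * (B\<^sub>1 * B\<^sub>2)"
proof -
  let ?n = "card \<eta>"
  obtain x where x: "cfg x {..<?n} = mset_set \<eta>" using exists_enum[of "mset_set \<eta>"] by auto
  have "x ` {..<?n} = \<eta>" using set_mset_cfg[of "{..<?n}" x] x \<open>finite \<eta>\<close> by simp
  then have inj: "inj_on x {..<?n}" by (intro eq_card_imp_inj_on) simp_all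
  have simple: "cfg x I = mset_set (x ` I)" if "I \<subseteq> {..<?n}" for I
    unfolding cfg_def by (rule image_mset_mset_set[OF inj_on_subset[OF inj that]])
  have "0 \<le> B\<^sub>1" using assms(1)[of "{}"] norm_ge_zero order_trans by blast
  have "norm (\<Sum>t\<in>P3 {..<?n}. case t of (a, b, c) \<Rightarrow> G\<^sub>1 (cfg x (a \<union> b)) * G\<^sub>2 (cfg x (b \<union> c)))
      \<le> (\<Sum>t\<in>P3 {..<?n}. B\<^sub>1 * B\<^sub>2)"
  proof (rule sum_norm_le)
    fix t assume t: "t \<in> P3 {..<?n}"
    obtain a b c where abc: "t = (a, b, c)" by (cases t)
    have sub: "a \<union> b \<subseteq> {..<?n}" "b \<union> c \<subseteq> {..<?n}" using t abc by (auto simp: P3_def)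
    have "norm (G\<^sub>1 (cfg x (a \<union> b))) \<le> B\<^sub>1" "norm (G\<^sub>2 (cfg x (b \<union> c))) \<le> B\<^sub>2"
      unfolding simple[OF sub(1)] simple[OF sub(2)]
      by (intro assms finite_imageI finite_subset[OF sub(1)] finite_subset[OF sub(2)] finite_lessThan)+
    then show "norm (case t of (a, b, c) \<Rightarrow> G\<^sub>1 (cfg x (a \<union> b)) * G\<^sub>2 (cfg x (b \<union> c))) \<le> B\<^sub>1 * B\<^sub>2"
      using \<open>0 \<le> B\<^sub>1\<close> by (auto simp: abc norm_mult intro!: mult_mono)
  qed
  then show ?thesis using conv_cfg[of G\<^sub>1 G\<^sub>2 x ?n] x by simp
qed

text \<open>\<open>ins \<phi> G\<close> is an unnormalised symmetric product of
  \<open>\<phi>\<close> and \<open>G\<close>, and \<open>lin \<phi>\<close> multiplies by the sum of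
  \<open>\<phi>\<close> over the configuration. They are the two parts of convolution with
  \<open>\<phi>\<close>, the first raising the degree by one and the second preserving it.\<close>

definition ins :: "('a \<Rightarrow> real) \<Rightarrow> ('a multiset \<Rightarrow> complex) \<Rightarrow> 'a multiset \<Rightarrow> complex" where
  "ins \<phi> G \<eta> = (\<Sum>x\<in>#\<eta>. complex_of_real (\<phi> x) * G (\<eta> - {#x#}))"

definition lin :: "('a \<Rightarrow> real) \<Rightarrow> ('a multiset \<Rightarrow> complex) \<Rightarrow> 'a multiset \<Rightarrow> complex" where
  "lin \<phi> G \<eta> = (\<Sum>x\<in>#\<eta>. complex_of_real (\<phi> x)) * G \<eta>"

definition one_fun :: "'a multiset \<Rightarrow> complex" where
  "one_fun \<eta> = (if \<eta> = {#} then 1 else 0)"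

lemma ins_cfg: "ins \<phi> G (cfg x {..<n}) = (\<Sum>i<n. complex_of_real (\<phi> (x i)) * G (cfg x ({..<n} - {i})))"
  unfolding ins_def sum_mset_cfg by (intro sum.cong) (auto simp: cfg_diff)

lemma lin_cfg: "lin \<phi> G (cfg x {..<n}) = (\<Sum>i<n. complex_of_real (\<phi> (x i)) * G (cfg x {..<n}))"
  unfolding lin_def sum_mset_cfg by (simp add: sum_distrib_right)

text \<open>A triple contributes only if \<open>a \<union> b\<close> is a single index. If this
  index lies in \<open>a\<close>, it is missing from the argument of \<open>G\<close>, which gives
  \<open>ins\<close>; if it lies in \<open>b\<close>, \<open>G\<close> still sees all points, which
  gives \<open>lin\<close>.\<close>

lemma conv_test:
  "(tensor_power (\<lambda>x. complex_of_real (\<phi> x)) 1 \<star> G) \<eta> = ins \<phi> G \<eta> + lin \<phi> G \<eta>"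
proof -
  let ?T = "tensor_power (\<lambda>x. complex_of_real (\<phi> x)) 1"
  obtain x where x: "cfg x {..<size \<eta>} = \<eta>" using exists_enum by blast
  let ?n = "size \<eta>"
  let ?g = "\<lambda>t. case t of (a, b, c) \<Rightarrow> ?T (cfg x (a \<union> b)) * G (cfg x (b \<union> c))"
  let ?A = "(\<lambda>i. ({i}, {}, {..<?n} - {i})) ` {..<?n}" and ?B = "(\<lambda>i. ({}, {i}, {..<?n} - {i})) ` {..<?n}"
  have T: "?T (cfg x {i}) = complex_of_real (\<phi> (x i))" for i
    by (simp add: tensor_power_def cfg_def)
  have "(?T \<star> G) \<eta> = sum ?g (P3 {..<?n})" using conv_cfg[of ?T G x ?n] x by simp
  also have "\<dots> = sum ?g (?A \<union> ?B)"
  proof (rule sum.mono_neutral_right[OF finite_P3])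
    show "?A \<union> ?B \<subseteq> P3 {..<?n}" by (auto simp: P3_def)
    show "\<forall>t\<in>P3 {..<?n} - (?A \<union> ?B). ?g t = 0"
    proof
      fix t assume t: "t \<in> P3 {..<?n} - (?A \<union> ?B)"
      obtain a b c where abc: "t = (a, b, c)" by (cases t)
      have P: "a \<union> b \<union> c = {..<?n}" "a \<inter> b = {}" "a \<inter> c = {}" "b \<inter> c = {}"
        using t abc by (auto simp: P3_def)
      have "card (a \<union> b) \<noteq> 1"
      proof
        assume "card (a \<union> b) = 1"
        then obtain i where i: "a \<union> b = {i}" using card_1_singletonE by blast
        then have "i < ?n" using P by auto
        have c: "c = {..<?n} - {i}" using P i by auto
        from i have "a = {i} \<and> b = {} \<or> a = {} \<and> b = {i}"
          using P(2) unfolding Un_singleton_iff by auto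
        then have "t \<in> ?A \<union> ?B" using abc c \<open>i < ?n\<close> by auto
        then show False using t by simp
      qed
      then show "?g t = 0" by (simp add: abc tensor_power_def)
    qed
  qed simp
  also have "\<dots> = sum ?g ?A + sum ?g ?B" by (rule sum.union_disjoint) auto
  also have "sum ?g ?A = (\<Sum>i<?n. complex_of_real (\<phi> (x i)) * G (cfg x ({..<?n} - {i})))"
    by (subst sum.reindex) (auto simp: inj_on_def T[unfolded One_nat_def])
  also have "sum ?g ?B = (\<Sum>i<?n. complex_of_real (\<phi> (x i)) * G (cfg x {..<?n}))"
  proof (subst sum.reindex)
    show "sum (?g \<circ> (\<lambda>i. ({}, {i}, {..<?n} - {i}))) {..<?n} =
        (\<Sum>i<?n. complex_of_real (\<phi> (x i)) * G (cfg x {..<?n}))"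
      by (intro sum.cong) (auto simp: T[unfolded One_nat_def] insert_absorb)
  qed (auto simp: inj_on_def)
  finally show ?thesis using ins_cfg[of \<phi> G x ?n] lin_cfg[of \<phi> G x ?n] x by simp
qed

text \<open>The unit vanishes off the empty configuration, which forces \<open>b\<close> and
  \<open>c\<close> to be empty; only the triple with \<open>a\<close> the whole index set
  survives.\<close>

lemma conv_one: "(G \<star> one_fun) \<eta> = G \<eta>"
proof -
  obtain x where x: "cfg x {..<size \<eta>} = \<eta>" using exists_enum by blast
  let ?n = "size \<eta>"
  let ?g = "\<lambda>t. case t of (a, b, c) \<Rightarrow> G (cfg x (a \<union> b)) * one_fun (cfg x (b \<union> c))"
  have "(G \<star> one_fun) \<eta> = sum ?g (P3 {..<?n})" using conv_cfg[of G one_fun x ?n] x by simp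
  also have "\<dots> = sum ?g {({..<?n}, {}, {})}"
  proof (rule sum.mono_neutral_right[OF finite_P3])
    show "{({..<?n}, {}, {})} \<subseteq> P3 {..<?n}" by (auto simp: P3_def)
    show "\<forall>t\<in>P3 {..<?n} - {({..<?n}, {}, {})}. ?g t = 0"
    proof
      fix t assume t: "t \<in> P3 {..<?n} - {({..<?n}, {}, {})}"
      obtain a b c where abc: "t = (a, b, c)" by (cases t)
      have fin: "finite (b \<union> c)" using t abc by (auto simp: P3_def intro: finite_subset[OF _ finite_lessThan[of ?n]])
      have "b \<union> c \<noteq> {}" using t abc by (auto simp: P3_def)
      then have "set_mset (cfg x (b \<union> c)) \<noteq> {}" using fin by simp
      then show "?g t = 0" by (auto simp: abc one_fun_def)
    qed
  qed simp
  also have "\<dots> = G \<eta>" using x by (simp add: one_fun_def cfg_def)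
  finally show ?thesis .
qed

text \<open>Splitting the sum of \<open>\<psi>\<close> over \<open>\<eta>\<close> at the
  distinguished point \<open>x\<close> leaves \<open>\<psi> x\<close> and the sum over the remaining
  points: \<open>lin \<psi>\<close> acts like a derivation.\<close>

lemma lin_ins: "lin \<psi> (ins \<phi> G) \<eta> = ins (\<lambda>x. \<psi> x * \<phi> x) G \<eta> + ins \<phi> (lin \<psi> G) \<eta>"
proof -
  have "(\<Sum>y\<in>#\<eta>. complex_of_real (\<psi> y)) * (complex_of_real (\<phi> x) * G (\<eta> - {#x#})) =
     complex_of_real (\<psi> x * \<phi> x) * G (\<eta> - {#x#}) + complex_of_real (\<phi> x) * lin \<psi> G (\<eta> - {#x#})"
    if "x \<in># \<eta>" for x
  proof -
    obtain \<xi> where "\<eta> = add_mset x \<xi>" using \<open>x \<in># \<eta>\<close> by (rule mset_add)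
    then show ?thesis by (simp add: lin_def algebra_simps)
  qed
  then show ?thesis
    unfolding lin_def[of \<psi> "ins \<phi> G"] ins_def sum_mset_distrib_left
    by (simp add: sum_mset.distrib[symmetric] cong: image_mset_cong)
qed

text \<open>This is \<open>n!\<close> times the symmetrised tensor product of the \<open>n\<close>
  functions in the list.\<close>

primrec sfun :: "('a \<Rightarrow> real) list \<Rightarrow> 'a multiset \<Rightarrow> complex" where
  "sfun [] = one_fun"
| "sfun (\<phi> # \<phi>s) = ins \<phi> (sfun \<phi>s)"

definition prodl :: "('a \<Rightarrow> real) list \<Rightarrow> 'a list \<Rightarrow> real" where
  "prodl \<phi>s xs = (\<Prod>(\<phi>, x)\<leftarrow>zip \<phi>s xs. \<phi> x)"

lemma prodl_Cons [simp]: "prodl (\<phi> # \<phi>s) (x # xs) = \<phi> x * prodl \<phi>s xs"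
  by (simp add: prodl_def)

lemma prodl_nth: "length xs = length \<phi>s \<Longrightarrow> prodl \<phi>s xs = (\<Prod>i<length \<phi>s. (\<phi>s ! i) (xs ! i))"
  by (induction xs \<phi>s rule: list_induct2) (simp_all add: prod.lessThan_Suc_shift del: prod.lessThan_Suc, simp add: prodl_def)

text \<open>On a simple configuration the successive removal of points runs through the orderings of
  the set, one for each assignment of points to factors.\<close>

lemma sfun_mset_set:
  assumes "finite \<eta>"
  shows "sfun \<phi>s (mset_set \<eta>) =
    (if card \<eta> = length \<phi>s then complex_of_real (\<Sum>xs\<in>permutations_of_set \<eta>. prodl \<phi>s xs) else 0)"
  using assms
proof (induction \<phi>s arbitrary: \<eta>)
  case Nil
  then show ?case by (simp add: one_fun_def mset_set_empty_iff prodl_def)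
next
  case (Cons \<phi> \<phi>s)
  have ins: "ins \<phi> (sfun \<phi>s) (mset_set \<eta>) = (\<Sum>x\<in>\<eta>. complex_of_real (\<phi> x) * sfun \<phi>s (mset_set (\<eta> - {x})))"
    unfolding ins_def sum_unfold_sum_mset
    using Cons.prems by (intro arg_cong[where f = sum_mset] image_mset_cong) (simp add: mset_set_Diff)
  show ?case
  proof (cases "card \<eta> = length (\<phi> # \<phi>s)")
    case True
    then have ne: "\<eta> \<noteq> {}" by auto
    have "(\<Sum>xs\<in>permutations_of_set \<eta>. prodl (\<phi> # \<phi>s) xs) =
      (\<Sum>x\<in>\<eta>. \<Sum>xs\<in>(#) x ` permutations_of_set (\<eta> - {x}). prodl (\<phi> # \<phi>s) xs)"
      unfolding permutations_of_set_nonempty[OF ne]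
      using Cons.prems by (intro sum.UNION_disjoint) auto
    also have "\<dots> = (\<Sum>x\<in>\<eta>. \<phi> x * (\<Sum>xs\<in>permutations_of_set (\<eta> - {x}). prodl \<phi>s xs))"
      by (intro sum.cong refl, subst sum.reindex) (auto simp: sum_distrib_left)
    finally show ?thesis using True Cons by (simp add: ins)
  next
    case False
    have "sfun \<phi>s (mset_set (\<eta> - {x})) = 0" if "x \<in> \<eta>" for x
    proof -
      have "card (\<eta> - {x}) = card \<eta> - 1" "card \<eta> > 0" using that Cons.prems by (auto simp: card_gt_0_iff)
      then show ?thesis using Cons False by auto
    qed
    then show ?thesis using False by (simp add: ins)
  qed
qed

section \<open>Closure properties of \<open>F_fin\<close>\<close>

lemma F_fin_iff:
  "G \<in> F_fin A \<longleftrightarrow> (\<forall>n. (\<lambda>x. G (cfg x {..<n})) \<in> test_power A n) \<and> (\<exists>N. \<forall>\<eta>. size \<eta> > N \<longrightarrow> G \<eta> = 0)"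
proof -
  have "(\<forall>n>N. part n G = (\<lambda>_. 0)) \<longleftrightarrow> (\<forall>\<eta>. size \<eta> > N \<longrightarrow> G \<eta> = 0)" for N
    by (auto simp: part_def fun_eq_iff)
  moreover have "part n G \<in> sym_test A n \<longleftrightarrow> (\<lambda>x. G (cfg x {..<n})) \<in> test_power A n" for n
    by (simp add: sym_test_def part_def)
  ultimately show ?thesis by (simp add: F_fin_def)
qed

context
  fixes A :: "('a::t2_space, 'd::finite) chart set"
  assumes A: "smooth_atlas A"
begin

lemma test_power_sum:
  fixes f :: "'i \<Rightarrow> (nat \<Rightarrow> 'a) \<Rightarrow> 'b::real_normed_algebra"
  assumes "\<And>i. i \<in> I \<Longrightarrow> f i \<in> test_power A n"
  shows "(\<lambda>x. \<Sum>i\<in>I. f i x) \<in> test_power A n"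
  using assms
  by (induction I rule: infinite_finite_induct) (auto intro: test_power_zero[OF A] test_power_add[OF A])

lemma F_fin_linear:
  assumes "G \<in> F_fin A" "bounded_linear h"
  shows "(\<lambda>\<eta>. h (G \<eta>)) \<in> F_fin A"
proof -
  have "h 0 = 0" using assms(2) by (rule linear_simps)
  then show ?thesis using assms test_power_linear[OF A] unfolding F_fin_iff by metis
qed

lemma F_fin_scale: "G \<in> F_fin A \<Longrightarrow> (\<lambda>\<eta>. c * G \<eta>) \<in> F_fin A"
  by (rule F_fin_linear[OF _ bounded_linear_mult_right])

lemma F_fin_cnj: "G \<in> F_fin A \<Longrightarrow> (\<lambda>\<eta>. cnj (G \<eta>)) \<in> F_fin A"
  by (rule F_fin_linear[OF _ bounded_linear_cnj])

lemma F_fin_zero: "(\<lambda>_. 0) \<in> F_fin A"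
  by (simp add: F_fin_iff test_power_zero[OF A])

lemma F_fin_add:
  assumes "G \<in> F_fin A" "H \<in> F_fin A"
  shows "(\<lambda>\<eta>. G \<eta> + H \<eta>) \<in> F_fin A"
proof -
  obtain N M where "\<forall>\<eta>. size \<eta> > N \<longrightarrow> G \<eta> = 0" "\<forall>\<eta>. size \<eta> > M \<longrightarrow> H \<eta> = 0"
    using assms unfolding F_fin_iff by blast
  then have "\<forall>\<eta>. size \<eta> > max N M \<longrightarrow> G \<eta> + H \<eta> = 0" by simp
  then show ?thesis using assms test_power_add[OF A] unfolding F_fin_iff by blast
qed

lemma F_fin_diff: "G \<in> F_fin A \<Longrightarrow> H \<in> F_fin A \<Longrightarrow> (\<lambda>\<eta>. G \<eta> - H \<eta>) \<in> F_fin A"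
  using F_fin_add[of G "\<lambda>\<eta>. -1 * H \<eta>"] F_fin_scale[of H "-1"] by simp

text \<open>The pointwise product, not \<open>\<star>\<close>; it serves the monotone approximation
  of indicators of open sets.\<close>

lemma F_fin_mult:
  assumes "G \<in> F_fin A" "H \<in> F_fin A"
  shows "(\<lambda>\<eta>. G \<eta> * H \<eta>) \<in> F_fin A"
proof -
  have "(\<lambda>x. G (cfg x {..<n}) * H (cfg x {..<n})) \<in> test_power A n" for n
    using test_power_mult[OF A, of "\<lambda>x. G (cfg x {..<n})" n "\<lambda>x. H (cfg x {..<n})" n id n id] assms
    by (simp add: F_fin_iff)
  then show ?thesis using assms unfolding F_fin_iff by (metis mult_zero_left)
qed

lemma of_real_test: "\<phi> \<in> test_fun A \<Longrightarrow> (\<lambda>x. complex_of_real (\<phi> (x 0))) \<in> test_power A 1"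
  unfolding test_fun_def using test_power_linear[OF A _ bounded_linear_of_real] by blast

lemma test_power_coord_mult:
  assumes \<phi>: "\<phi> \<in> test_fun A" and G: "(\<lambda>x. G (cfg x {..<m})) \<in> test_power A m" and "inj \<tau>"
    and im: "\<tau> ` {..<m} \<subseteq> {..<n}" "i < n" "{..<n} \<subseteq> insert i (\<tau> ` {..<m})"
  shows "(\<lambda>x. complex_of_real (\<phi> (x i)) * G (cfg x (\<tau> ` {..<m}))) \<in> test_power A n"
proof -
  \<comment> \<open>The shift \<open>j + i\<close> is an injection on all of \<open>nat\<close> that
    sends the single variable \<open>0\<close> to \<open>i\<close>.\<close>
  have "(\<lambda>x. complex_of_real (\<phi> ((x \<circ> (\<lambda>j. j + i)) 0)) * G (cfg (x \<circ> \<tau>) {..<m})) \<in> test_power A n"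
    by (rule test_power_mult[OF A of_real_test[OF \<phi>] G _ _ \<open>inj \<tau>\<close> im(1)]) (use im in auto)
  then show ?thesis using \<open>inj \<tau>\<close> by (simp add: cfg_reindex inj_on_subset)
qed

lemma ins_F_fin:
  assumes \<phi>: "\<phi> \<in> test_fun A" and G: "G \<in> F_fin A"
  shows "ins \<phi> G \<in> F_fin A"
  unfolding F_fin_iff
proof (intro conjI allI)
  fix n
  show "(\<lambda>x. ins \<phi> G (cfg x {..<n})) \<in> test_power A n"
    unfolding ins_cfg
  proof (rule test_power_sum)
    fix i assume i: "i \<in> {..<n}"
    \<comment> \<open>The increasing enumeration of the indices other than \<open>i\<close>.\<close>
    let ?\<tau> = "\<lambda>j. if j < i then j else Suc j"
    have im: "?\<tau> ` {..<n - 1} = {..<n} - {i}"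
    proof
      show "{..<n} - {i} \<subseteq> ?\<tau> ` {..<n - 1}"
      proof
        fix j assume "j \<in> {..<n} - {i}"
        then show "j \<in> ?\<tau> ` {..<n - 1}"
          using i by (intro image_eqI[of _ _ "if j < i then j else j - 1"]) auto
      qed
    qed (use i in auto)
    have "inj ?\<tau>" by (auto simp: inj_on_def split: if_splits)
    from test_power_coord_mult[OF \<phi> _ this, of G "n - 1" n i, unfolded im]
    show "(\<lambda>x. complex_of_real (\<phi> (x i)) * G (cfg x ({..<n} - {i}))) \<in> test_power A n"
      using G i by (auto simp: F_fin_iff)
  qed
next
  obtain N where N: "\<forall>\<eta>. size \<eta> > N \<longrightarrow> G \<eta> = 0" using G unfolding F_fin_iff by blast
  have "ins \<phi> G \<eta> = 0" if "size \<eta> > Suc N" for \<eta>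
  proof -
    have "G (\<eta> - {#x#}) = 0" if "x \<in># \<eta>" for x
      using N that \<open>size \<eta> > Suc N\<close> by (simp add: size_Diff_singleton)
    then show ?thesis unfolding ins_def by (simp cong: image_mset_cong)
  qed
  then show "\<exists>N. \<forall>\<eta>. N < size \<eta> \<longrightarrow> ins \<phi> G \<eta> = 0" by blast
qed

lemma lin_F_fin:
  assumes \<phi>: "\<phi> \<in> test_fun A" and G: "G \<in> F_fin A"
  shows "lin \<phi> G \<in> F_fin A"
  unfolding F_fin_iff
proof (intro conjI allI)
  fix n
  show "(\<lambda>x. lin \<phi> G (cfg x {..<n})) \<in> test_power A n"
    unfolding lin_cfg
  proof (rule test_power_sum)
    fix i assume i: "i \<in> {..<n}"
    show "(\<lambda>x. complex_of_real (\<phi> (x i)) * G (cfg x {..<n})) \<in> test_power A n"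
      using test_power_coord_mult[OF \<phi> _ inj_on_id, of G n n i] G i by (auto simp: F_fin_iff)
  qed
next
  show "\<exists>N. \<forall>\<eta>. N < size \<eta> \<longrightarrow> lin \<phi> G \<eta> = 0" using G unfolding F_fin_iff lin_def by auto
qed

lemma conv_test_F_fin:
  assumes "\<phi> \<in> test_fun A" "G \<in> F_fin A"
  shows "tensor_power (\<lambda>x. complex_of_real (\<phi> x)) 1 \<star> G \<in> F_fin A"
proof -
  have "tensor_power (\<lambda>x. complex_of_real (\<phi> x)) 1 \<star> G = (\<lambda>\<eta>. ins \<phi> G \<eta> + lin \<phi> G \<eta>)"
    by (rule ext) (rule conv_test)
  then show ?thesis using F_fin_add[OF ins_F_fin[OF assms] lin_F_fin[OF assms]] by simp
qed

lemma one_F_fin: "one_fun \<in> F_fin A"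
  unfolding F_fin_iff
proof (intro conjI allI)
  fix n
  show "(\<lambda>x. one_fun (cfg x {..<n})) \<in> test_power A n"
  proof (cases n)
    case 0
    have "(\<lambda>x. one_fun (cfg x {..<n})) = (\<lambda>x::nat \<Rightarrow> 'a. 1)" by (simp add: 0 one_fun_def cfg_def)
    moreover have "(\<lambda>x::nat \<Rightarrow> 'a. 1::complex) \<in> test_power A 0"
      unfolding test_power_iff local_rep_def[abs_def] supported_def
      using open_coord_open[OF A] by (auto intro!: smooth_coord_const exI[of _ "{}"])
    ultimately show ?thesis using 0 by simp
  next
    case (Suc m)
    have "cfg x {..<n} \<noteq> {#}" for x :: "nat \<Rightarrow> 'a" by (simp add: Suc cfg_def mset_set_empty_iff lessThan_empty_iff)
    then show ?thesis by (simp add: one_fun_def test_power_zero[OF A])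
  qed
next
  show "\<exists>N. \<forall>\<eta>::'a multiset. N < size \<eta> \<longrightarrow> one_fun \<eta> = 0" by (intro exI[of _ 0]) (auto simp: one_fun_def)
qed

lemma sfun_F_fin: "set \<phi>s \<subseteq> test_fun A \<Longrightarrow> sfun \<phi>s \<in> F_fin A"
  by (induction \<phi>s) (auto intro: one_F_fin ins_F_fin)

lemma F_fin_mset_cont: "G \<in> F_fin A \<Longrightarrow> mset_cont G"
  unfolding mset_cont_def using test_power_continuous[OF A] by (auto simp: F_fin_iff)

lemma F_fin_bounded:
  assumes "G \<in> F_fin A"
  shows "\<exists>B. \<forall>\<eta>. norm (G \<eta>) \<le> B"
proof -
  obtain N where N: "\<forall>\<eta>. size \<eta> > N \<longrightarrow> G \<eta> = 0" using assms unfolding F_fin_iff by blast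
  have "\<forall>n. \<exists>B. \<forall>x. norm (G (cfg x {..<n})) \<le> B"
    using assms test_power_bounded[OF A] by (auto simp: F_fin_iff)
  then obtain B where B: "\<And>n x. norm (G (cfg x {..<n})) \<le> B n" by metis
  have B0: "B n \<ge> 0" for n using B[of _ n] norm_ge_zero order_trans by blast
  have "norm (G \<eta>) \<le> (\<Sum>n\<le>N. B n)" for \<eta>
  proof (cases "size \<eta> \<le> N")
    case True
    obtain x where "cfg x {..<size \<eta>} = \<eta>" using exists_enum by blast
    then have "norm (G \<eta>) \<le> B (size \<eta>)" using B[of x "size \<eta>"] by simp
    also have "\<dots> \<le> (\<Sum>n\<le>N. B n)" using True B0 by (intro member_le_sum) auto
    finally show ?thesis .
  qed (use N B0 in \<open>simp add: sum_nonneg\<close>)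
  then show ?thesis by blast
qed

lemma F_fin_bsupp:
  assumes "G \<in> F_fin A"
  shows "\<exists>N L. compact L \<and> bsupp N L G"
proof -
  obtain N where N: "\<forall>\<eta>. size \<eta> > N \<longrightarrow> G \<eta> = 0" using assms unfolding F_fin_iff by blast
  have "\<forall>n. \<exists>L. compact L \<and> supported n L (\<lambda>x. G (cfg x {..<n}))"
    using assms by (auto simp: F_fin_iff test_power_iff)
  then obtain L where L: "\<And>n. compact (L n)" "\<And>n. supported n (L n) (\<lambda>x. G (cfg x {..<n}))" by metis
  have "bsupp N (\<Union>n\<le>N. L n) G"
    unfolding bsupp_def
  proof (intro allI impI)
    fix \<eta> assume nz: "G \<eta> \<noteq> 0"
    then have le: "size \<eta> \<le> N" using N by (meson not_le)
    obtain x where x: "cfg x {..<size \<eta>} = \<eta>" using exists_enum by blast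
    then have "\<forall>i<size \<eta>. x i \<in> L (size \<eta>)"
      using L(2)[of "size \<eta>"] nz unfolding supported_def by auto
    moreover have "set_mset \<eta> = x ` {..<size \<eta>}" using x set_mset_cfg[of "{..<size \<eta>}" x] by simp
    ultimately show "size \<eta> \<le> N \<and> set_mset \<eta> \<subseteq> (\<Union>n\<le>N. L n)" using le by auto
  qed
  moreover have "compact (\<Union>n\<le>N. L n)" using L(1) by (intro compact_UN) auto
  ultimately show ?thesis by blast
qed

end

section \<open>The form \<open>a\<^sub>\<rho>\<close>\<close>

lemma openin_conf_topology:
  "openin conf_topology U \<longleftrightarrow> (\<exists>V. openin mconf_topology V \<and> U = mset_set -` V \<inter> {\<eta>. finite \<eta>})"
  unfolding conf_topology_def openin_pullback_topology ..

lemma space_conf_borel [simp]: "space conf_borel = {\<eta>. finite \<eta>}"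
  by (simp add: conf_borel_def space_measure_of_conv)

lemma sets_conf_borel: "sets conf_borel = sigma_sets {\<eta>. finite \<eta>} {U. openin conf_topology U}"
  unfolding conf_borel_def by (rule sets_measure_of) (auto simp: openin_conf_topology)

lemma conf_open_measurable: "openin conf_topology U \<Longrightarrow> U \<in> sets conf_borel"
  unfolding sets_conf_borel by (rule sigma_sets.Basic) simp

lemma mset_cont_open: "mset_cont G \<Longrightarrow> open S \<Longrightarrow> openin conf_topology (mset_set -` (G -` S) \<inter> {\<eta>. finite \<eta>})"
  unfolding openin_conf_topology openin_mconf_topology mset_cont_def
  by (intro exI[of _ "G -` S"]) (auto dest: open_vimage simp: vimage_def)

lemma mset_cont_measurable: "mset_cont G \<Longrightarrow> (\<lambda>\<eta>. G (mset_set \<eta>)) \<in> borel_measurable conf_borel"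
  using conf_open_measurable[OF mset_cont_open, of G]
  by (intro borel_measurableI) (simp add: vimage_def)

lemma nconf_open:
  assumes "open U"
  shows "openin conf_topology (nconf U n)"
proof -
  have eq: "{x. cfg x {..<m} \<in> {M. size M = n \<and> set_mset M \<subseteq> U}} =
      (if m = n then \<Inter>i\<in>{..<n}. {x. x i \<in> U} else {})" for m
    by auto
  have "openin mconf_topology {M. size M = n \<and> set_mset M \<subseteq> U}"
    unfolding openin_mconf_topology eq using assms by (auto intro!: open_INT open_coord)
  moreover have "nconf U n = mset_set -` {M. size M = n \<and> set_mset M \<subseteq> U} \<inter> {\<eta>. finite \<eta>}"
    by (auto simp: nconf_def)
  ultimately show ?thesis unfolding openin_conf_topology by blast
qed

text \<open>Within the \<open>n\<close>-point sets, having a point in the open complement of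
  \<open>L\<close> is an open condition.\<close>

lemma nconf_closed:
  assumes "closed L"
  shows "nconf L n \<in> sets conf_borel"
proof -
  let ?V = "{M. size M = n \<and> \<not> set_mset M \<subseteq> L}"
  have eq: "{x. cfg x {..<m} \<in> ?V} = (if m = n then \<Union>i\<in>{..<n}. {x. x i \<in> - L} else {})" for m
    by auto
  have "open {x::nat \<Rightarrow> 'a. x i \<in> - L}" for i using assms by (intro open_coord) auto
  then have "openin mconf_topology ?V"
    unfolding openin_mconf_topology eq by (auto intro!: open_UN simp del: Compl_iff)
  then have "mset_set -` ?V \<inter> {\<eta>. finite \<eta>} \<in> sets conf_borel"
    by (intro conf_open_measurable) (unfold openin_conf_topology, blast)
  moreover have "nconf UNIV n \<in> sets conf_borel"
    by (intro conf_open_measurable nconf_open) simp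
  moreover have "nconf L n = nconf UNIV n - (mset_set -` ?V \<inter> {\<eta>. finite \<eta>})"
    by (auto simp: nconf_def)
  ultimately show ?thesis by auto
qed

lemma conv_add_left: "((\<lambda>\<eta>. G \<eta> + G' \<eta>) \<star> H) \<eta> = (G \<star> H) \<eta> + (G' \<star> H) \<eta>"
  and conv_add_right: "(H \<star> (\<lambda>\<eta>. G \<eta> + G' \<eta>)) \<eta> = (H \<star> G) \<eta> + (H \<star> G') \<eta>"
  and conv_scale_left: "((\<lambda>\<eta>. c * G \<eta>) \<star> H) \<eta> = c * (G \<star> H) \<eta>"
  and conv_scale_right: "(H \<star> (\<lambda>\<eta>. c * G \<eta>)) \<eta> = c * (H \<star> G) \<eta>"
  by (simp_all add: conv_def Let_def sum.distrib[symmetric] sum_distrib_left case_prod_beta algebra_simps)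

text \<open>Collects what the finiteness of the form uses of \<open>F_fin\<close>, without reference
  to smoothness.\<close>

definition cc_fun :: "('a::topological_space multiset \<Rightarrow> complex) \<Rightarrow> bool" where
  "cc_fun G \<longleftrightarrow> mset_cont G \<and> (\<exists>N L. compact L \<and> bsupp N L G) \<and> (\<exists>B. \<forall>\<eta>. norm (G \<eta>) \<le> B)"

lemma F_fin_cc_fun:
  fixes A :: "('a::t2_space, 'd::finite) chart set"
  shows "smooth_atlas A \<Longrightarrow> G \<in> F_fin A \<Longrightarrow> cc_fun G"
  unfolding cc_fun_def by (intro conjI F_fin_mset_cont F_fin_bounded F_fin_bsupp)

lemma bsupp_mono: "bsupp N L G \<Longrightarrow> N \<le> M \<Longrightarrow> L \<subseteq> L' \<Longrightarrow> bsupp M L' G"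
  unfolding bsupp_def by (meson order_trans)

lemma mset_cont_cnj: "mset_cont G \<Longrightarrow> mset_cont (\<lambda>\<eta>. cnj (G \<eta>))"
  by (auto simp: mset_cont_def intro: continuous_intros)

context
  fixes \<rho> :: "'a::t2_space set measure"
  assumes sets_rho: "sets \<rho> = sets conf_borel"
    and rho_bound: "\<And>\<Lambda> :: 'a set. compact \<Lambda> \<Longrightarrow> \<exists>C>0. \<forall>n. emeasure \<rho> (nconf \<Lambda> n) \<le> ennreal (C ^ n)"
begin

lemma space_rho: "space \<rho> = {\<eta>. finite \<eta>}"
  using sets_eq_imp_space_eq[OF sets_rho] by simp

lemma measurable_rho: "borel_measurable \<rho> = borel_measurable conf_borel"
  by (rule measurable_cong_sets[OF sets_rho refl])

definition rho_mass :: "nat \<Rightarrow> 'a set \<Rightarrow> real" where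
  "rho_mass N L = measure \<rho> (\<Union>n\<le>N. nconf L n)"

lemma nconf_Union_sets: "compact L \<Longrightarrow> (\<Union>n\<le>N. nconf L n) \<in> sets \<rho>"
  unfolding sets_rho by (intro sets.finite_UN nconf_closed compact_imp_closed) auto

lemma nconf_Union_finite:
  assumes "compact L"
  shows "emeasure \<rho> (\<Union>n\<le>N. nconf L n) < \<infinity>"
proof -
  obtain C where C: "\<And>n. emeasure \<rho> (nconf L n) \<le> ennreal (C ^ n)" using rho_bound[OF assms] by blast
  have "emeasure \<rho> (\<Union>n\<le>N. nconf L n) \<le> (\<Sum>n\<le>N. emeasure \<rho> (nconf L n))"
    using assms by (intro emeasure_subadditive_finite) (auto simp: sets_rho intro: nconf_closed compact_imp_closed)
  also have "\<dots> \<le> (\<Sum>n\<le>N. ennreal (C ^ n))" by (intro sum_mono C)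
  also have "\<dots> < \<infinity>" by (simp add: ennreal_sum_less_top)
  finally show ?thesis .
qed

text \<open>The measure may be infinite, but the integrand vanishes off the configurations of at
  most \<open>N\<close> points in \<open>L\<close>, whose mass is finite by the bounds
  \<open>C ^ n\<close>.\<close>

lemma cc_integral:
  assumes "mset_cont D" "compact L" "bsupp N L D" and B: "\<And>\<eta>. finite \<eta> \<Longrightarrow> norm (D (mset_set \<eta>)) \<le> B"
  shows "integrable \<rho> (\<lambda>\<eta>. D (mset_set \<eta>) :: complex)"
    "norm (\<integral>\<eta>. D (mset_set \<eta>) \<partial>\<rho>) \<le> B * rho_mass N L"
proof -
  let ?S = "\<Union>n\<le>N. nconf L n"
  note S = nconf_Union_sets[OF assms(2), of N] nconf_Union_finite[OF assms(2), of N]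
  have zero: "D (mset_set \<eta>) = 0" if "finite \<eta>" "\<eta> \<notin> ?S" for \<eta>
    using assms(3)[unfolded bsupp_def, rule_format, of "mset_set \<eta>"] that by (auto simp: nconf_def)
  show int: "integrable \<rho> (\<lambda>\<eta>. D (mset_set \<eta>))"
  proof (rule integrableI_bounded_set[OF S(1) _ S(2), where B = B])
    show "(\<lambda>\<eta>. D (mset_set \<eta>)) \<in> borel_measurable \<rho>"
      unfolding measurable_rho by (rule mset_cont_measurable[OF assms(1)])
    show "AE x\<in>?S in \<rho>. norm (D (mset_set x)) \<le> B"
      using B by (intro AE_I2) (simp add: space_rho)
    show "AE x in \<rho>. x \<notin> ?S \<longrightarrow> D (mset_set x) = 0"
      using zero by (intro AE_I2) (simp add: space_rho)
  qed
  have "norm (\<integral>\<eta>. D (mset_set \<eta>) \<partial>\<rho>) \<le> (\<integral>\<eta>. norm (D (mset_set \<eta>)) \<partial>\<rho>)"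
    by (rule integral_norm_bound)
  also have "\<dots> \<le> (\<integral>\<eta>. B * indicator ?S \<eta> \<partial>\<rho>)"
  proof (rule integral_mono)
    show "integrable \<rho> (\<lambda>\<eta>. norm (D (mset_set \<eta>)))" using int by simp
    show "integrable \<rho> (\<lambda>\<eta>. B * indicator ?S \<eta>)" using S by simp
    fix \<eta> assume "\<eta> \<in> space \<rho>"
    then show "norm (D (mset_set \<eta>)) \<le> B * indicator ?S \<eta>"
      using zero[of \<eta>] B[of \<eta>] by (cases "\<eta> \<in> ?S") (simp_all add: space_rho del: UN_iff)
  qed
  also have "\<dots> = B * rho_mass N L" using S by (simp add: rho_mass_def)
  finally show "norm (\<integral>\<eta>. D (mset_set \<eta>) \<partial>\<rho>) \<le> B * rho_mass N L" .
qed

lemma cc_conv_integrable: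
  assumes "cc_fun G" "cc_fun H"
  shows "integrable \<rho> (\<lambda>\<eta>. (G \<star> H) (mset_set \<eta>))"
proof -
  obtain N L B where G: "mset_cont G" "compact L" "bsupp N L G" "\<And>\<eta>. norm (G \<eta>) \<le> B"
    using assms(1) unfolding cc_fun_def by blast
  obtain M L' B' where H: "mset_cont H" "compact L'" "bsupp M L' H" "\<And>\<eta>. norm (H \<eta>) \<le> B'"
    using assms(2) unfolding cc_fun_def by blast
  \<comment> \<open>A sum in place of a maximum over the possible sizes
    \<open>n \<le> N + M\<close>; each term bounds the convolution at \<open>n\<close>
    points.\<close>
  let ?C = "\<Sum>n\<le>N + M. real (card (P3 {..<n})) * (B * B')"
  have BB: "B * B' \<ge> 0" using G(4)[of "{#}"] H(4)[of "{#}"] order_trans[OF norm_ge_zero]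
    by (intro mult_nonneg_nonneg) blast+
  have supp: "bsupp (N + M) (L \<union> L') (G \<star> H)"
    by (rule bsupp_conv; rule bsupp_mono[OF G(3)] bsupp_mono[OF H(3)]) auto
  show ?thesis
  proof (rule cc_integral(1)[OF mset_cont_conv[OF G(1) H(1)] compact_Un[OF G(2) H(2)] supp])
    fix \<eta> :: "'a set" assume \<eta>: "finite \<eta>"
    show "norm ((G \<star> H) (mset_set \<eta>)) \<le> ?C"
    proof (cases "card \<eta> \<le> N + M")
      case True
      have "norm ((G \<star> H) (mset_set \<eta>)) \<le> real (card (P3 {..<card \<eta>})) * (B * B')"
        by (rule norm_conv_le) (use G H \<eta> in auto)
      also have "\<dots> \<le> ?C" by (rule member_le_sum) (use True BB in auto)
      finally show ?thesis .
    next
      case False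
      then have "(G \<star> H) (mset_set \<eta>) = 0"
        using supp[unfolded bsupp_def, rule_format, of "mset_set \<eta>"] by auto
      then show ?thesis using BB by (auto intro!: sum_nonneg)
    qed
  qed
qed

text \<open>The constant depends on \<open>N\<close> and \<open>L\<close> only: it is a count of
  triples times the mass of the configurations of at most \<open>N + N\<close> points in
  \<open>L\<close>. For functions with common support, uniform convergence thus forces convergence
  in the seminorm of the form.\<close>

lemma a_form_bound:
  assumes "compact L"
  shows "\<exists>C\<ge>0. \<forall>D B. mset_cont D \<longrightarrow> bsupp N L D \<longrightarrow> (\<forall>\<eta>. finite \<eta> \<longrightarrow> norm (D (mset_set \<eta>)) \<le> B) \<longrightarrow>
    norm (a_form \<rho> D (\<lambda>\<eta>. cnj (D \<eta>))) \<le> C * B\<^sup>2"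
proof -
  let ?C = "\<Sum>n\<le>N + N. real (card (P3 {..<n}))"
  have "norm (a_form \<rho> D (\<lambda>\<eta>. cnj (D \<eta>))) \<le> (?C * rho_mass (N + N) L) * B\<^sup>2"
    if D: "mset_cont D" "bsupp N L D" and B: "\<forall>\<eta>. finite \<eta> \<longrightarrow> norm (D (mset_set \<eta>)) \<le> B" for D B
  proof -
    have supp: "bsupp (N + N) L (D \<star> (\<lambda>\<eta>. cnj (D \<eta>)))"
      by (rule bsupp_conv[OF D(2)]) (use D(2) in \<open>simp add: bsupp_def\<close>)
    have "norm (\<integral>\<eta>. (D \<star> (\<lambda>\<eta>. cnj (D \<eta>))) (mset_set \<eta>) \<partial>\<rho>) \<le> (?C * B\<^sup>2) * rho_mass (N + N) L"
    proof (rule cc_integral(2)[OF mset_cont_conv[OF D(1) mset_cont_cnj[OF D(1)]] assms supp])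
      fix \<eta> :: "'a set" assume \<eta>: "finite \<eta>"
      show "norm ((D \<star> (\<lambda>\<eta>. cnj (D \<eta>))) (mset_set \<eta>)) \<le> ?C * B\<^sup>2"
      proof (cases "card \<eta> \<le> N + N")
        case True
        have "norm ((D \<star> (\<lambda>\<eta>. cnj (D \<eta>))) (mset_set \<eta>)) \<le> real (card (P3 {..<card \<eta>})) * (B * B)"
          by (rule norm_conv_le) (use B \<eta> in auto)
        also have "\<dots> = real (card (P3 {..<card \<eta>})) * B\<^sup>2" by (simp add: power2_eq_square)
        also have "\<dots> \<le> ?C * B\<^sup>2" using True by (intro mult_right_mono member_le_sum) auto
        finally show ?thesis .
      next
        case False
        then have "(D \<star> (\<lambda>\<eta>. cnj (D \<eta>))) (mset_set \<eta>) = 0"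
          using supp[unfolded bsupp_def, rule_format, of "mset_set \<eta>"] by auto
        then show ?thesis by (auto intro!: sum_nonneg mult_nonneg_nonneg)
      qed
    qed
    then show ?thesis by (simp add: a_form_def mult_ac)
  qed
  then show ?thesis
    by (intro exI[of _ "?C * rho_mass (N + N) L"]) (auto simp: rho_mass_def intro!: mult_nonneg_nonneg sum_nonneg)
qed

lemma a_form_add_left:
  "cc_fun G \<Longrightarrow> cc_fun G' \<Longrightarrow> cc_fun H \<Longrightarrow>
    a_form \<rho> (\<lambda>\<eta>. G \<eta> + G' \<eta>) H = a_form \<rho> G H + a_form \<rho> G' H"
  unfolding a_form_def conv_add_left by (intro Bochner_Integration.integral_add cc_conv_integrable)

lemma a_form_add_right:
  "cc_fun G \<Longrightarrow> cc_fun G' \<Longrightarrow> cc_fun H \<Longrightarrow>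
    a_form \<rho> H (\<lambda>\<eta>. G \<eta> + G' \<eta>) = a_form \<rho> H G + a_form \<rho> H G'"
  unfolding a_form_def conv_add_right by (intro Bochner_Integration.integral_add cc_conv_integrable)

lemma a_form_scale_left: "a_form \<rho> (\<lambda>\<eta>. c * G \<eta>) H = c * a_form \<rho> G H"
  and a_form_scale_right: "a_form \<rho> H (\<lambda>\<eta>. c * G \<eta>) = c * a_form \<rho> H G"
  by (simp_all add: a_form_def conv_scale_left conv_scale_right)

end

section \<open>Quotients and completions of semi-inner product spaces\<close>

lemma tendsto_zero_le_add:
  fixes a b c :: "nat \<Rightarrow> real"
  assumes "b \<longlonglongrightarrow> 0" "c \<longlonglongrightarrow> 0" "\<And>n. 0 \<le> a n" "\<And>n. a n \<le> b n + c n"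
  shows "a \<longlonglongrightarrow> 0"
proof (rule tendsto_sandwich[OF _ _ tendsto_const])
  show "(\<lambda>n. b n + c n) \<longlonglongrightarrow> 0" using tendsto_add[OF assms(1,2)] by simp
qed (use assms(3,4) in simp_all)

text \<open>The operations on quotients and completions are unions over all representatives. Once
  the result is the same class for every choice, the union is that class.\<close>

lemma UN_UN_const:
  assumes "a \<in> X" "b \<in> Y" "\<And>f g. f \<in> X \<Longrightarrow> g \<in> Y \<Longrightarrow> F f g = C"
  shows "(\<Union>f\<in>X. \<Union>g\<in>Y. F f g) = C"
proof (intro equalityI subsetI)
  fix x assume "x \<in> (\<Union>f\<in>X. \<Union>g\<in>Y. F f g)"
  then show "x \<in> C" using assms(3) by (elim UN_E) simp
next
  fix x assume "x \<in> C"
  then have "x \<in> F a b" using assms by simp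
  then show "x \<in> (\<Union>f\<in>X. \<Union>g\<in>Y. F f g)" using assms(1,2) by (intro UN_I)
qed

text \<open>Serves two spaces: \<open>F_fin\<close> with the form given by \<open>\<rho>\<close>,
  which is divided by its kernel and completed, and the square integrable functions with their
  quotient.\<close>

locale semi_ip =
  fixes V :: "('s \<Rightarrow> complex) set" and s :: "('s \<Rightarrow> complex) \<Rightarrow> ('s \<Rightarrow> complex) \<Rightarrow> complex"
  assumes V_zero: "(\<lambda>_. 0) \<in> V"
    and V_add: "f \<in> V \<Longrightarrow> g \<in> V \<Longrightarrow> (\<lambda>x. f x + g x) \<in> V"
    and V_scale: "f \<in> V \<Longrightarrow> (\<lambda>x. c * f x) \<in> V"
    and s_add_left: "f \<in> V \<Longrightarrow> g \<in> V \<Longrightarrow> h \<in> V \<Longrightarrow> s (\<lambda>x. f x + g x) h = s f h + s g h"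
    and s_add_right: "f \<in> V \<Longrightarrow> g \<in> V \<Longrightarrow> h \<in> V \<Longrightarrow> s h (\<lambda>x. f x + g x) = s h f + s h g"
    and s_scale_left: "f \<in> V \<Longrightarrow> g \<in> V \<Longrightarrow> s (\<lambda>x. c * f x) g = c * s f g"
    and s_scale_right: "f \<in> V \<Longrightarrow> g \<in> V \<Longrightarrow> s f (\<lambda>x. c * g x) = cnj c * s f g"
    and s_pos: "f \<in> V \<Longrightarrow> s f f \<in> \<real>\<^sub>\<ge>\<^sub>0"
begin

section \<open>Seminorm and Cauchy--Schwarz inequality\<close>

lemma V_diff: "f \<in> V \<Longrightarrow> g \<in> V \<Longrightarrow> (\<lambda>x. f x - g x) \<in> V"
  using V_add[of f "\<lambda>x. -1 * g x"] V_scale[of g "-1"] by simp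

lemma s_diff_left: "f \<in> V \<Longrightarrow> g \<in> V \<Longrightarrow> h \<in> V \<Longrightarrow> s (\<lambda>x. f x - g x) h = s f h - s g h"
  using s_add_left[of f "\<lambda>x. -1 * g x" h] V_scale[of g "-1"] s_scale_left[of g h "-1"] by simp

lemma s_diff_right: "f \<in> V \<Longrightarrow> g \<in> V \<Longrightarrow> h \<in> V \<Longrightarrow> s h (\<lambda>x. f x - g x) = s h f - s h g"
  using s_add_right[of f "\<lambda>x. -1 * g x" h] V_scale[of g "-1"] s_scale_right[of h g "-1"] by simp

definition N :: "('s \<Rightarrow> complex) \<Rightarrow> real" where
  "N f = sqrt (Re (s f f))"

lemma s_self: "f \<in> V \<Longrightarrow> s f f = complex_of_real ((N f)\<^sup>2)"
  using s_pos[of f] by (auto simp: N_def complex_nonneg_Reals_iff complex_eq_iff)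

lemma N_nonneg: "f \<in> V \<Longrightarrow> 0 \<le> N f"
  using s_pos[of f] by (auto simp: N_def complex_nonneg_Reals_iff)

lemma s_self_eq_0: "f \<in> V \<Longrightarrow> s f f = 0 \<longleftrightarrow> N f = 0"
  using s_self by simp

text \<open>Polarisation: the form is real at \<open>f + c g\<close>, and the choices
  \<open>c = 1\<close> and \<open>c = \<i>\<close> compare the imaginary and the real parts of
  \<open>s f g\<close> and \<open>s g f\<close>.\<close>

lemma s_hermitian:
  assumes "f \<in> V" "g \<in> V"
  shows "s g f = cnj (s f g)"
proof -
  have eq: "s (\<lambda>x. f x + c * g x) (\<lambda>x. f x + c * g x) = s f f + cnj c * s f g + c * s g f + c * cnj c * s g g" for c
    using assms V_scale by (simp add: s_add_left s_add_right V_add s_scale_left s_scale_right algebra_simps)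
  have im: "Im (s h h) = 0" if "h \<in> V" for h using s_pos[OF that] by (simp add: complex_nonneg_Reals_iff)
  have "Im (cnj c * s f g + c * s g f) = 0" for c
  proof -
    have "Im (s f f + cnj c * s f g + c * s g f + c * cnj c * s g g) = 0"
      using im[of "\<lambda>x. f x + c * g x"] assms V_add V_scale by (simp add: eq)
    moreover have "Im (c * cnj c * s g g) = 0" using im[OF assms(2)] by (simp add: complex_mult_cnj)
    ultimately show ?thesis using im[OF assms(1)] unfolding plus_complex.sel by linarith
  qed
  from this[of 1] this[of \<i>] show ?thesis by (simp add: complex_eq_iff)
qed

lemma N_diff_sq:
  assumes "f \<in> V" "g \<in> V"
  shows "(N (\<lambda>x. f x - c * g x))\<^sup>2 = (N f)\<^sup>2 - 2 * Re (cnj c * s f g) + (cmod c)\<^sup>2 * (N g)\<^sup>2"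
proof -
  have cc: "c * cnj c = (complex_of_real (cmod c))\<^sup>2" using complex_norm_square[of c] by simp
  have "s (\<lambda>x. f x - c * g x) (\<lambda>x. f x - c * g x) =
      s f f - cnj c * s f g - c * cnj (s f g) + c * cnj c * s g g"
    using assms V_scale s_hermitian[OF assms]
    by (simp add: s_diff_left s_diff_right V_diff s_scale_left s_scale_right algebra_simps)
  also have "\<dots> = complex_of_real ((N f)\<^sup>2) - (cnj c * s f g + cnj (cnj c * s f g))
      + complex_of_real ((cmod c)\<^sup>2 * (N g)\<^sup>2)"
    using assms by (simp add: s_self cc algebra_simps)
  finally have "Re (s (\<lambda>x. f x - c * g x) (\<lambda>x. f x - c * g x)) =
      Re (complex_of_real ((N f)\<^sup>2) - (cnj c * s f g + cnj (cnj c * s f g))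
      + complex_of_real ((cmod c)\<^sup>2 * (N g)\<^sup>2))" by simp
  then show ?thesis using s_self[OF V_diff[OF assms(1) V_scale[OF assms(2)]], of c] by simp
qed

lemma Cauchy_Schwarz:
  assumes "f \<in> V" "g \<in> V"
  shows "cmod (s f g) \<le> N f * N g"
proof -
  let ?a = "(cmod (s f g))\<^sup>2"
  have re: "Re (cnj (of_real t * s f g) * s f g) = t * ?a" for t
    unfolding cmod_power2 by (simp add: power2_eq_square algebra_simps)
  have le: "0 \<le> (N f)\<^sup>2 - 2 * (t * ?a) + t\<^sup>2 * ?a * (N g)\<^sup>2" for t
    using N_diff_sq[OF assms, of "of_real t * s f g", unfolded re]
      zero_le_power2[of "N (\<lambda>x. f x - of_real t * s f g * g x)"]
    by (simp add: norm_mult power_mult_distrib)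
  show ?thesis
  proof (cases "N g = 0")
    case True
    have "?a = 0"
    proof (rule ccontr)
      assume nz: "?a \<noteq> 0"
      \<comment> \<open>With \<open>N g = 0\<close> the bound is affine in \<open>t\<close> with
        slope \<open>- 2 * ?a\<close>; this \<open>t\<close> makes it negative.\<close>
      have "0 \<le> (N f)\<^sup>2 - 2 * (((N f)\<^sup>2 + 1) / ?a * ?a)" using le[of "((N f)\<^sup>2 + 1) / ?a"] True by simp
      then have *: "0 \<le> (N f)\<^sup>2 - 2 * ((N f)\<^sup>2 + 1)" using nz by simp
      have "0 \<le> x \<Longrightarrow> 0 \<le> x - 2 * (x + 1) \<Longrightarrow> False" for x :: real by simp
      from this[OF zero_le_power2 *] show False .
    qed
    then show ?thesis using True by simp
  next
    case False
    then have pos: "N g > 0" using N_nonneg[OF assms(2)] by simp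
    \<comment> \<open>The value \<open>1 / (N g)^2\<close> is a minimiser of the quadratic in
      \<open>t\<close>.\<close>
    have "0 \<le> (N f)\<^sup>2 - 2 * (1 / (N g)\<^sup>2 * ?a) + (1 / (N g)\<^sup>2)\<^sup>2 * ?a * (N g)\<^sup>2" by (rule le)
    also have "\<dots> = (N f)\<^sup>2 - ?a / (N g)\<^sup>2" using pos by (simp add: field_simps power2_eq_square)
    finally have "?a \<le> (N f * N g)\<^sup>2" using pos by (simp add: field_simps power_mult_distrib)
    from power2_le_imp_le[OF this] show ?thesis using N_nonneg[OF assms(1)] pos by simp
  qed
qed

lemma N_triangle:
  assumes "f \<in> V" "g \<in> V"
  shows "N (\<lambda>x. f x + g x) \<le> N f + N g"
proof -
  have "(N (\<lambda>x. f x + g x))\<^sup>2 = (N f)\<^sup>2 + 2 * Re (s f g) + (N g)\<^sup>2"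
    using N_diff_sq[OF assms, of "-1"] by simp
  also have "\<dots> \<le> (N f)\<^sup>2 + 2 * (N f * N g) + (N g)\<^sup>2"
    using Cauchy_Schwarz[OF assms] complex_Re_le_cmod[of "s f g"] by simp
  also have "\<dots> = (N f + N g)\<^sup>2" by (simp add: power2_sum)
  finally have "(N (\<lambda>x. f x + g x))\<^sup>2 \<le> (N f + N g)\<^sup>2" .
  from power2_le_imp_le[OF this] show ?thesis using N_nonneg[OF assms(1)] N_nonneg[OF assms(2)] by simp
qed

lemma N_minus: "f \<in> V \<Longrightarrow> g \<in> V \<Longrightarrow> N (\<lambda>x. f x - g x) = N (\<lambda>x. g x - f x)"
  by (simp add: N_def s_diff_left s_diff_right V_diff algebra_simps)

lemma N_scale: "f \<in> V \<Longrightarrow> N (\<lambda>x. c * f x) = cmod c * N f"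
  by (simp add: N_def s_scale_left s_scale_right V_scale mult.assoc[symmetric] complex_mult_cnj
      real_sqrt_mult cmod_def)

lemma N_triangle3:
  assumes "f \<in> V" "g \<in> V" "h \<in> V"
  shows "N (\<lambda>x. f x - h x) \<le> N (\<lambda>x. f x - g x) + N (\<lambda>x. g x - h x)"
  using N_triangle[OF V_diff[OF assms(1,2)] V_diff[OF assms(2,3)]] by simp

section \<open>The quotient by the null vectors\<close>

abbreviation Q where "Q \<equiv> quotient_space V s"
abbreviation q where "q \<equiv> qclass V s"

lemma mem_q: "f \<in> V \<Longrightarrow> g \<in> q f \<longleftrightarrow> g \<in> V \<and> N (\<lambda>x. g x - f x) = 0"
  unfolding qclass_def using s_self_eq_0[OF V_diff] by blast

lemma self_mem_q: "f \<in> V \<Longrightarrow> f \<in> q f"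
  using s_scale_left[OF V_zero V_zero, of 0] by (simp add: qclass_def)

lemma N_0: "N (\<lambda>x. 0) = 0"
  using s_scale_left[OF V_zero V_zero, of 0] by (simp add: N_def)

lemma q_eq:
  assumes "f \<in> V" "g \<in> V" "N (\<lambda>x. f x - g x) = 0"
  shows "q f = q g"
proof -
  have le: "N (\<lambda>x. h x - a x) \<le> N (\<lambda>x. h x - b x)"
    if "h \<in> V" "a \<in> V" "b \<in> V" "N (\<lambda>x. b x - a x) = 0" for h a b
    using N_triangle3[OF that(1,3,2)] that(4) by simp
  have "N (\<lambda>x. g x - f x) = 0" using N_minus[OF assms(1,2)] assms(3) by simp
  then have "N (\<lambda>x. h x - f x) = N (\<lambda>x. h x - g x)" if "h \<in> V" for h
    using le[OF that assms(1,2)] le[OF that assms(2,1)] assms(3) by simp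
  then show ?thesis
    by (intro set_eqI) (auto simp: mem_q[OF assms(1)] mem_q[OF assms(2)])
qed

lemma carr_Q: "carr Q = q ` V"
  by (simp add: quotient_space_def)

lemma vadd_Q:
  assumes "f \<in> V" "g \<in> V"
  shows "vadd Q (q f) (q g) = q (\<lambda>x. f x + g x)"
proof -
  have "q (\<lambda>x. f' x + g' x) = q (\<lambda>x. f x + g x)" if "f' \<in> q f" "g' \<in> q g" for f' g'
  proof (rule q_eq)
    have *: "f' \<in> V" "g' \<in> V" "N (\<lambda>x. f' x - f x) = 0" "N (\<lambda>x. g' x - g x) = 0"
      using that assms mem_q by auto
    then show "(\<lambda>x. f' x + g' x) \<in> V" "(\<lambda>x. f x + g x) \<in> V" using assms V_add by auto
    have "N (\<lambda>x. (f' x - f x) + (g' x - g x)) \<le> 0"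
      using N_triangle[OF V_diff[OF *(1) assms(1)] V_diff[OF *(2) assms(2)]] * by simp
    then show "N (\<lambda>x. f' x + g' x - (f x + g x)) = 0"
      using N_nonneg[OF V_diff[OF V_add[OF *(1,2)] V_add[OF assms]]] by (simp add: algebra_simps)
  qed
  from UN_UN_const[OF self_mem_q[OF assms(1)] self_mem_q[OF assms(2)] this]
  show ?thesis by (simp add: quotient_space_def)
qed

lemma vscale_Q:
  assumes "f \<in> V"
  shows "vscale Q c (q f) = q (\<lambda>x. c * f x)"
proof -
  have "q (\<lambda>x. c * f' x) = q (\<lambda>x. c * f x)" if "f' \<in> q f" for f'
  proof (rule q_eq)
    have *: "f' \<in> V" "N (\<lambda>x. f' x - f x) = 0" using that assms mem_q by auto
    then show "(\<lambda>x. c * f' x) \<in> V" "(\<lambda>x. c * f x) \<in> V" using assms V_scale by auto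
    show "N (\<lambda>x. c * f' x - c * f x) = 0"
      using N_scale[OF V_diff[OF *(1) assms], of c] * by (simp add: algebra_simps)
  qed
  \<comment> \<open>The one-element index set makes the unary union an instance of the binary
    one.\<close>
  from UN_UN_const[of _ _ _ "UNIV :: unit set" "\<lambda>f' _. q (\<lambda>x. c * f' x)", OF self_mem_q[OF assms] UNIV_I this]
  show ?thesis by (simp add: quotient_space_def)
qed

lemma s_null:
  assumes "f \<in> V" "g \<in> V" "N f = 0"
  shows "s f g = 0" "s g f = 0"
  using Cauchy_Schwarz[OF assms(1,2)] Cauchy_Schwarz[OF assms(2,1)] assms(3) by auto

lemma vip_Q:
  assumes "f \<in> V" "g \<in> V"
  shows "vip Q (q f) (q g) = s f g"
proof -
  have eq: "s f' g' = s f g" if "f' \<in> q f" "g' \<in> q g" for f' g'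
  proof -
    have *: "f' \<in> V" "g' \<in> V" "N (\<lambda>x. f' x - f x) = 0" "N (\<lambda>x. g' x - g x) = 0"
      using that assms mem_q by auto
    have "s (\<lambda>x. f' x - f x) g' = 0" "s f (\<lambda>x. g' x - g x) = 0"
      using s_null[OF V_diff[OF *(1) assms(1)] *(2,3)] s_null[OF V_diff[OF *(2) assms(2)] assms(1) *(4)] by auto
    then show ?thesis using * assms by (simp add: s_diff_left s_diff_right)
  qed
  have "vip Q (q f) (q g) = (THE z. \<exists>f'\<in>q f. \<exists>g'\<in>q g. z = s f' g')" by (simp add: quotient_space_def)
  also have "\<dots> = s f g"
  proof (rule the_equality)
    show "\<exists>f'\<in>q f. \<exists>g'\<in>q g. s f g = s f' g'"
      by (intro bexI[OF _ self_mem_q] refl assms)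
    show "z = s f g" if "\<exists>f'\<in>q f. \<exists>g'\<in>q g. z = s f' g'" for z
      using that by (elim bexE) (simp add: eq)
  qed
  finally show ?thesis .
qed

lemma vdist_Q:
  assumes "f \<in> V" "g \<in> V"
  shows "vdist Q (q f) (q g) = N (\<lambda>x. f x - g x)"
  using assms V_scale[OF assms(2), of "-1"] V_diff[OF assms]
  by (simp add: vdist_def vscale_Q vadd_Q vip_Q N_def)

section \<open>The completion, evaluated on classes of constant sequences\<close>

abbreviation H where "H \<equiv> completion Q"
abbreviation e where "e f \<equiv> cclass Q (\<lambda>_. q f)"

lemma cauchy_const: "f \<in> V \<Longrightarrow> (\<lambda>_. q f) \<in> cauchy_seqs Q"
  by (simp add: cauchy_seqs_def carr_Q vdist_Q N_0)

lemma e_in_carr: "f \<in> V \<Longrightarrow> e f \<in> carr H"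
  using cauchy_const by (simp add: completion_def)

lemma self_mem_e: "f \<in> V \<Longrightarrow> (\<lambda>_. q f) \<in> e f"
  using cauchy_const by (simp add: cclass_def vdist_Q N_0)

lemma cauchy_seqs_repr:
  assumes "u \<in> cauchy_seqs Q"
  shows "\<exists>w. (\<forall>n. w n \<in> V) \<and> u = (\<lambda>n. q (w n))"
proof -
  have "u n \<in> q ` V" for n using assms by (simp add: cauchy_seqs_def carr_Q)
  then have "\<forall>n. \<exists>f\<in>V. u n = q f" unfolding image_iff by simp
  then obtain w where "\<And>n. w n \<in> V" "\<And>n. u n = q (w n)" by metis
  then show ?thesis by (intro exI[of _ w]) (auto simp: fun_eq_iff)
qed

lemma e_repr:
  assumes "f \<in> V" "u \<in> e f"
  shows "\<exists>w. (\<forall>n. w n \<in> V) \<and> u = (\<lambda>n. q (w n)) \<and> (\<lambda>n. N (\<lambda>x. w n x - f x)) \<longlonglongrightarrow> 0"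
proof -
  have "u \<in> cauchy_seqs Q" using assms(2) by (simp add: cclass_def)
  then obtain w where w: "\<forall>n. w n \<in> V" "u = (\<lambda>n. q (w n))" using cauchy_seqs_repr by blast
  then show ?thesis using assms by (intro exI[of _ w]) (simp add: cclass_def vdist_Q)
qed

text \<open>By the triangle inequality a sequence is asymptotic to \<open>w\<close> exactly if it
  converges to \<open>f\<close>, so \<open>w\<close> and the constant sequence have the same
  class.\<close>

lemma cclass_eq_e:
  assumes "f \<in> V" "\<And>n. w n \<in> V" "(\<lambda>n. N (\<lambda>x. w n x - f x)) \<longlonglongrightarrow> 0"
  shows "cclass Q (\<lambda>n. q (w n)) = e f"
proof -
  have "(\<lambda>n. N (\<lambda>x. z n x - w n x)) \<longlonglongrightarrow> 0 \<longleftrightarrow> (\<lambda>n. N (\<lambda>x. z n x - f x)) \<longlonglongrightarrow> 0" if z: "\<And>n. z n \<in> V" for z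
  proof
    assume *: "(\<lambda>n. N (\<lambda>x. z n x - w n x)) \<longlonglongrightarrow> 0"
    show "(\<lambda>n. N (\<lambda>x. z n x - f x)) \<longlonglongrightarrow> 0"
      by (rule tendsto_zero_le_add[OF * assms(3)])
        (rule N_nonneg[OF V_diff] N_triangle3 z assms)+
  next
    assume *: "(\<lambda>n. N (\<lambda>x. z n x - f x)) \<longlonglongrightarrow> 0"
    have "N (\<lambda>x. z n x - w n x) \<le> N (\<lambda>x. z n x - f x) + N (\<lambda>x. w n x - f x)" for n
      using N_triangle3[OF z[of n] assms(1) assms(2)[of n]] N_minus[OF assms(1) assms(2)[of n]] by simp
    then show "(\<lambda>n. N (\<lambda>x. z n x - w n x)) \<longlonglongrightarrow> 0"
      by (rule tendsto_zero_le_add[OF * assms(3) N_nonneg[OF V_diff[OF z assms(2)]]])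
  qed
  note iff = this
  have "(\<lambda>n. vdist Q (v n) (q (w n))) \<longlonglongrightarrow> 0 \<longleftrightarrow> (\<lambda>n. vdist Q (v n) (q f)) \<longlonglongrightarrow> 0" if uv: "v \<in> cauchy_seqs Q" for v
  proof -
    obtain z where z: "\<And>n. z n \<in> V" "v = (\<lambda>n. q (z n))" using cauchy_seqs_repr[OF uv] by blast
    show ?thesis using iff[OF z(1)] z assms by (simp add: vdist_Q)
  qed
  then show ?thesis unfolding cclass_def by auto
qed

lemma vadd_H:
  assumes "f \<in> V" "g \<in> V"
  shows "vadd H (e f) (e g) = e (\<lambda>x. f x + g x)"
proof -
  have "cclass Q (\<lambda>n. vadd Q (u n) (v n)) = e (\<lambda>x. f x + g x)" if uv: "u \<in> e f" "v \<in> e g" for u v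
  proof -
    obtain w where w: "\<And>n. w n \<in> V" "u = (\<lambda>n. q (w n))" "(\<lambda>n. N (\<lambda>x. w n x - f x)) \<longlonglongrightarrow> 0"
      using e_repr[OF assms(1) uv(1)] by blast
    obtain z where z: "\<And>n. z n \<in> V" "v = (\<lambda>n. q (z n))" "(\<lambda>n. N (\<lambda>x. z n x - g x)) \<longlonglongrightarrow> 0"
      using e_repr[OF assms(2) uv(2)] by blast
    have "N (\<lambda>x. (w n x + z n x) - (f x + g x)) \<le> N (\<lambda>x. w n x - f x) + N (\<lambda>x. z n x - g x)" for n
      using N_triangle[OF V_diff[OF w(1)[of n] assms(1)] V_diff[OF z(1)[of n] assms(2)]]
      by (simp add: algebra_simps)
    then have "(\<lambda>n. N (\<lambda>x. (w n x + z n x) - (f x + g x))) \<longlonglongrightarrow> 0"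
      by (rule tendsto_zero_le_add[OF w(3) z(3) N_nonneg[OF V_diff[OF V_add[OF w(1) z(1)] V_add[OF assms]]]])
    then have "cclass Q (\<lambda>n. q (\<lambda>x. w n x + z n x)) = e (\<lambda>x. f x + g x)"
      by (intro cclass_eq_e V_add assms w z)
    then show ?thesis using w z by (simp add: vadd_Q)
  qed
  from UN_UN_const[OF self_mem_e[OF assms(1)] self_mem_e[OF assms(2)] this]
  show ?thesis by (simp add: completion_def)
qed

lemma vscale_H:
  assumes "f \<in> V"
  shows "vscale H c (e f) = e (\<lambda>x. c * f x)"
proof -
  have "cclass Q (\<lambda>n. vscale Q c (u n)) = e (\<lambda>x. c * f x)" if uv: "u \<in> e f" for u
  proof -
    obtain w where w: "\<And>n. w n \<in> V" "u = (\<lambda>n. q (w n))" "(\<lambda>n. N (\<lambda>x. w n x - f x)) \<longlonglongrightarrow> 0"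
      using e_repr[OF assms uv] by blast
    have "N (\<lambda>x. c * w n x - c * f x) = cmod c * N (\<lambda>x. w n x - f x)" for n
      using N_scale[OF V_diff[OF w(1)[of n] assms], of c] by (simp add: algebra_simps)
    then have "(\<lambda>n. N (\<lambda>x. c * w n x - c * f x)) \<longlonglongrightarrow> 0"
      using tendsto_mult_right_zero[OF w(3), of "cmod c"] by simp
    then have "cclass Q (\<lambda>n. q (\<lambda>x. c * w n x)) = e (\<lambda>x. c * f x)"
      by (intro cclass_eq_e V_scale assms w)
    then show ?thesis using w by (simp add: vscale_Q)
  qed
  from UN_UN_const[of _ _ _ "UNIV :: unit set" "\<lambda>u _. cclass Q (\<lambda>n. vscale Q c (u n))", OF self_mem_e[OF assms] UNIV_I this]
  show ?thesis by (simp add: completion_def)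
qed

text \<open>Replacing one argument at a time, Cauchy--Schwarz bounds the error by the two distances,
  where \<open>N (z n)\<close> is at most \<open>N g\<close> plus the second distance. So all
  representing sequences give the same limit.\<close>

lemma vip_H:
  assumes "f \<in> V" "g \<in> V"
  shows "vip H (e f) (e g) = s f g"
proof -
  have lim: "(\<lambda>n. vip Q (u n) (v n)) \<longlonglongrightarrow> s f g" if uv: "u \<in> e f" "v \<in> e g" for u v
  proof -
    obtain w where w: "\<And>n. w n \<in> V" "u = (\<lambda>n. q (w n))" "(\<lambda>n. N (\<lambda>x. w n x - f x)) \<longlonglongrightarrow> 0"
      using e_repr[OF assms(1) uv(1)] by blast
    obtain z where z: "\<And>n. z n \<in> V" "v = (\<lambda>n. q (z n))" "(\<lambda>n. N (\<lambda>x. z n x - g x)) \<longlonglongrightarrow> 0"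
      using e_repr[OF assms(2) uv(2)] by blast
    have "cmod (s (w n) (z n) - s f g) \<le>
        N (\<lambda>x. w n x - f x) * (N (\<lambda>x. z n x - g x) + N g) + N f * N (\<lambda>x. z n x - g x)" for n
    proof -
      have "s (w n) (z n) - s f g = s (\<lambda>x. w n x - f x) (z n) + s f (\<lambda>x. z n x - g x)"
        using w z assms by (simp add: s_diff_left s_diff_right)
      also have "cmod \<dots> \<le> cmod (s (\<lambda>x. w n x - f x) (z n)) + cmod (s f (\<lambda>x. z n x - g x))"
        by (rule norm_triangle_ineq)
      also have "\<dots> \<le> N (\<lambda>x. w n x - f x) * N (z n) + N f * N (\<lambda>x. z n x - g x)"
        by (intro add_mono Cauchy_Schwarz V_diff w z assms)
      also have "\<dots> \<le> N (\<lambda>x. w n x - f x) * (N (\<lambda>x. z n x - g x) + N g) + N f * N (\<lambda>x. z n x - g x)"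
        using N_triangle[OF V_diff[OF z(1)[of n] assms(2)] assms(2)]
        by (intro add_mono mult_left_mono N_nonneg V_diff w assms) simp_all
      finally show ?thesis .
    qed
    note le = this
    have "(\<lambda>n. N (\<lambda>x. w n x - f x) * (N (\<lambda>x. z n x - g x) + N g)) \<longlonglongrightarrow> 0 * (0 + N g)"
      "(\<lambda>n. N f * N (\<lambda>x. z n x - g x)) \<longlonglongrightarrow> N f * 0"
      by (intro tendsto_mult tendsto_add tendsto_const w z)+
    then have "(\<lambda>n. cmod (s (w n) (z n) - s f g)) \<longlonglongrightarrow> 0"
      by (intro tendsto_zero_le_add[OF _ _ norm_ge_zero le]) simp_all
    then have "(\<lambda>n. s (w n) (z n)) \<longlonglongrightarrow> s f g"
      by (rule LIM_zero_cancel[OF tendsto_norm_zero_cancel])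
    then show ?thesis using w z by (simp add: vip_Q)
  qed
  have "vip H (e f) (e g) = (THE t. \<exists>u\<in>e f. \<exists>v\<in>e g. (\<lambda>n. vip Q (u n) (v n)) \<longlonglongrightarrow> t)"
    by (simp add: completion_def)
  also have "\<dots> = s f g"
  proof (rule the_equality)
    show "\<exists>u\<in>e f. \<exists>v\<in>e g. (\<lambda>n. vip Q (u n) (v n)) \<longlonglongrightarrow> s f g"
      by (intro bexI[OF _ self_mem_e] lim self_mem_e assms)
    show "t = s f g" if "\<exists>u\<in>e f. \<exists>v\<in>e g. (\<lambda>n. vip Q (u n) (v n)) \<longlonglongrightarrow> t" for t
      using that by (elim bexE) (rule LIMSEQ_unique[OF _ lim])
  qed
  finally show ?thesis .
qed

lemma vdist_H_self: "f \<in> V \<Longrightarrow> vdist H (e f) (e f) = 0"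
  using V_scale[of f "-1"] vscale_H[of f "-1"] vadd_H[of f "\<lambda>x. -1 * f x"] vip_H[OF V_zero V_zero]
    s_scale_left[OF V_zero V_zero, of 0]
  by (simp add: vdist_def)

end

section \<open>The \<open>K\<close>-transform\<close>

lemma test_fun_support: "\<phi> \<in> test_fun A \<Longrightarrow> \<exists>L. compact L \<and> (\<forall>x. \<phi> x \<noteq> 0 \<longrightarrow> x \<in> L)"
proof -
  assume "\<phi> \<in> test_fun A"
  then obtain L where L: "compact L" "supported 1 L (\<lambda>x. \<phi> (x 0))"
    unfolding test_fun_def test_power_iff by blast
  have "x \<in> L" if "\<phi> x \<noteq> 0" for x
    using L(2)[unfolded supported_def, rule_format, of "\<lambda>_. x" 0] that by simp
  then show ?thesis using L(1) by blast
qed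

lemma infsum_restrict_support:
  assumes "finite F" "F \<subseteq> S" "\<And>x. x \<in> S - F \<Longrightarrow> f x = 0"
  shows "infsum f S = sum f F"
proof -
  have "infsum f S = infsum f F" by (rule infsum_cong_neutral) (use assms in auto)
  then show ?thesis using assms(1) by simp
qed

lemma dist_of_eq:
  assumes "\<phi> \<in> test_fun A" "finite F" "F \<subseteq> \<gamma>" "\<And>x. x \<in> \<gamma> - F \<Longrightarrow> \<phi> x = 0"
  shows "dist_of A \<gamma> \<phi> = (\<Sum>x\<in>F. \<phi> x)"
  using infsum_restrict_support[OF assms(2-4)] assms(1) by (simp add: dist_of_def)

text \<open>A point of \<open>\<gamma>\<close> outside \<open>\<gamma>'\<close> is detected by a
  product of two bumps at it: the compact support of the first leaves finitely many other points of
  both configurations, and the second vanishes at these.\<close>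

lemma inj_on_dist_of:
  fixes A :: "('a::t2_space, 'd::finite) chart set"
  assumes A: "smooth_atlas A"
  shows "inj_on (dist_of A) configs"
proof -
  have sub: "x \<in> \<gamma>'"
    if "\<gamma> \<in> configs" "\<gamma>' \<in> configs" "dist_of A \<gamma> = dist_of A \<gamma>'" and x: "x \<in> \<gamma>" for \<gamma> \<gamma>' x
  proof (rule ccontr)
    assume x': "x \<notin> \<gamma>'"
    from exists_bump[OF A open_UNIV UNIV_I, of x] obtain \<psi> L
      where \<psi>: "\<psi> \<in> test_fun A" "\<psi> x > 0" "compact L" "\<forall>z. \<psi> z \<noteq> 0 \<longrightarrow> z \<in> L" by blast
    let ?F = "(\<gamma> \<union> \<gamma>') \<inter> L - {x}"
    have "finite ?F" using that(1,2) \<psi>(3) by (auto simp: configs_def Int_Un_distrib2)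
    then have "open (- ?F)" by (intro open_Compl finite_imp_closed)
    from exists_bump[OF A this, of x] obtain \<phi> L'
      where \<phi>: "\<phi> \<in> test_fun A" "\<phi> x > 0" "L' \<subseteq> - ?F" "\<forall>z. \<phi> z \<noteq> 0 \<longrightarrow> z \<in> L'" by blast
    let ?p = "\<lambda>z. \<psi> z * \<phi> z"
    have p: "?p \<in> test_fun A"
      using test_power_mult[OF A, of "\<lambda>x. \<psi> (x 0)" 1 "\<lambda>x. \<phi> (x 0)" 1 id 1 id] \<psi>(1) \<phi>(1)
      by (simp add: test_fun_def)
    have zero: "?p z = 0" if "z \<in> \<gamma> \<union> \<gamma>'" "z \<noteq> x" for z
    proof (rule ccontr)
      assume "?p z \<noteq> 0"
      then have "z \<in> L" "z \<in> L'" using \<psi>(4) \<phi>(4) by auto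
      then show False using that \<phi>(3) by blast
    qed
    have 1: "dist_of A \<gamma> ?p = ?p x" by (subst dist_of_eq[OF p, of "{x}"]) (use x zero in auto)
    have 2: "dist_of A \<gamma>' ?p = 0" by (subst dist_of_eq[OF p, of "{}"]) (use x' zero in force)+
    have "?p x > 0" using \<psi>(2) \<phi>(2) by simp
    then show False unfolding 1[symmetric] that(3) 2 by simp
  qed
  show ?thesis by (intro inj_onI equalityI subsetI) (metis sub)+
qed

lemma config_of_dist_of:
  fixes A :: "('a::t2_space, 'd::finite) chart set"
  shows "smooth_atlas A \<Longrightarrow> \<gamma> \<in> configs \<Longrightarrow> config_of A (dist_of A \<gamma>) = \<gamma>"
  unfolding config_of_def by (rule the_inv_into_f_f[OF inj_on_dist_of])

text \<open>Only configurations inside \<open>L\<close> are charged by \<open>G\<close>, so among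
  the finite subsets of \<open>\<gamma>\<close> only those of the finite set \<open>F\<close>
  count.\<close>

lemma K_transform_eq:
  assumes "finite F" "F \<subseteq> \<gamma>" "\<gamma> \<inter> L \<subseteq> F" "\<And>\<eta>. finite \<eta> \<Longrightarrow> G \<eta> \<noteq> 0 \<Longrightarrow> \<eta> \<subseteq> L"
  shows "K_transform G \<gamma> = (\<Sum>\<eta>\<in>Pow F. G \<eta>)"
  unfolding K_transform_def
proof (rule infsum_restrict_support)
  show "Pow F \<subseteq> {\<eta>. finite \<eta> \<and> \<eta> \<subseteq> \<gamma>}" using assms finite_subset by auto
  show "G \<eta> = 0" if "\<eta> \<in> {\<eta>. finite \<eta> \<and> \<eta> \<subseteq> \<gamma>} - Pow F" for \<eta>
    using that assms(3) assms(4)[of \<eta>] by blast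
qed (use assms in auto)

lemma bsupp_mset_set: "bsupp N L G \<Longrightarrow> finite \<eta> \<Longrightarrow> G (mset_set \<eta>) \<noteq> 0 \<Longrightarrow> \<eta> \<subseteq> L"
  unfolding bsupp_def by (metis finite_set_mset_mset_set)

lemma ins_mset_set:
  "finite \<eta> \<Longrightarrow> ins \<phi> G (mset_set \<eta>) = (\<Sum>x\<in>\<eta>. complex_of_real (\<phi> x) * G (mset_set (\<eta> - {x})))"
  unfolding ins_def sum_unfold_sum_mset
  by (intro arg_cong[where f = sum_mset] image_mset_cong) (simp add: mset_set_Diff)

lemma lin_mset_set:
  "lin \<phi> G (mset_set \<eta>) = (\<Sum>x\<in>\<eta>. complex_of_real (\<phi> x)) * G (mset_set \<eta>)"
  by (simp add: lin_def sum_unfold_sum_mset)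

text \<open>Multiplicativity of the K-transform for convolution with a test function, over a finite
  set. Removing \<open>x\<close> from \<open>\<eta>\<close> turns the \<open>ins\<close> part into a
  sum over \<open>\<xi>\<close> and the points outside \<open>\<xi>\<close>, and the
  \<open>lin\<close> part supplies the points inside.\<close>

lemma sum_Pow_conv_test:
  assumes "finite F"
  shows "(\<Sum>\<eta>\<in>Pow F. ins \<phi> G (mset_set \<eta>) + lin \<phi> G (mset_set \<eta>)) =
    (\<Sum>x\<in>F. complex_of_real (\<phi> x)) * (\<Sum>\<eta>\<in>Pow F. G (mset_set \<eta>))"
proof -
  have fin: "finite \<eta>" if "\<eta> \<in> Pow F" for \<eta> using that assms finite_subset by auto
  have "(\<Sum>\<eta>\<in>Pow F. ins \<phi> G (mset_set \<eta>)) =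
      (\<Sum>(\<eta>, x)\<in>Sigma (Pow F) (\<lambda>\<eta>. \<eta>). complex_of_real (\<phi> x) * G (mset_set (\<eta> - {x})))"
    using assms fin by (subst sum.Sigma[symmetric]) (auto simp: ins_mset_set)
  also have "\<dots> = (\<Sum>(\<xi>, x)\<in>Sigma (Pow F) (\<lambda>\<xi>. F - \<xi>). complex_of_real (\<phi> x) * G (mset_set \<xi>))"
    by (rule sum.reindex_bij_witness[where i = "\<lambda>(\<xi>, x). (insert x \<xi>, x)" and j = "\<lambda>(\<eta>, x). (\<eta> - {x}, x)"])
      (auto simp: insert_absorb)
  also have "\<dots> = (\<Sum>\<xi>\<in>Pow F. (\<Sum>x\<in>F - \<xi>. complex_of_real (\<phi> x)) * G (mset_set \<xi>))"
    using assms by (subst sum.Sigma[symmetric]) (auto simp: sum_distrib_right)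
  finally have "(\<Sum>\<eta>\<in>Pow F. ins \<phi> G (mset_set \<eta>) + lin \<phi> G (mset_set \<eta>)) =
      (\<Sum>\<xi>\<in>Pow F. ((\<Sum>x\<in>F - \<xi>. complex_of_real (\<phi> x)) + (\<Sum>x\<in>\<xi>. complex_of_real (\<phi> x))) * G (mset_set \<xi>))"
    by (simp add: sum.distrib lin_mset_set distrib_right)
  also have "\<dots> = (\<Sum>\<xi>\<in>Pow F. (\<Sum>x\<in>F. complex_of_real (\<phi> x)) * G (mset_set \<xi>))"
  proof (rule sum.cong[OF refl])
    fix \<xi> assume "\<xi> \<in> Pow F"
    then show "((\<Sum>x\<in>F - \<xi>. complex_of_real (\<phi> x)) + (\<Sum>x\<in>\<xi>. complex_of_real (\<phi> x))) * G (mset_set \<xi>) =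
        (\<Sum>x\<in>F. complex_of_real (\<phi> x)) * G (mset_set \<xi>)"
      using sum.subset_diff[of \<xi> F "\<lambda>x. complex_of_real (\<phi> x)"] assms by simp
  qed
  finally show ?thesis by (simp add: sum_distrib_left)
qed

definition KT :: "('a multiset \<Rightarrow> complex) \<Rightarrow> 'a set \<Rightarrow> complex" where
  "KT G \<gamma> = K_transform (\<lambda>\<eta>. G (mset_set \<eta>)) \<gamma>"

lemma KT_eq:
  assumes "bsupp N L G" "finite F" "F \<subseteq> \<gamma>" "\<gamma> \<inter> L \<subseteq> F"
  shows "KT G \<gamma> = (\<Sum>\<eta>\<in>Pow F. G (mset_set \<eta>))"
  unfolding KT_def by (rule K_transform_eq[OF assms(2-4)]) (rule bsupp_mset_set[OF assms(1)])

lemma KT_one: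
  fixes \<gamma> :: "'a set"
  shows "KT one_fun \<gamma> = 1"
proof -
  have "KT one_fun \<gamma> = (\<Sum>\<eta>\<in>Pow ({} :: 'a set). one_fun (mset_set \<eta>))"
    by (rule KT_eq[of 0 "{}"]) (auto simp: bsupp_def one_fun_def)
  then show ?thesis by (simp add: one_fun_def)
qed

lemma configs_finite: "\<gamma> \<in> configs \<Longrightarrow> compact L \<Longrightarrow> finite (\<gamma> \<inter> L)"
  by (simp add: configs_def)

context
  fixes A :: "('a::t2_space, 'd::finite) chart set"
  assumes A: "smooth_atlas A"
begin

lemma KT_add_scale:
  assumes "G \<in> F_fin A" "G' \<in> F_fin A" "\<gamma> \<in> configs"
  shows "KT (\<lambda>\<eta>. G \<eta> + c * G' \<eta>) \<gamma> = KT G \<gamma> + c * KT G' \<gamma>"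
proof -
  obtain N L where G: "compact L" "bsupp N L G" using F_fin_bsupp[OF A assms(1)] by blast
  obtain M L' where G': "compact L'" "bsupp M L' G'" using F_fin_bsupp[OF A assms(2)] by blast
  let ?F = "\<gamma> \<inter> (L \<union> L')"
  have F: "finite ?F" using configs_finite[OF assms(3) compact_Un[OF G(1) G'(1)]] .
  have "bsupp (max N M) (L \<union> L') (\<lambda>\<eta>. G \<eta> + c * G' \<eta>)"
    unfolding bsupp_def
  proof (intro allI impI)
    fix \<eta> assume "G \<eta> + c * G' \<eta> \<noteq> 0"
    then have "G \<eta> \<noteq> 0 \<or> G' \<eta> \<noteq> 0" by auto
    then show "size \<eta> \<le> max N M \<and> set_mset \<eta> \<subseteq> L \<union> L'"
      using G(2) G'(2) unfolding bsupp_def by (metis le_supI1 le_supI2 max.coboundedI1 max.coboundedI2)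
  qed
  from KT_eq[OF this F] have "KT (\<lambda>\<eta>. G \<eta> + c * G' \<eta>) \<gamma> = (\<Sum>\<eta>\<in>Pow ?F. G (mset_set \<eta>) + c * G' (mset_set \<eta>))"
    by simp
  moreover have "KT G \<gamma> = (\<Sum>\<eta>\<in>Pow ?F. G (mset_set \<eta>))" by (rule KT_eq[OF G(2) F]) auto
  moreover have "KT G' \<gamma> = (\<Sum>\<eta>\<in>Pow ?F. G' (mset_set \<eta>))" by (rule KT_eq[OF G'(2) F]) auto
  ultimately show ?thesis by (simp add: sum.distrib sum_distrib_left)
qed

lemma KT_conv_test:
  assumes \<phi>: "\<phi> \<in> test_fun A" and G: "G \<in> F_fin A" and \<gamma>: "\<gamma> \<in> configs"
  shows "KT (tensor_power (\<lambda>x. complex_of_real (\<phi> x)) 1 \<star> G) \<gamma> =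
    complex_of_real (dist_of A \<gamma> \<phi>) * KT G \<gamma>"
proof -
  let ?H = "tensor_power (\<lambda>x. complex_of_real (\<phi> x)) 1 \<star> G"
  obtain L where L: "compact L" "\<And>x. \<phi> x \<noteq> 0 \<Longrightarrow> x \<in> L" using test_fun_support[OF \<phi>] by blast
  obtain N L' where L': "compact L'" "bsupp N L' G" using F_fin_bsupp[OF A G] by blast
  obtain M L'' where L'': "compact L''" "bsupp M L'' ?H"
    using F_fin_bsupp[OF A conv_test_F_fin[OF A \<phi> G]] by blast
  let ?F = "\<gamma> \<inter> (L \<union> L' \<union> L'')"
  have F: "finite ?F" using configs_finite[OF \<gamma> compact_Un[OF compact_Un[OF L(1) L'(1)] L''(1)]] .
  have "KT ?H \<gamma> = (\<Sum>\<eta>\<in>Pow ?F. ins \<phi> G (mset_set \<eta>) + lin \<phi> G (mset_set \<eta>))"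
    using KT_eq[OF L''(2) F] unfolding conv_test by auto
  also have "\<dots> = (\<Sum>x\<in>?F. complex_of_real (\<phi> x)) * (\<Sum>\<eta>\<in>Pow ?F. G (mset_set \<eta>))"
    by (rule sum_Pow_conv_test[OF F])
  also have "(\<Sum>\<eta>\<in>Pow ?F. G (mset_set \<eta>)) = KT G \<gamma>" by (rule KT_eq[OF L'(2) F, symmetric]) auto
  also have "(\<Sum>x\<in>?F. complex_of_real (\<phi> x)) = complex_of_real (dist_of A \<gamma> \<phi>)"
    by (subst dist_of_eq[OF \<phi> F]) (use L(2) in auto)
  finally show ?thesis .
qed

end

text \<open>The common support reduces all transforms to one finite sum over subsets of
  \<open>\<gamma> \<inter> L\<close>, so pointwise convergence on simple configurations is
  enough.\<close>

lemma KT_tendsto: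
  assumes "\<And>k. bsupp N L (H k)" "bsupp M L G" "compact L" "\<gamma> \<in> configs"
    and conv: "\<And>\<eta>. finite \<eta> \<Longrightarrow> (\<lambda>k. H k (mset_set \<eta>)) \<longlonglongrightarrow> G (mset_set \<eta>)"
  shows "(\<lambda>k. KT (H k) \<gamma>) \<longlonglongrightarrow> KT G \<gamma>"
proof -
  have F: "finite (\<gamma> \<inter> L)" by (rule configs_finite[OF assms(4,3)])
  have 1: "KT (H k) \<gamma> = (\<Sum>\<eta>\<in>Pow (\<gamma> \<inter> L). H k (mset_set \<eta>))" for k
    by (rule KT_eq[OF assms(1) F]) auto
  have 2: "KT G \<gamma> = (\<Sum>\<eta>\<in>Pow (\<gamma> \<inter> L). G (mset_set \<eta>))" by (rule KT_eq[OF assms(2) F]) auto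
  show ?thesis unfolding 1 2
    by (intro tendsto_sum conv) (auto intro: finite_subset[OF _ F])
qed

text \<open>Links the two value types of the K-transform: complex for the comparison with
  \<open>K\<close>, extended nonnegative for the correlation measure.\<close>

lemma K_transform_ennreal_of_KT:
  assumes "bsupp N L G" "compact L" "\<gamma> \<in> configs"
    and g: "\<And>\<eta>. finite \<eta> \<Longrightarrow> G (mset_set \<eta>) = complex_of_real (g \<eta>)" "\<And>\<eta>. finite \<eta> \<Longrightarrow> 0 \<le> g \<eta>"
  shows "K_transform (\<lambda>\<eta>. ennreal (g \<eta>)) \<gamma> = ennreal (Re (KT G \<gamma>))" "0 \<le> Re (KT G \<gamma>)"
proof -
  have F: "finite (\<gamma> \<inter> L)" by (rule configs_finite[OF assms(3,2)])
  have fin: "finite \<eta>" if "\<eta> \<in> Pow (\<gamma> \<inter> L)" for \<eta>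
    using that by (auto intro: finite_subset[OF _ F])
  have "KT G \<gamma> = (\<Sum>\<eta>\<in>Pow (\<gamma> \<inter> L). G (mset_set \<eta>))" by (rule KT_eq[OF assms(1) F]) auto
  then have KT: "Re (KT G \<gamma>) = (\<Sum>\<eta>\<in>Pow (\<gamma> \<inter> L). g \<eta>)" using fin g(1) by simp
  have "K_transform (\<lambda>\<eta>. ennreal (g \<eta>)) \<gamma> = (\<Sum>\<eta>\<in>Pow (\<gamma> \<inter> L). ennreal (g \<eta>))"
  proof (rule K_transform_eq[OF F])
    fix \<eta> assume "finite \<eta>" "ennreal (g \<eta>) \<noteq> 0"
    then show "\<eta> \<subseteq> L" using bsupp_mset_set[OF assms(1)] g(1) by fastforce
  qed auto
  then show "K_transform (\<lambda>\<eta>. ennreal (g \<eta>)) \<gamma> = ennreal (Re (KT G \<gamma>))"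
    unfolding KT by (subst sum_ennreal[symmetric]) (use fin g(2) in auto)
  show "0 \<le> Re (KT G \<gamma>)" unfolding KT using fin g(2) by (intro sum_nonneg) auto
qed

section \<open>The K-transform of functions with values in \<open>ennreal\<close>\<close>

lemma K_transform_SUP_sum:
  fixes G :: "'a set \<Rightarrow> ennreal"
  shows "K_transform G \<gamma> = (SUP F\<in>{F. finite F \<and> F \<subseteq> {\<eta>. finite \<eta> \<and> \<eta> \<subseteq> \<gamma>}}. sum G F)"
  unfolding K_transform_def by (rule nonneg_infsum_complete) simp

lemma K_transform_cmult:
  fixes G :: "'a set \<Rightarrow> ennreal"
  shows "K_transform (\<lambda>\<eta>. c * G \<eta>) \<gamma> = c * K_transform G \<gamma>"
  unfolding K_transform_SUP_sum by (subst SUP_mult_left_ennreal) (simp add: sum_distrib_left)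

lemma K_transform_add:
  fixes G H :: "'a set \<Rightarrow> ennreal"
  shows "K_transform (\<lambda>\<eta>. G \<eta> + H \<eta>) \<gamma> = K_transform G \<gamma> + K_transform H \<gamma>"
  unfolding K_transform_def by (rule infsum_add) (auto intro: nonneg_summable_on_complete)

lemma K_transform_mono:
  fixes G H :: "'a set \<Rightarrow> ennreal"
  assumes "\<And>\<eta>. finite \<eta> \<Longrightarrow> G \<eta> \<le> H \<eta>"
  shows "K_transform G \<gamma> \<le> K_transform H \<gamma>"
  unfolding K_transform_def
  by (rule infsum_mono) (use assms in \<open>auto intro: nonneg_summable_on_complete\<close>)

text \<open>The transform is a supremum of finite sums; finite sums commute with increasing suprema,
  and two suprema commute.\<close>

lemma K_transform_SUP:
  fixes G :: "nat \<Rightarrow> 'a set \<Rightarrow> ennreal"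
  assumes "\<And>\<eta>. finite \<eta> \<Longrightarrow> incseq (\<lambda>k. G k \<eta>)"
  shows "K_transform (\<lambda>\<eta>. SUP k. G k \<eta>) \<gamma> = (SUP k. K_transform (G k) \<gamma>)"
proof -
  let ?X = "{F. finite F \<and> F \<subseteq> {\<eta>. finite \<eta> \<and> \<eta> \<subseteq> \<gamma>}}"
  have "K_transform (\<lambda>\<eta>. SUP k. G k \<eta>) \<gamma> = (SUP F\<in>?X. SUP k. sum (G k) F)"
    unfolding K_transform_SUP_sum
    by (intro SUP_cong refl ennreal_SUP_sum[symmetric]) (use assms in auto)
  also have "\<dots> = (SUP k. SUP F\<in>?X. sum (G k) F)" by (rule SUP_commute)
  finally show ?thesis unfolding K_transform_SUP_sum .
qed

lemma K_transform_suminf: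
  fixes G :: "nat \<Rightarrow> 'a set \<Rightarrow> ennreal"
  shows "K_transform (\<lambda>\<eta>. \<Sum>k. G k \<eta>) \<gamma> = (\<Sum>k. K_transform (G k) \<gamma>)"
proof -
  have sum: "K_transform (\<lambda>\<eta>. \<Sum>k<n. G k \<eta>) \<gamma> = (\<Sum>k<n. K_transform (G k) \<gamma>)" for n
    by (induction n) (simp_all add: K_transform_add, simp add: K_transform_def)
  have "K_transform (\<lambda>\<eta>. SUP n. \<Sum>k<n. G k \<eta>) \<gamma> = (SUP n. K_transform (\<lambda>\<eta>. \<Sum>k<n. G k \<eta>) \<gamma>)"
    by (rule K_transform_SUP) (auto intro!: incseq_SucI)
  then show ?thesis unfolding suminf_eq_SUP sum .
qed

text \<open>The functions differ only inside a null set, all subsets of which are measurable for the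
  completion.\<close>

lemma borel_measurable_completion_AE:
  fixes f g :: "'a \<Rightarrow> 'b::topological_space"
  assumes "f \<in> borel_measurable M" "AE x in M. f x = g x"
  shows "g \<in> borel_measurable (Complete_Measure.completion M)"
proof (rule borel_measurableI)
  fix S :: "'b set" assume "open S"
  show "g -` S \<inter> space (Complete_Measure.completion M) \<in> sets (Complete_Measure.completion M)"
  proof (rule completion.in_sets_AE)
    show "f -` S \<inter> space M \<in> sets (Complete_Measure.completion M)"
      using assms(1) \<open>open S\<close> by (intro sets_completionI_sets measurable_sets) auto
    show "AE x in Complete_Measure.completion M. (x \<in> f -` S \<inter> space M) = (x \<in> g -` S \<inter> space (Complete_Measure.completion M))"
      using AE_completion[OF assms(2)] by eventually_elim simp
  qed auto
qed

section \<open>Density of products of test functions\<close>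

definition test_in :: "('a::topological_space, 'd::finite) chart set \<Rightarrow> 'a set \<Rightarrow> ('a \<Rightarrow> real) set" where
  "test_in A L = {\<phi> \<in> test_fun A. \<forall>x. \<phi> x \<noteq> 0 \<longrightarrow> x \<in> L}"

text \<open>The complex linear span of the symmetrised products of \<open>n\<close> test functions
  vanishing off \<open>L\<close>; fixing \<open>L\<close> provides the common support that the bound
  on the form asks for.\<close>

inductive_set sspan :: "('a::topological_space, 'd::finite) chart set \<Rightarrow> 'a set \<Rightarrow> nat \<Rightarrow>
    ('a multiset \<Rightarrow> complex) set" for A L n where
  base: "set \<phi>s \<subseteq> test_in A L \<Longrightarrow> length \<phi>s = n \<Longrightarrow> sfun \<phi>s \<in> sspan A L n"
| add_scale: "G \<in> sspan A L n \<Longrightarrow> H \<in> sspan A L n \<Longrightarrow> (\<lambda>\<eta>. G \<eta> + c * H \<eta>) \<in> sspan A L n"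

lemma sfun_nonzero:
  "sfun \<phi>s \<eta> \<noteq> 0 \<Longrightarrow> (\<And>\<phi> x. \<phi> \<in> set \<phi>s \<Longrightarrow> \<phi> x \<noteq> 0 \<Longrightarrow> x \<in> L) \<Longrightarrow>
    size \<eta> = length \<phi>s \<and> set_mset \<eta> \<subseteq> L"
proof (induction \<phi>s arbitrary: \<eta>)
  case Nil
  then show ?case by (simp add: one_fun_def split: if_splits)
next
  case (Cons \<phi> \<phi>s)
  have "\<exists>x\<in>#\<eta>. complex_of_real (\<phi> x) * sfun \<phi>s (\<eta> - {#x#}) \<noteq> 0"
  proof (rule ccontr)
    assume "\<not> ?thesis"
    then have "image_mset (\<lambda>x. complex_of_real (\<phi> x) * sfun \<phi>s (\<eta> - {#x#})) \<eta> = image_mset (\<lambda>_. 0) \<eta>"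
      by (intro image_mset_cong) auto
    then have "ins \<phi> (sfun \<phi>s) \<eta> = 0" unfolding ins_def by simp
    then show False using Cons.prems(1) by simp
  qed
  then obtain x \<xi> where x: "\<eta> = add_mset x \<xi>" "\<phi> x \<noteq> 0" "sfun \<phi>s \<xi> \<noteq> 0"
    by (metis add_mset_remove_trivial mult_not_zero multi_member_split of_real_0)
  have "size \<xi> = length \<phi>s \<and> set_mset \<xi> \<subseteq> L"
    by (rule Cons.IH[OF x(3)], rule Cons.prems(2)) auto
  moreover have "x \<in> L" using Cons.prems(2)[of \<phi> x] x(2) by simp
  ultimately show ?case using x(1) by simp
qed

lemma sspan_bsupp: "G \<in> sspan A L n \<Longrightarrow> bsupp n L G"
proof (induction rule: sspan.induct)
  case (base \<phi>s)
  then show ?case using sfun_nonzero[of \<phi>s _ L] by (fastforce simp: bsupp_def test_in_def)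
next
  case (add_scale G H c)
  show ?case unfolding bsupp_def
  proof (intro allI impI)
    fix \<eta> assume "G \<eta> + c * H \<eta> \<noteq> 0"
    then have "G \<eta> \<noteq> 0 \<or> H \<eta> \<noteq> 0" by auto
    then show "size \<eta> \<le> n \<and> set_mset \<eta> \<subseteq> L" using add_scale unfolding bsupp_def by blast
  qed
qed

lemma ins_add_scale: "ins \<phi> (\<lambda>\<eta>. G \<eta> + c * H \<eta>) \<eta> = ins \<phi> G \<eta> + c * ins \<phi> H \<eta>"
  unfolding ins_def sum_mset_distrib_left sum_mset.distrib[symmetric]
  by (simp add: algebra_simps)

lemma ins_sspan:
  assumes "\<phi> \<in> test_in A L"
  shows "G \<in> sspan A L n \<Longrightarrow> ins \<phi> G \<in> sspan A L (Suc n)"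
proof (induction rule: sspan.induct)
  case (base \<phi>s)
  then show ?case using sspan.base[of "\<phi> # \<phi>s" A L "Suc n"] assms by simp
next
  case (add_scale G H c)
  have "ins \<phi> (\<lambda>\<eta>. G \<eta> + c * H \<eta>) = (\<lambda>\<eta>. ins \<phi> G \<eta> + c * ins \<phi> H \<eta>)"
    by (rule ext) (rule ins_add_scale)
  then show ?case using sspan.add_scale[OF add_scale.IH, of c] by simp
qed

lemma sspan_zero: "set \<phi>s \<subseteq> test_in A L \<Longrightarrow> length \<phi>s = n \<Longrightarrow> (\<lambda>_. 0) \<in> sspan A L n"
  using sspan.add_scale[OF sspan.base sspan.base, of \<phi>s A L n \<phi>s "-1"] by simp

context
  fixes A :: "('a::t2_space, 'd::finite) chart set"
  assumes A: "smooth_atlas A"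
begin

lemma test_fun_mult:
  assumes "\<psi> \<in> test_fun A" "\<phi> \<in> test_fun A"
  shows "(\<lambda>x. \<psi> x * \<phi> x) \<in> test_fun A"
  using test_power_mult[OF A, of "\<lambda>x. \<psi> (x 0)" 1 "\<lambda>x. \<phi> (x 0)" 1 id 1 id] assms
  by (simp add: test_fun_def)

lemma test_fun_scale: "\<phi> \<in> test_fun A \<Longrightarrow> (\<lambda>x. c * \<phi> x) \<in> test_fun A"
  using test_power_linear[OF A, of "\<lambda>x. \<phi> (x 0)" 1 "\<lambda>t. c * t"] bounded_linear_mult_right[of c]
  by (simp add: test_fun_def)

lemma test_fun_sum: "(\<And>i. i \<in> I \<Longrightarrow> \<phi> i \<in> test_fun A) \<Longrightarrow> (\<lambda>x. \<Sum>i\<in>I. \<phi> i x) \<in> test_fun A"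
  unfolding test_fun_def mem_Collect_eq by (rule test_power_sum[OF A])

lemma test_fun_continuous:
  assumes "\<phi> \<in> test_fun A"
  shows "continuous_on UNIV \<phi>"
proof -
  have "continuous_on UNIV (\<lambda>x::nat \<Rightarrow> 'a. \<phi> (x 0))"
    using assms test_power_continuous[OF A] by (simp add: test_fun_def)
  moreover have "continuous_on UNIV (\<lambda>x::'a. (\<lambda>_::nat. x))"
    by (rule continuous_on_coordinatewise_then_product) (rule continuous_on_id)
  ultimately show ?thesis
    using continuous_on_compose2[of UNIV "\<lambda>x::nat \<Rightarrow> 'a. \<phi> (x 0)" UNIV "\<lambda>x _. x"] by simp
qed

lemma continuous_on_coord:
  assumes "continuous_on UNIV (f :: 'a \<Rightarrow> real)"
  shows "continuous_on UNIV (\<lambda>x::nat \<Rightarrow> 'a. f (x i))"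
  by (rule continuous_on_compose2[OF assms continuous_on_product_coordinates]) simp

text \<open>By the derivation property, \<open>lin \<psi>\<close> replaces one factor
  \<open>\<phi>\<close> at a time by the product of \<open>\<psi>\<close> and \<open>\<phi>\<close>,
  a test function that still vanishes off \<open>L\<close>.\<close>

lemma lin_sfun: "\<psi> \<in> test_fun A \<Longrightarrow> set \<phi>s \<subseteq> test_in A L \<Longrightarrow> lin \<psi> (sfun \<phi>s) \<in> sspan A L (length \<phi>s)"
proof (induction \<phi>s)
  case Nil
  have "lin \<psi> one_fun = (\<lambda>_. 0)" by (auto simp: fun_eq_iff lin_def one_fun_def)
  then show ?case using sspan_zero[of "[]" A L 0] by simp
next
  case (Cons \<phi> \<phi>s)
  let ?p = "\<lambda>x. \<psi> x * \<phi> x"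
  have p: "?p \<in> test_in A L"
    using Cons.prems test_fun_mult[of \<psi> \<phi>] by (auto simp: test_in_def)
  have "lin \<psi> (sfun (\<phi> # \<phi>s)) = (\<lambda>\<eta>. sfun (?p # \<phi>s) \<eta> + 1 * ins \<phi> (lin \<psi> (sfun \<phi>s)) \<eta>)"
    by (simp add: fun_eq_iff lin_ins)
  moreover have "sfun (?p # \<phi>s) \<in> sspan A L (length (\<phi> # \<phi>s))"
    by (rule sspan.base) (use p Cons.prems in auto)
  moreover have "ins \<phi> (lin \<psi> (sfun \<phi>s)) \<in> sspan A L (length (\<phi> # \<phi>s))"
    using ins_sspan[of \<phi> A L] Cons by simp
  ultimately show ?case using sspan.add_scale by metis
qed

lemma sspan_F_fin: "G \<in> sspan A L n \<Longrightarrow> G \<in> F_fin A"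
  by (induction rule: sspan.induct)
    (auto simp: test_in_def intro!: sfun_F_fin[OF A] F_fin_add[OF A] F_fin_scale[OF A])

text \<open>The products of degree \<open>n + 1\<close> lie in the algebra generated by the test
  functions: \<open>sfun (\<phi> # \<phi>s)\<close> is the convolution of \<open>\<phi>\<close> with
  \<open>sfun \<phi>s\<close> minus \<open>lin \<phi> (sfun \<phi>s)\<close>, and both terms come
  from elements of degree \<open>n\<close>.\<close>

lemma sspan_induct_algebra:
  assumes one: "P one_fun"
    and add_scale: "\<And>G H c. G \<in> F_fin A \<Longrightarrow> H \<in> F_fin A \<Longrightarrow> P G \<Longrightarrow> P H \<Longrightarrow> P (\<lambda>\<eta>. G \<eta> + c * H \<eta>)"
    and conv: "\<And>\<phi> G. \<phi> \<in> test_fun A \<Longrightarrow> G \<in> F_fin A \<Longrightarrow> P G \<Longrightarrow>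
      P (tensor_power (\<lambda>x. complex_of_real (\<phi> x)) 1 \<star> G)"
  shows "G \<in> sspan A L n \<Longrightarrow> P G"
proof (induction n arbitrary: G)
  case 0
  then show ?case
    by (induction rule: sspan.induct) (use one add_scale sspan_F_fin in auto)
next
  case (Suc n)
  from Suc.prems show ?case
  proof (induction rule: sspan.induct)
    case (base \<phi>s')
    then obtain \<phi> \<phi>s where eq: "\<phi>s' = \<phi> # \<phi>s" "length \<phi>s = n" by (cases \<phi>s') auto
    then have \<phi>: "\<phi> \<in> test_fun A" "set \<phi>s \<subseteq> test_in A L" using base by (auto simp: test_in_def)
    have s: "sfun \<phi>s \<in> sspan A L n" using \<phi> eq by (intro sspan.base)
    have l: "lin \<phi> (sfun \<phi>s) \<in> sspan A L n" using lin_sfun[OF \<phi>] eq by simp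
    let ?C = "tensor_power (\<lambda>x. complex_of_real (\<phi> x)) 1 \<star> sfun \<phi>s"
    have "P (\<lambda>\<eta>. ?C \<eta> + (-1) * lin \<phi> (sfun \<phi>s) \<eta>)"
      using Suc.IH[OF s] Suc.IH[OF l] \<phi>(1) sspan_F_fin[OF s] sspan_F_fin[OF l] conv_test_F_fin[OF A]
      by (intro add_scale conv) auto
    moreover have "sfun \<phi>s' = (\<lambda>\<eta>. ?C \<eta> + (-1) * lin \<phi> (sfun \<phi>s) \<eta>)"
      by (simp add: fun_eq_iff eq conv_test[unfolded One_nat_def])
    ultimately show ?case by simp
  next
    case (add_scale G H c)
    then show ?case using assms(2) sspan_F_fin by blast
  qed
qed

text \<open>Positivity on \<open>L\<close> is what the later division calls for, and a finite sum of
  bumps provides it.\<close>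

lemma exists_cutoff:
  assumes "compact L"
  shows "\<exists>\<kappa>\<in>test_fun A. (\<forall>x. 0 \<le> \<kappa> x) \<and> (\<forall>x\<in>L. 0 < \<kappa> x)"
proof -
  have "\<forall>x. \<exists>\<phi>\<in>test_fun A. (\<forall>z. \<phi> z \<ge> 0) \<and> \<phi> x > 0" using exists_bump[OF A open_UNIV UNIV_I] by blast
  then obtain \<phi> where \<phi>: "\<And>x. \<phi> x \<in> test_fun A" "\<And>x z. 0 \<le> \<phi> x z" "\<And>x. 0 < \<phi> x x" by metis
  have op: "open {z. 0 < \<phi> x z}" for x
    using test_fun_continuous[OF \<phi>(1)] by (intro open_Collect_less continuous_on_const)
  obtain D where D: "finite D" "L \<subseteq> (\<Union>x\<in>D. {z. 0 < \<phi> x z})"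
  proof (rule compactE_image[OF assms, of UNIV "\<lambda>x. {z. 0 < \<phi> x z}"])
    show "L \<subseteq> (\<Union>x\<in>UNIV. {z. 0 < \<phi> x z})" using \<phi>(3) by auto
  qed (use op in auto)
  have "0 < (\<Sum>x\<in>D. \<phi> x z)" if z: "z \<in> L" for z
  proof -
    obtain x where "x \<in> D" "0 < \<phi> x z" using z D(2) by auto
    then show ?thesis using D(1) \<phi>(2) by (intro sum_pos2[of D x]) auto
  qed
  then show ?thesis using \<phi> by (intro bexI[of _ "\<lambda>z. \<Sum>x\<in>D. \<phi> x z"] test_fun_sum) (auto intro: sum_nonneg)
qed

text \<open>Stone--Weierstrass asks for the constants, which need not be test functions. This class
  contains constants and test functions alike, and multiplication by a cutoff takes it into the test
  functions.\<close>

definition multipliers :: "('a \<Rightarrow> real) set" where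
  "multipliers = {\<psi>. continuous_on UNIV \<psi> \<and> (\<forall>\<kappa>\<in>test_fun A. (\<lambda>x. \<psi> x * \<kappa> x) \<in> test_fun A)}"

lemma multipliers_const: "(\<lambda>_. c) \<in> multipliers"
  by (auto simp: multipliers_def intro: test_fun_scale)

lemma multipliers_mult: "\<psi> \<in> multipliers \<Longrightarrow> \<psi>' \<in> multipliers \<Longrightarrow> (\<lambda>x. \<psi> x * \<psi>' x) \<in> multipliers"
  by (auto simp: multipliers_def mult.assoc intro!: continuous_on_mult)

lemma multipliers_test: "\<phi> \<in> test_fun A \<Longrightarrow> \<phi> \<in> multipliers"
  by (auto simp: multipliers_def test_fun_continuous intro!: test_fun_mult)

text \<open>The algebra for Stone--Weierstrass: finite sums of tensor products of multipliers. The
  scalar \<open>c\<close> provides the constants, in particular for \<open>n = 0\<close>, where the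
  product is empty.\<close>

inductive_set product_ring :: "nat \<Rightarrow> ((nat \<Rightarrow> 'a) \<Rightarrow> real) set" for n where
  base: "(\<And>i. i < n \<Longrightarrow> \<psi> i \<in> multipliers) \<Longrightarrow> (\<lambda>x. c * (\<Prod>i<n. \<psi> i (x i))) \<in> product_ring n"
| add: "p \<in> product_ring n \<Longrightarrow> r \<in> product_ring n \<Longrightarrow> (\<lambda>x. p x + r x) \<in> product_ring n"

lemma product_ring_mult_base:
  assumes "\<And>i. i < n \<Longrightarrow> \<psi> i \<in> multipliers"
  shows "r \<in> product_ring n \<Longrightarrow> (\<lambda>x. c * (\<Prod>i<n. \<psi> i (x i)) * r x) \<in> product_ring n"
proof (induction rule: product_ring.induct)
  case (base \<psi>' c')
  have "(\<lambda>x. c * c' * (\<Prod>i<n. \<psi> i (x i) * \<psi>' i (x i))) \<in> product_ring n"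
    using assms base multipliers_mult by (intro product_ring.base) auto
  then show ?case by (simp add: prod.distrib mult_ac)
next
  case (add p r)
  then show ?case using product_ring.add[OF add.IH] by (simp add: algebra_simps)
qed

lemma product_ring_mult: "p \<in> product_ring n \<Longrightarrow> r \<in> product_ring n \<Longrightarrow> (\<lambda>x. p x * r x) \<in> product_ring n"
proof (induction rule: product_ring.induct)
  case (base \<psi> c)
  show ?case by (rule product_ring_mult_base[OF base(1) base(2)])
next
  case (add p q)
  then show ?case using product_ring.add[OF add.IH] by (simp add: algebra_simps)
qed

lemma product_ring_continuous: "p \<in> product_ring n \<Longrightarrow> continuous_on UNIV p"
proof (induction rule: product_ring.induct)
  case (base \<psi> c)
  have "continuous_on UNIV (\<lambda>x. \<psi> i (x i))" if "i < n" for i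
    using base[OF that] by (auto simp: multipliers_def intro!: continuous_on_coord)
  then show ?case by (intro continuous_on_mult continuous_on_const continuous_on_prod) auto
qed (rule continuous_on_add)

lemma product_ring_const: "(\<lambda>_. c) \<in> product_ring n"
  using product_ring.base[of n "\<lambda>_ _. 1" c] multipliers_const by simp

lemma product_ring_coord:
  assumes "\<phi> \<in> test_fun A" "i < n"
  shows "(\<lambda>x. \<phi> (x i)) \<in> product_ring n"
proof -
  have "(\<lambda>x. 1 * (\<Prod>j<n. (if j = i then \<phi> else (\<lambda>_. 1)) (x j))) \<in> product_ring n"
    using multipliers_test[OF assms(1)] multipliers_const by (intro product_ring.base) auto
  moreover have "(\<Prod>j<n. (if j = i then \<phi> else (\<lambda>_. 1)) (x j)) = \<phi> (x i)" for x
  proof -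
    have "(\<Prod>j<n. (if j = i then \<phi> else (\<lambda>_. 1)) (x j)) = (\<Prod>j<n. if j = i then \<phi> (x j) else 1)"
      by (intro prod.cong) auto
    then show ?thesis using assms(2) by (simp add: prod.delta)
  qed
  ultimately show ?thesis by simp
qed

text \<open>The coordinates from \<open>n\<close> on carry the same fixed value as in the compact
  copy of \<open>L^n\<close> below, so that tuples of points of \<open>L\<close> belong to
  it.\<close>

definition tup :: "nat \<Rightarrow> 'a list \<Rightarrow> nat \<Rightarrow> 'a" where
  "tup n xs i = (if i < n then xs ! i else undefined)"

definition perm_sum :: "nat \<Rightarrow> ('a list \<Rightarrow> real) \<Rightarrow> 'a set \<Rightarrow> complex" where
  "perm_sum n f \<eta> = (if card \<eta> = n then complex_of_real (\<Sum>xs\<in>permutations_of_set \<eta>. f xs) else 0)"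

lemma perm_sum_add: "perm_sum n (\<lambda>xs. f xs + g xs) \<eta> = perm_sum n f \<eta> + perm_sum n g \<eta>"
  by (simp add: perm_sum_def sum.distrib)

lemma perm_sum_cong: "(\<And>xs. length xs = n \<Longrightarrow> f xs = g xs) \<Longrightarrow> perm_sum n f \<eta> = perm_sum n g \<eta>"
  using length_finite_permutations_of_set[of _ \<eta>]
  by (auto simp: perm_sum_def simp del: of_real_sum intro!: sum.cong arg_cong[where f = complex_of_real])

lemma perm_sum_cmult: "perm_sum n (\<lambda>xs. c * f xs) \<eta> = complex_of_real c * perm_sum n f \<eta>"
  by (simp add: perm_sum_def sum_distrib_left)

text \<open>Multiplying by \<open>\<kappa>\<close> in every variable turns the multipliers
  \<open>\<psi> i\<close> into test functions vanishing off \<open>L\<close>; summation over the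
  orderings of \<open>\<eta>\<close> then gives \<open>sfun\<close> of these.\<close>

lemma product_ring_sspan:
  assumes \<kappa>: "\<kappa> \<in> test_in A L"
  shows "p \<in> product_ring n \<Longrightarrow> \<exists>H\<in>sspan A L n. \<forall>\<eta>. finite \<eta> \<longrightarrow>
    H (mset_set \<eta>) = perm_sum n (\<lambda>xs. p (tup n xs) * (\<Prod>i<n. \<kappa> (xs ! i))) \<eta>"
proof (induction rule: product_ring.induct)
  case (base \<psi> c)
  let ?ps = "map (\<lambda>i x. \<psi> i x * \<kappa> x) [0..<n]"
  have ps: "set ?ps \<subseteq> test_in A L" using base \<kappa> by (auto simp: multipliers_def test_in_def)
  have eq: "c * (\<Prod>i<n. \<psi> i (tup n xs i)) * (\<Prod>i<n. \<kappa> (xs ! i)) = c * prodl ?ps xs"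
    if "length xs = n" for xs
    using that by (simp add: prodl_nth tup_def prod.distrib)
  have mem: "(\<lambda>\<eta>. 0 + c * sfun ?ps \<eta>) \<in> sspan A L n"
    by (rule sspan.add_scale[OF sspan_zero[of ?ps] sspan.base]) (use ps in auto)
  have "0 + c * sfun ?ps (mset_set \<eta>) =
      perm_sum n (\<lambda>xs. c * (\<Prod>i<n. \<psi> i (tup n xs i)) * (\<Prod>i<n. \<kappa> (xs ! i))) \<eta>" if "finite \<eta>" for \<eta>
  proof -
    have "perm_sum n (\<lambda>xs. c * (\<Prod>i<n. \<psi> i (tup n xs i)) * (\<Prod>i<n. \<kappa> (xs ! i))) \<eta> =
        complex_of_real c * perm_sum n (prodl ?ps) \<eta>"
      unfolding perm_sum_cmult[symmetric] by (rule perm_sum_cong[OF eq])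
    moreover have "sfun ?ps (mset_set \<eta>) = perm_sum n (prodl ?ps) \<eta>"
      using sfun_mset_set[OF that, of ?ps] by (simp add: perm_sum_def)
    ultimately show ?thesis by simp
  qed
  then show ?case by (intro bexI[OF _ mem] allI impI)
next
  case (add p r)
  from add.IH(1) obtain H where H: "H \<in> sspan A L n" "\<forall>\<eta>. finite \<eta> \<longrightarrow>
    H (mset_set \<eta>) = perm_sum n (\<lambda>xs. p (tup n xs) * (\<Prod>i<n. \<kappa> (xs ! i))) \<eta>" by blast
  from add.IH(2) obtain H' where H': "H' \<in> sspan A L n" "\<forall>\<eta>. finite \<eta> \<longrightarrow>
    H' (mset_set \<eta>) = perm_sum n (\<lambda>xs. r (tup n xs) * (\<Prod>i<n. \<kappa> (xs ! i))) \<eta>" by blast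
  show ?case
    by (intro bexI[OF _ sspan.add_scale[OF H(1) H'(1), of 1]]) (simp add: H(2) H'(2) distrib_right perm_sum_add)
qed

definition approximable :: "'a set \<Rightarrow> nat \<Rightarrow> ('a set \<Rightarrow> complex) \<Rightarrow> real \<Rightarrow> bool" where
  "approximable L n F e \<longleftrightarrow> (\<exists>H\<in>sspan A L n. \<forall>\<eta>. finite \<eta> \<longrightarrow> norm (H (mset_set \<eta>) - F \<eta>) \<le> e)"

text \<open>Stone--Weierstrass is applied to the quotient by a cutoff, so that multiplying back by the
  cutoff gives an approximation that is uniform on the whole space and has a fixed support.\<close>

lemma dense_real:
  fixes g :: "(nat \<Rightarrow> 'a) \<Rightarrow> real"
  assumes g: "continuous_on UNIV g" "compact L\<^sub>0" "supported n L\<^sub>0 g" "\<And>x x'. (\<And>i. i < n \<Longrightarrow> x i = x' i) \<Longrightarrow> g x = g x'"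
  shows "\<exists>L. compact L \<and> (\<forall>e>0. approximable L n (perm_sum n (\<lambda>xs. g (tup n xs))) e)"
proof -
  obtain \<kappa> where \<kappa>: "\<kappa> \<in> test_fun A" "\<And>x. 0 \<le> \<kappa> x" "\<And>x. x \<in> L\<^sub>0 \<Longrightarrow> 0 < \<kappa> x"
    using exists_cutoff[OF g(2)] by blast
  obtain L where L: "compact L" "supported 1 L (\<lambda>x. \<kappa> (x 0))"
    using \<kappa>(1) unfolding test_fun_def test_power_iff by blast
  have supp: "x \<in> L" if "\<kappa> x \<noteq> 0" for x
    using L(2)[unfolded supported_def, rule_format, of "\<lambda>_. x" 0] that by simp
  have \<kappa>L: "\<kappa> \<in> test_in A L" using \<kappa>(1) supp by (simp add: test_in_def)
  obtain B where B: "\<And>x. \<kappa> x \<le> B" "0 < B"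
  proof -
    have "\<exists>B. \<forall>x::nat \<Rightarrow> 'a. norm (\<kappa> (x 0)) \<le> B"
      using test_power_bounded[OF A, of "\<lambda>x. \<kappa> (x 0)" 1] \<kappa>(1) unfolding test_fun_def by simp
    then obtain B where B: "\<forall>x::nat \<Rightarrow> 'a. norm (\<kappa> (x 0)) \<le> B" by blast
    have le: "\<kappa> x \<le> max B 1" for x using B[rule_format, of "\<lambda>_. x"] by simp
    show ?thesis by (rule that[OF le]) simp
  qed
  let ?X = "\<lambda>x. \<Prod>i<n. \<kappa> (x i)"
  have X0: "0 \<le> ?X x" for x using \<kappa>(2) by (intro prod_nonneg) auto
  have XB: "?X x \<le> B ^ n" for x
    using prod_mono[of "{..<n}" "\<lambda>i. \<kappa> (x i)" "\<lambda>_. B"] \<kappa>(2) B(1) by simp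
  have Xcont: "continuous_on UNIV ?X"
    by (intro continuous_on_prod continuous_on_coord test_fun_continuous \<kappa>(1))
  have gX: "g x = g x / ?X x * ?X x" for x
  proof (cases "g x = 0")
    case False
    then have "0 < ?X x" using g(3) \<kappa>(3) by (intro prod_pos) (auto simp: supported_def)
    then show ?thesis by (simp del: prod_zero_iff)
  qed simp
  have h: "continuous_on UNIV (\<lambda>x. g x / ?X x)"
  proof -
    \<comment> \<open>On \<open>?O\<close> the denominator is positive; on \<open>?O'\<close> some
      coordinate below \<open>n\<close> lies outside \<open>L\<^sub>0\<close>, so the quotient is
      \<open>0\<close> there.\<close>
    let ?O = "{x. 0 < ?X x}" and ?O' = "\<Union>i\<in>{..<n}. {x. x i \<in> - L\<^sub>0}"
    have "open ?O" using Xcont by (intro open_Collect_less continuous_on_const)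
    moreover have "open ?O'" using compact_imp_closed[OF g(2)] by (intro open_UN ballI open_coord) auto
    moreover have "continuous_on ?O (\<lambda>x. g x / ?X x)"
      using g(1) Xcont by (intro continuous_on_divide) (auto intro: continuous_on_subset simp del: prod_zero_iff)
    moreover have "continuous_on ?O' (\<lambda>x. g x / ?X x)"
      by (rule continuous_on_eq[OF continuous_on_const[of _ 0]]) (use g(3) in \<open>auto simp: supported_def\<close>)
    moreover have "?O \<union> ?O' = UNIV" using \<kappa>(3) by (auto intro!: prod_pos)
    ultimately show ?thesis using continuous_on_open_Un[of ?O ?O'] by simp
  qed
  let ?S = "{x. (\<forall>i<n. x i \<in> L) \<and> (\<forall>i\<ge>n. x i = undefined)}"
  interpret function_ring_on "product_ring n" ?S
  proof
    show "compact ?S" by (rule compact_power[OF L(1)])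
    show "continuous_on ?S f" if "f \<in> product_ring n" for f
      using product_ring_continuous[OF that] continuous_on_subset by blast
    show "\<exists>f\<in>product_ring n. f x \<noteq> f y" if xy: "x \<in> ?S" "y \<in> ?S" "x \<noteq> y" for x y
    proof -
      obtain i where i: "x i \<noteq> y i" using xy(3) by auto
      \<comment> \<open>Points of \<open>?S\<close> share all coordinates from \<open>n\<close> on,
        so they differ in one that a test function can separate.\<close>
      then have "i < n" using xy(1,2) by (metis (mono_tags, lifting) mem_Collect_eq not_le)
      have op: "open (- {y i})" by (intro open_Compl finite_imp_closed) simp
      have "x i \<in> - {y i}" using i by simp
      from exists_bump[OF A op this] obtain \<phi> L' where \<phi>: "\<phi> \<in> test_fun A" "0 < \<phi> (x i)"
        "L' \<subseteq> - {y i}" "\<forall>z. \<phi> z \<noteq> 0 \<longrightarrow> z \<in> L'" by blast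
      have "\<phi> (y i) = 0" using \<phi>(3,4) by auto
      then have "\<phi> (x i) \<noteq> \<phi> (y i)" using \<phi>(2) by simp
      then show ?thesis by (rule bexI[of _ "\<lambda>x. \<phi> (x i)", OF _ product_ring_coord[OF \<phi>(1) \<open>i < n\<close>]])
    qed
  qed (auto intro: product_ring.add product_ring_mult product_ring_const)
  have "approximable L n (perm_sum n (\<lambda>xs. g (tup n xs))) e" if e: "e > 0" for e
  proof -
    \<comment> \<open>\<open>fact n\<close> counts the orderings of an \<open>n\<close>-point set
      and \<open>B ^ n\<close> bounds the product of the cutoffs; both factors are lost
      below.\<close>
    let ?d = "e / (fact n * B ^ n)"
    have "?d > 0" using e B(2) by simp
    from Stone_Weierstrass_basic[OF continuous_on_subset[OF h subset_UNIV] this]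
    obtain p where p: "p \<in> product_ring n" "\<forall>x\<in>?S. \<bar>g x / ?X x - p x\<bar> < ?d" by blast
    from product_ring_sspan[OF \<kappa>L p(1)] obtain H where H: "H \<in> sspan A L n" "\<forall>\<eta>. finite \<eta> \<longrightarrow>
        H (mset_set \<eta>) = perm_sum n (\<lambda>xs. p (tup n xs) * (\<Prod>i<n. \<kappa> (xs ! i))) \<eta>" by blast
    have close: "\<bar>p (tup n xs) * (\<Prod>i<n. \<kappa> (xs ! i)) - g (tup n xs)\<bar> \<le> e / fact n" for xs
    proof -
      let ?x = "tup n xs"
      have Xx: "(\<Prod>i<n. \<kappa> (xs ! i)) = ?X ?x" by (simp add: tup_def)
      show ?thesis
      proof (cases "?x \<in> ?S")
        case True
        have "p ?x * ?X ?x - g ?x = (p ?x - g ?x / ?X ?x) * ?X ?x" using gX[of ?x] by (simp add: algebra_simps)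
        then have "\<bar>p ?x * ?X ?x - g ?x\<bar> = \<bar>p ?x - g ?x / ?X ?x\<bar> * ?X ?x" using X0[of ?x] by (simp add: abs_mult)
        also have "\<dots> \<le> ?d * B ^ n" using p(2)[rule_format, OF True] X0[of ?x] XB[of ?x]
          by (intro mult_mono) (auto simp: abs_minus_commute)
        also have "\<dots> = e / fact n" using B(2) by simp
        finally show ?thesis by (simp add: Xx)
      next
        case False
        then obtain i where "i < n" "?x i \<notin> L" by (auto simp: tup_def)
        then have "\<kappa> (?x i) = 0" using supp by blast
        then have X: "?X ?x = 0" using \<open>i < n\<close> by auto
        then have g: "g ?x = 0" using gX[of ?x] by simp
        show ?thesis unfolding Xx X g using e by simp
      qed
    qed
    have "norm (H (mset_set \<eta>) - perm_sum n (\<lambda>xs. g (tup n xs)) \<eta>) \<le> e" if "finite \<eta>" for \<eta>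
    proof (cases "card \<eta> = n")
      case True
      have "H (mset_set \<eta>) - perm_sum n (\<lambda>xs. g (tup n xs)) \<eta> = complex_of_real
          (\<Sum>xs\<in>permutations_of_set \<eta>. p (tup n xs) * (\<Prod>i<n. \<kappa> (xs ! i)) - g (tup n xs))"
        using H(2) that True by (simp add: perm_sum_def sum_subtractf)
      also have "norm \<dots> \<le> (\<Sum>xs\<in>permutations_of_set \<eta>. e / fact n)"
        unfolding norm_of_real by (rule order_trans[OF sum_abs]) (intro sum_mono close)
      also have "\<dots> = e" using \<open>finite \<eta>\<close> True by simp
      finally show ?thesis .
    next
      case False
      then show ?thesis using H(2) that e by (simp add: perm_sum_def)
    qed
    then show ?thesis using H(1) unfolding approximable_def by blast
  qed
  then show ?thesis using L(1) by blast
qed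

lemma sspan_mono:
  assumes "G \<in> sspan A L n" "L \<subseteq> L'"
  shows "G \<in> sspan A L' n"
  using assms(1)
proof (induction rule: sspan.induct)
  case (base \<phi>s)
  have "test_in A L \<subseteq> test_in A L'" using assms(2) by (auto simp: test_in_def)
  then show ?case using base by (intro sspan.base) auto
qed (rule sspan.add_scale)

lemma cfg_tup:
  assumes "length xs = n"
  shows "cfg (tup n xs) {..<n} = mset xs"
proof -
  have "cfg (tup n xs) {..<n} = cfg (\<lambda>i. xs ! i) {..<n}" by (rule cfg_cong) (simp add: tup_def)
  then show ?thesis using cfg_nth[of xs] assms by simp
qed

lemma sspan_dense:
  assumes G: "G \<in> F_fin A"
  shows "\<exists>L. compact L \<and> (\<forall>e>0. approximable L n (\<lambda>\<eta>. part n G (mset_set \<eta>)) e)"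
proof -
  \<comment> \<open>The division compensates the sum over all \<open>n!\<close> orderings, on each
    of which the symmetric function takes the same value.\<close>
  let ?g = "\<lambda>x. G (cfg x {..<n}) / fact n"
  obtain L\<^sub>0 where L\<^sub>0: "compact L\<^sub>0" "supported n L\<^sub>0 (\<lambda>x. G (cfg x {..<n}))"
    using G unfolding F_fin_iff test_power_iff by blast
  have cont: "continuous_on UNIV ?g"
    using F_fin_mset_cont[OF A G] by (auto simp: mset_cont_def intro!: continuous_intros)
  have loc: "cfg x {..<n} = cfg x' {..<n}" if "\<And>i. i < n \<Longrightarrow> x i = x' i" for x x' :: "nat \<Rightarrow> 'a"
    by (rule cfg_cong) (use that in auto)
  let ?R = "perm_sum n (\<lambda>xs. Re (?g (tup n xs)))" and ?I = "perm_sum n (\<lambda>xs. Im (?g (tup n xs)))"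
  have part: "part n G (mset_set \<eta>) = ?R \<eta> + \<i> * ?I \<eta>" if "finite \<eta>" for \<eta>
  proof (cases "card \<eta> = n")
    case True
    have eq: "?g (tup n xs) = G (mset_set \<eta>) / fact n" if "xs \<in> permutations_of_set \<eta>" for xs
    proof -
      have "mset xs = mset_set \<eta>"
        using permutations_of_setD[OF that] mset_set_set[of xs] by simp
      moreover have "length xs = n" using length_finite_permutations_of_set[OF that] True by simp
      ultimately show ?thesis by (simp add: cfg_tup)
    qed
    have "?R \<eta> + \<i> * ?I \<eta> = (\<Sum>xs\<in>permutations_of_set \<eta>. ?g (tup n xs))"
      using True by (simp add: perm_sum_def complex_eq_iff)
    also have "\<dots> = (\<Sum>xs\<in>permutations_of_set \<eta>. G (mset_set \<eta>) / fact n)" by (rule sum.cong[OF refl eq])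
    also have "\<dots> = G (mset_set \<eta>)" using True that by simp
    finally show ?thesis using True by (simp add: part_def)
  qed (simp add: part_def perm_sum_def)
  have "\<exists>L. compact L \<and> (\<forall>e>0. approximable L n ?R e)"
  proof (rule dense_real[OF _ L\<^sub>0(1)])
    show "continuous_on UNIV (\<lambda>x. Re (?g x))" using cont by (rule continuous_on_Re)
    show "supported n L\<^sub>0 (\<lambda>x. Re (?g x))"
      unfolding supported_def
    proof (intro allI impI)
      fix x i assume "Re (?g x) \<noteq> 0" "i < n"
      then have "G (cfg x {..<n}) \<noteq> 0" by auto
      then show "x i \<in> L\<^sub>0" using L\<^sub>0(2) \<open>i < n\<close> unfolding supported_def by blast
    qed
    show "Re (?g x) = Re (?g x')" if "\<And>i. i < n \<Longrightarrow> x i = x' i" for x x' using loc[of x x'] that by simp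
  qed
  then obtain L\<^sub>1 where L\<^sub>1: "compact L\<^sub>1" "\<forall>e>0. approximable L\<^sub>1 n ?R e" by blast
  have "\<exists>L. compact L \<and> (\<forall>e>0. approximable L n ?I e)"
  proof (rule dense_real[OF _ L\<^sub>0(1)])
    show "continuous_on UNIV (\<lambda>x. Im (?g x))" using cont by (rule continuous_on_Im)
    show "supported n L\<^sub>0 (\<lambda>x. Im (?g x))"
      unfolding supported_def
    proof (intro allI impI)
      fix x i assume "Im (?g x) \<noteq> 0" "i < n"
      then have "G (cfg x {..<n}) \<noteq> 0" by auto
      then show "x i \<in> L\<^sub>0" using L\<^sub>0(2) \<open>i < n\<close> unfolding supported_def by blast
    qed
    show "Im (?g x) = Im (?g x')" if "\<And>i. i < n \<Longrightarrow> x i = x' i" for x x' using loc[of x x'] that by simp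
  qed
  then obtain L\<^sub>2 where L\<^sub>2: "compact L\<^sub>2" "\<forall>e>0. approximable L\<^sub>2 n ?I e" by blast
  have "approximable (L\<^sub>1 \<union> L\<^sub>2) n (\<lambda>\<eta>. part n G (mset_set \<eta>)) e" if e: "e > 0" for e
  proof -
    have e2: "e / 2 > 0" using e by simp
    obtain H\<^sub>1 where H\<^sub>1: "H\<^sub>1 \<in> sspan A L\<^sub>1 n" "\<forall>\<eta>. finite \<eta> \<longrightarrow> norm (H\<^sub>1 (mset_set \<eta>) - ?R \<eta>) \<le> e / 2"
      using L\<^sub>1(2)[rule_format, OF e2] unfolding approximable_def by (elim bexE)
    obtain H\<^sub>2 where H\<^sub>2: "H\<^sub>2 \<in> sspan A L\<^sub>2 n" "\<forall>\<eta>. finite \<eta> \<longrightarrow> norm (H\<^sub>2 (mset_set \<eta>) - ?I \<eta>) \<le> e / 2"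
      using L\<^sub>2(2)[rule_format, OF e2] unfolding approximable_def by (elim bexE)
    have mem: "(\<lambda>\<eta>. H\<^sub>1 \<eta> + \<i> * H\<^sub>2 \<eta>) \<in> sspan A (L\<^sub>1 \<union> L\<^sub>2) n"
      by (rule sspan.add_scale[OF sspan_mono[OF H\<^sub>1(1)] sspan_mono[OF H\<^sub>2(1)]]) auto
    have "norm (H\<^sub>1 (mset_set \<eta>) + \<i> * H\<^sub>2 (mset_set \<eta>) - part n G (mset_set \<eta>)) \<le> e" if "finite \<eta>" for \<eta>
    proof -
      have "H\<^sub>1 (mset_set \<eta>) + \<i> * H\<^sub>2 (mset_set \<eta>) - part n G (mset_set \<eta>) =
          (H\<^sub>1 (mset_set \<eta>) - ?R \<eta>) + \<i> * (H\<^sub>2 (mset_set \<eta>) - ?I \<eta>)"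
        unfolding part[OF that] by (simp only: right_diff_distrib) simp
      also have "norm \<dots> \<le> norm (H\<^sub>1 (mset_set \<eta>) - ?R \<eta>) + norm (\<i> * (H\<^sub>2 (mset_set \<eta>) - ?I \<eta>))"
        by (rule norm_triangle_ineq)
      also have "\<dots> \<le> e / 2 + e / 2"
        using H\<^sub>1(2)[rule_format, OF that] H\<^sub>2(2)[rule_format, OF that]
        unfolding norm_mult norm_ii mult_1 by (rule add_mono)
      finally show ?thesis by simp
    qed
    then show ?thesis unfolding approximable_def by (intro bexI[OF _ mem] allI impI)
  qed
  then show ?thesis using compact_Un[OF L\<^sub>1(1) L\<^sub>2(1)] by blast
qed

end

section \<open>The space \<open>L\<^sup>2\<close>\<close>

lemma sq_integrable_mult:
  assumes "f \<in> sq_integrable M" "g \<in> sq_integrable M"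
  shows "integrable M (\<lambda>x. f x * cnj (g x))"
proof (rule Bochner_Integration.integrable_bound)
  show "integrable M (\<lambda>x. (cmod (f x))\<^sup>2 + (cmod (g x))\<^sup>2)"
    using assms by (auto simp: sq_integrable_def)
  have [measurable]: "f \<in> borel_measurable M" "g \<in> borel_measurable M" using assms by (auto simp: sq_integrable_def)
  show "(\<lambda>x. f x * cnj (g x)) \<in> borel_measurable M"
    by (intro borel_measurable_times borel_measurable_continuous_on[OF continuous_on_cnj[OF continuous_on_id]]) measurable
  have "cmod a * cmod b \<le> (cmod a)\<^sup>2 + (cmod b)\<^sup>2" for a b
  proof -
    have "0 \<le> cmod a * cmod b" by simp
    moreover have "2 * (cmod a * cmod b) \<le> (cmod a)\<^sup>2 + (cmod b)\<^sup>2"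
      using sum_squares_bound[of "cmod a" "cmod b"] by (simp only: mult.assoc)
    ultimately show ?thesis by linarith
  qed
  then show "AE x in M. norm (f x * cnj (g x)) \<le> norm ((cmod (f x))\<^sup>2 + (cmod (g x))\<^sup>2)"
    by (simp add: norm_mult)
qed

lemma sq_integrable_add:
  assumes "f \<in> sq_integrable M" "g \<in> sq_integrable M"
  shows "(\<lambda>x. f x + g x) \<in> sq_integrable M"
proof -
  have [measurable]: "f \<in> borel_measurable M" "g \<in> borel_measurable M" using assms by (auto simp: sq_integrable_def)
  have "integrable M (\<lambda>x. (cmod (f x + g x))\<^sup>2)"
  proof (rule Bochner_Integration.integrable_bound)
    show "integrable M (\<lambda>x. 2 * (cmod (f x))\<^sup>2 + 2 * (cmod (g x))\<^sup>2)"
      using assms by (auto simp: sq_integrable_def)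
    have "(cmod (a + b))\<^sup>2 \<le> 2 * (cmod a)\<^sup>2 + 2 * (cmod b)\<^sup>2" for a b
    proof -
      have "(cmod (a + b))\<^sup>2 \<le> (cmod a + cmod b)\<^sup>2" by (intro power_mono norm_triangle_ineq) simp
      also have "\<dots> \<le> 2 * (cmod a)\<^sup>2 + 2 * (cmod b)\<^sup>2"
        using sum_squares_bound[of "cmod a" "cmod b"] by (simp add: power2_sum)
      finally show ?thesis .
    qed
    then show "AE x in M. norm ((cmod (f x + g x))\<^sup>2) \<le> norm (2 * (cmod (f x))\<^sup>2 + 2 * (cmod (g x))\<^sup>2)" by simp
  qed measurable
  then show ?thesis by (simp add: sq_integrable_def)
qed

lemma L2_ip_self: "L2_ip M f f = complex_of_real (\<integral>x. (cmod (f x))\<^sup>2 \<partial>M)"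
  unfolding L2_ip_def complex_norm_square[symmetric] by (rule integral_complex_of_real)

lemma semi_ip_L2: "semi_ip (sq_integrable M) (L2_ip M)"
proof
  fix f g h :: "'a \<Rightarrow> complex" and c
  assume f: "f \<in> sq_integrable M" and g: "g \<in> sq_integrable M"
  show "(\<lambda>x. f x + g x) \<in> sq_integrable M" by (rule sq_integrable_add[OF f g])
  show "L2_ip M (\<lambda>x. c * f x) g = c * L2_ip M f g" by (simp add: L2_ip_def mult.assoc)
  show "L2_ip M f (\<lambda>x. c * g x) = cnj c * L2_ip M f g" by (simp add: L2_ip_def mult.left_commute)
  assume h: "h \<in> sq_integrable M"
  show "L2_ip M (\<lambda>x. f x + g x) h = L2_ip M f h + L2_ip M g h"
    unfolding L2_ip_def distrib_right
    by (rule Bochner_Integration.integral_add[OF sq_integrable_mult[OF f h] sq_integrable_mult[OF g h]])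
  show "L2_ip M h (\<lambda>x. f x + g x) = L2_ip M h f + L2_ip M h g"
    unfolding L2_ip_def complex_cnj_add distrib_left
    by (rule Bochner_Integration.integral_add[OF sq_integrable_mult[OF h f] sq_integrable_mult[OF h g]])
next
  fix f :: "'a \<Rightarrow> complex" and c assume f: "f \<in> sq_integrable M"
  then show "(\<lambda>x. c * f x) \<in> sq_integrable M"
    by (auto simp: sq_integrable_def norm_mult power_mult_distrib)
  show "L2_ip M f f \<in> \<real>\<^sub>\<ge>\<^sub>0" unfolding L2_ip_self by (simp add: complex_nonneg_Reals_iff)
qed (simp add: sq_integrable_def)

lemma L2_null:
  assumes "f \<in> sq_integrable M" "L2_ip M f f = 0"
  shows "AE x in M. f x = 0"
proof -
  have "(\<integral>x. (cmod (f x))\<^sup>2 \<partial>M) = 0" using assms(2) by (simp add: L2_ip_self)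
  then have "AE x in M. (cmod (f x))\<^sup>2 = 0"
    using assms(1) by (subst (asm) integral_nonneg_eq_0_iff_AE) (auto simp: sq_integrable_def)
  then show ?thesis by eventually_elim simp
qed

lemma mem_L2_class_AE:
  assumes "f \<in> sq_integrable M" "g \<in> L2_class M f"
  shows "g \<in> sq_integrable M" "AE x in M. g x = f x"
proof -
  interpret semi_ip "sq_integrable M" "L2_ip M" by (rule semi_ip_L2)
  show g: "g \<in> sq_integrable M" using assms(2) by (simp add: L2_class_def qclass_def)
  have "AE x in M. g x - f x = 0"
    using L2_null[OF V_diff[OF g assms(1)]] assms(2) by (simp add: L2_class_def qclass_def)
  then show "AE x in M. g x = f x" by eventually_elim simp
qed

lemma self_mem_L2_class: "f \<in> sq_integrable M \<Longrightarrow> f \<in> L2_class M f"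
  unfolding L2_class_def by (rule semi_ip.self_mem_q[OF semi_ip_L2])

section \<open>Exhaustion and open sets of configurations\<close>

text \<open>The bumps give every point an open neighbourhood inside a compact set; by Lindelof
  countably many such neighbourhoods cover the manifold.\<close>

lemma compact_exhaustion:
  fixes A :: "('a::{t2_space, second_countable_topology}, 'd::finite) chart set"
  assumes A: "smooth_atlas A"
  shows "\<exists>(V :: nat \<Rightarrow> 'a set) L. (\<forall>i. open (V i) \<and> compact (L i) \<and> V i \<subseteq> L i) \<and> (\<Union>i. V i) = UNIV"
proof -
  let ?F = "{V :: 'a set. open V \<and> (\<exists>L. compact L \<and> V \<subseteq> L)}"
  have cov: "\<Union>?F = UNIV"
  proof (intro equalityI subsetI)
    fix x :: 'a
    from exists_bump[OF A open_UNIV UNIV_I, of x] obtain \<phi> L where \<phi>: "\<phi> \<in> test_fun A" "0 < \<phi> x"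
      "compact L" "\<forall>z. \<phi> z \<noteq> 0 \<longrightarrow> z \<in> L" by blast
    have "open {z. 0 < \<phi> z}"
      using test_fun_continuous[OF A \<phi>(1)] by (intro open_Collect_less continuous_on_const)
    moreover have "{z. 0 < \<phi> z} \<subseteq> L" using \<phi>(4) by auto
    ultimately show "x \<in> \<Union>?F" using \<phi>(2,3) by (intro UnionI[of "{z. 0 < \<phi> z}"]) auto
  qed simp
  obtain F' where F': "F' \<subseteq> ?F" "countable F'" "\<Union>F' = \<Union>?F" by (rule Lindelof[of ?F]) auto
  \<comment> \<open>The empty set is inserted so that a nonempty set is enumerated.\<close>
  define V where "V = from_nat_into (insert {} F')"
  have ran: "range V = insert {} F'" unfolding V_def using F'(2) by (intro range_from_nat_into) auto
  have "\<exists>L. open (V i) \<and> compact L \<and> V i \<subseteq> L" for i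
  proof -
    have "V i \<in> insert {} F'" using ran by auto
    then show ?thesis using F'(1) by auto
  qed
  then obtain L where "\<forall>i. open (V i) \<and> compact (L i) \<and> V i \<subseteq> L i" by metis
  moreover have "(\<Union>i. V i) = UNIV" unfolding ran using F'(3) cov by simp
  ultimately show ?thesis by blast
qed

text \<open>An infinite \<open>\<eta>\<close> contributes only the value at the empty configuration, as \<open>mset_set \<eta> = {#}\<close>.\<close>

definition unit_fun :: "('a multiset \<Rightarrow> complex) \<Rightarrow> bool" where
  "unit_fun G \<longleftrightarrow> (\<forall>\<eta>. Im (G (mset_set \<eta>)) = 0 \<and> 0 \<le> Re (G (mset_set \<eta>)) \<and> Re (G (mset_set \<eta>)) \<le> 1)"

text \<open>Around an enumeration of \<open>\<eta>\<^sub>0\<close> the lifted open set contains a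
  box; take the symmetrised product of bumps inside its sides. If it is nonzero at
  \<open>\<eta>\<close>, then some ordering of \<open>\<eta>\<close> lies in the box, hence
  \<open>\<eta>\<close> in \<open>U\<close>.\<close>

lemma conf_bump:
  fixes A :: "('a::t2_space, 'd::finite) chart set"
  assumes A: "smooth_atlas A" and U: "openin conf_topology U" and "\<eta>\<^sub>0 \<in> U"
  shows "\<exists>G\<in>F_fin A. unit_fun G \<and> (\<forall>\<eta>. finite \<eta> \<longrightarrow> G (mset_set \<eta>) \<noteq> 0 \<longrightarrow> \<eta> \<in> U) \<and> 0 < Re (G (mset_set \<eta>\<^sub>0))"
proof -
  obtain V where V: "openin mconf_topology V" "U = mset_set -` V \<inter> {\<eta>. finite \<eta>}"
    using U unfolding openin_conf_topology by blast
  have fin: "finite \<eta>\<^sub>0" "mset_set \<eta>\<^sub>0 \<in> V" using \<open>\<eta>\<^sub>0 \<in> U\<close> V(2) by auto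
  obtain xs where xs: "set xs = \<eta>\<^sub>0" "distinct xs" using finite_distinct_list[OF fin(1)] by blast
  let ?n = "length xs" and ?x = "\<lambda>i. xs ! i"
  have mset_xs: "mset xs = mset_set \<eta>\<^sub>0" using xs mset_set_set[of xs] by simp
  let ?O = "{x. cfg x {..<?n} \<in> V}"
  have "openin (product_topology (\<lambda>i::nat. euclidean) UNIV) ?O"
    using V(1) unfolding openin_mconf_topology open_fun_def by blast
  moreover have "?x \<in> ?O" using fin(2) by (simp add: cfg_nth mset_xs)
  ultimately have "\<exists>X. ?x \<in> PiE UNIV X \<and> (\<forall>i. openin euclidean (X i)) \<and>
      finite {i. X i \<noteq> topspace euclidean} \<and> PiE UNIV X \<subseteq> ?O"
    by (rule product_topology_open_contains_basis)
  then obtain X where "?x \<in> PiE UNIV X" "\<forall>i. openin euclidean (X i)" "PiE UNIV X \<subseteq> ?O"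
    by (elim exE conjE) (rule that)
  then have X: "\<And>i. ?x i \<in> X i" "\<And>i. open (X i)" "\<And>y. (\<And>i. y i \<in> X i) \<Longrightarrow> cfg y {..<?n} \<in> V"
    by (auto simp: PiE_iff subset_iff)
  have box: "cfg y {..<?n} \<in> V" if "\<And>i. i < ?n \<Longrightarrow> y i \<in> X i" for y
  proof -
    \<comment> \<open>The box also constrains the coordinates from \<open>?n\<close> on, which
      \<open>cfg\<close> ignores; there the values of \<open>?x\<close> are inserted.\<close>
    let ?y = "\<lambda>i. if i < ?n then y i else ?x i"
    have "cfg ?y {..<?n} \<in> V" by (rule X(3)) (use that X(1) in simp)
    moreover have "cfg ?y {..<?n} = cfg y {..<?n}" by (rule cfg_cong) simp
    ultimately show ?thesis by simp
  qed
  have "\<forall>i. \<exists>\<phi>\<in>test_fun A. (\<forall>z. \<phi> z \<ge> 0) \<and> \<phi> (?x i) > 0 \<and> (\<forall>z. \<phi> z \<noteq> 0 \<longrightarrow> z \<in> X i)"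
  proof
    fix i
    from exists_bump[OF A X(2) X(1), of i]
    show "\<exists>\<phi>\<in>test_fun A. (\<forall>z. \<phi> z \<ge> 0) \<and> \<phi> (?x i) > 0 \<and> (\<forall>z. \<phi> z \<noteq> 0 \<longrightarrow> z \<in> X i)" by blast
  qed
  then obtain \<phi> where \<phi>: "\<And>i. \<phi> i \<in> test_fun A" "\<And>i z. 0 \<le> \<phi> i z" "\<And>i. 0 < \<phi> i (?x i)"
    "\<And>i z. \<phi> i z \<noteq> 0 \<Longrightarrow> z \<in> X i" by metis
  let ?ps = "map \<phi> [0..<?n]"
  have S: "sfun ?ps \<in> F_fin A" by (rule sfun_F_fin[OF A]) (use \<phi>(1) in auto)
  obtain B where B: "\<forall>\<eta>. norm (sfun ?ps \<eta>) \<le> B" using F_fin_bounded[OF A S] by blast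
  \<comment> \<open>Division by \<open>c\<close> brings the values to at most \<open>1\<close>; the
    maximum keeps the divisor positive.\<close>
  define c where "c = max B 1"
  have c: "c > 0" "\<And>\<eta>. norm (sfun ?ps \<eta>) \<le> c" using B by (auto simp: c_def le_max_iff_disj)
  have prodl: "prodl ?ps ys = (\<Prod>i<?n. \<phi> i (ys ! i))" if "length ys = ?n" for ys
    using that by (simp add: prodl_nth)
  have nonneg: "0 \<le> prodl ?ps ys" if "length ys = ?n" for ys
    unfolding prodl[OF that] using \<phi>(2) by (intro prod_nonneg) auto
  define s where "s \<eta> = (if card \<eta> = ?n then \<Sum>ys\<in>permutations_of_set \<eta>. prodl ?ps ys else 0)" for \<eta>
  have s: "sfun ?ps (mset_set \<eta>) = complex_of_real (s \<eta>)" if "finite \<eta>" for \<eta>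
    using sfun_mset_set[OF that, of ?ps] by (simp add: s_def)
  have s0: "0 \<le> s \<eta>" for \<eta>
    unfolding s_def using nonneg length_finite_permutations_of_set[of _ \<eta>] by (auto intro!: sum_nonneg)
  have s_le: "s \<eta> \<le> c" if "finite \<eta>" for \<eta> using c(2)[of "mset_set \<eta>"] s0[of \<eta>] by (simp add: s[OF that])
  let ?G = "\<lambda>\<eta>. complex_of_real (1 / c) * sfun ?ps \<eta>"
  have G: "?G (mset_set \<eta>) = complex_of_real (s (if finite \<eta> then \<eta> else {}) / c)" for \<eta>
    using s[of \<eta>] s[of "{}"] by simp
  have "?G \<in> F_fin A" by (rule F_fin_scale[OF A S])
  moreover have "unit_fun ?G" unfolding unit_fun_def G using c(1) s0 s_le by auto
  moreover have "\<eta> \<in> U" if \<eta>: "finite \<eta>" "?G (mset_set \<eta>) \<noteq> 0" for \<eta>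
  proof -
    have "s \<eta> \<noteq> 0" using \<eta>(2) s[OF \<eta>(1)] by auto
    then obtain ys where ys: "card \<eta> = ?n" "ys \<in> permutations_of_set \<eta>" "prodl ?ps ys \<noteq> 0"
      unfolding s_def by (metis (no_types, lifting) sum.neutral)
    have len: "length ys = ?n" using length_finite_permutations_of_set[OF ys(2)] ys(1) by simp
    have "ys ! i \<in> X i" if "i < ?n" for i
      using ys(3) that \<phi>(4)[of i "ys ! i"] unfolding prodl[OF len] by auto
    then have "mset ys \<in> V" using box[of "\<lambda>i. ys ! i"] cfg_nth[of ys] len by simp
    moreover have "mset ys = mset_set \<eta>" using permutations_of_setD[OF ys(2)] mset_set_set[of ys] by simp
    ultimately show ?thesis using V(2) \<eta>(1) by simp
  qed
  moreover have "0 < Re (?G (mset_set \<eta>\<^sub>0))"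
  proof -
    have "card \<eta>\<^sub>0 = ?n" using xs distinct_card by fastforce
    moreover have "0 < (\<Sum>ys\<in>permutations_of_set \<eta>\<^sub>0. prodl ?ps ys)"
    proof (rule sum_pos2[of _ xs])
      show "xs \<in> permutations_of_set \<eta>\<^sub>0" using xs by auto
      show "0 < prodl ?ps xs" unfolding prodl[OF refl] using \<phi>(3) by (intro prod_pos) auto
      show "0 \<le> prodl ?ps ys" if "ys \<in> permutations_of_set \<eta>\<^sub>0" for ys
        using length_finite_permutations_of_set[OF that] \<open>card \<eta>\<^sub>0 = ?n\<close> by (intro nonneg) simp
    qed simp
    ultimately show ?thesis unfolding G using c(1) fin(1) by (simp add: s_def)
  qed
  ultimately show ?thesis by blast
qed

text \<open>Lindelof is applied to the tuples of each length separately, whose space inherits second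
  countability from the manifold; the countably many countable families are then merged.\<close>

lemma conf_open_cover:
  fixes A :: "('a::{t2_space, second_countable_topology}, 'd::finite) chart set"
  assumes A: "smooth_atlas A" and U: "openin conf_topology U"
  shows "\<exists>G :: nat \<Rightarrow> 'a multiset \<Rightarrow> complex. (\<forall>i. G i \<in> F_fin A \<and> unit_fun (G i) \<and>
      (\<forall>\<eta>. finite \<eta> \<longrightarrow> \<eta> \<notin> U \<longrightarrow> G i (mset_set \<eta>) = 0)) \<and>
    (\<forall>\<eta>\<in>U. \<exists>i. 0 < Re (G i (mset_set \<eta>)))"
proof -
  have "\<forall>\<zeta>\<in>U. \<exists>G. G \<in> F_fin A \<and> unit_fun G \<and> (\<forall>\<eta>. finite \<eta> \<longrightarrow> G (mset_set \<eta>) \<noteq> 0 \<longrightarrow> \<eta> \<in> U) \<and>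
      0 < Re (G (mset_set \<zeta>))"
    using conf_bump[OF A U] by blast
  from bchoice[OF this] obtain g where g: "\<forall>\<zeta>\<in>U. g \<zeta> \<in> F_fin A \<and> unit_fun (g \<zeta>) \<and>
      (\<forall>\<eta>. finite \<eta> \<longrightarrow> g \<zeta> (mset_set \<eta>) \<noteq> 0 \<longrightarrow> \<eta> \<in> U) \<and> 0 < Re (g \<zeta> (mset_set \<zeta>))" by blast
  have fin: "finite \<eta>" if "\<eta> \<in> U" for \<eta> using U that unfolding openin_conf_topology by auto
  let ?S = "\<lambda>n \<zeta>. {x. 0 < Re (g \<zeta> (cfg x {..<n}))}"
  have "\<exists>C. C \<subseteq> U \<and> countable C \<and> (\<Union>\<zeta>\<in>C. ?S n \<zeta>) = (\<Union>\<zeta>\<in>U. ?S n \<zeta>)" for n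
  proof -
    have op: "open S" if "S \<in> ?S n ` U" for S
    proof -
      obtain \<zeta> where \<zeta>: "\<zeta> \<in> U" "S = ?S n \<zeta>" using \<open>S \<in> ?S n ` U\<close> by blast
      have "continuous_on UNIV (\<lambda>x. g \<zeta> (cfg x {..<n}))"
        using F_fin_mset_cont[OF A, of "g \<zeta>"] g \<zeta>(1) by (simp add: mset_cont_def)
      then show ?thesis unfolding \<zeta>(2) by (intro open_Collect_less continuous_on_const continuous_on_Re)
    qed
    obtain F' where F': "F' \<subseteq> ?S n ` U" "countable F'" "\<Union>F' = \<Union>(?S n ` U)"
      by (rule Lindelof[of "?S n ` U"]) (use op in auto)
    obtain C where "C \<subseteq> U" "countable C" "F' = ?S n ` C"
      using F'(1,2) countable_subset_image[of F' "?S n" U] by blast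
    then show ?thesis using F'(3) by (intro exI[of _ C]) simp
  qed
  then obtain C where C: "\<And>n. C n \<subseteq> U" "\<And>n. countable (C n)" "\<And>n. (\<Union>\<zeta>\<in>C n. ?S n \<zeta>) = (\<Union>\<zeta>\<in>U. ?S n \<zeta>)"
    by metis
  let ?D = "insert (\<lambda>_. 0) (g ` (\<Union>n. C n))"
  have D: "countable ?D" using C(2) by auto
  define G where "G = from_nat_into ?D"
  have ran: "range G = ?D" unfolding G_def using D by (intro range_from_nat_into) auto
  have good: "G i \<in> F_fin A \<and> unit_fun (G i) \<and> (\<forall>\<eta>. finite \<eta> \<longrightarrow> \<eta> \<notin> U \<longrightarrow> G i (mset_set \<eta>) = 0)" for i
  proof -
    have "G i \<in> ?D" using ran by auto
    then consider "G i = (\<lambda>_. 0)" | \<zeta> where "\<zeta> \<in> U" "G i = g \<zeta>" using C(1) by auto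
    then show ?thesis
    proof cases
      case 1
      then show ?thesis using F_fin_zero[OF A] by (simp add: unit_fun_def)
    next
      case 2
      then show ?thesis using g by auto
    qed
  qed
  have pos: "\<exists>i. 0 < Re (G i (mset_set \<eta>))" if "\<eta> \<in> U" for \<eta>
  proof -
    obtain x where x: "cfg x {..<card \<eta>} = mset_set \<eta>" using exists_enum[of "mset_set \<eta>"] by auto
    have "x \<in> ?S (card \<eta>) \<eta>" using g that x by simp
    then have "x \<in> (\<Union>\<zeta>\<in>C (card \<eta>). ?S (card \<eta>) \<zeta>)" unfolding C(3) using that by blast
    then obtain \<zeta> where \<zeta>: "\<zeta> \<in> C (card \<eta>)" "0 < Re (g \<zeta> (mset_set \<eta>))" using x by auto
    then have "g \<zeta> \<in> range G" unfolding ran by blast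
    then show ?thesis using \<zeta>(2) by auto
  qed
  show ?thesis using good pos by (intro exI[of _ G]) blast
qed

text \<open>The partial products \<open>\<Prod>i<k. (1 - G i) ^ k\<close> decrease to the indicator of the complement of \<open>U\<close>.\<close>

lemma conf_open_approx:
  fixes A :: "('a::{t2_space, second_countable_topology}, 'd::finite) chart set"
  assumes A: "smooth_atlas A" and U: "openin conf_topology U"
  shows "\<exists>F. (\<forall>k. F k \<in> F_fin A) \<and> (\<forall>k. unit_fun (F k)) \<and> (\<forall>\<eta>. incseq (\<lambda>k. Re (F k (mset_set \<eta>)))) \<and>
    (\<forall>\<eta>. finite \<eta> \<longrightarrow> (\<lambda>k. Re (F k (mset_set \<eta>))) \<longlonglongrightarrow> indicator U \<eta>)"
proof -
  from conf_open_cover[OF A U] obtain G :: "nat \<Rightarrow> 'a multiset \<Rightarrow> complex" where *: "\<forall>i. G i \<in> F_fin A \<and> unit_fun (G i) \<and>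
      (\<forall>\<eta>. finite \<eta> \<longrightarrow> \<eta> \<notin> U \<longrightarrow> G i (mset_set \<eta>) = 0)"
    "\<forall>\<eta>\<in>U. \<exists>i. 0 < Re (G i (mset_set \<eta>))" by (elim exE conjE) (rule that)
  have G: "\<And>i. G i \<in> F_fin A" "\<And>i. unit_fun (G i)"
    "\<And>i \<eta>. finite \<eta> \<Longrightarrow> \<eta> \<notin> U \<Longrightarrow> G i (mset_set \<eta>) = 0"
    "\<And>\<eta>. \<eta> \<in> U \<Longrightarrow> \<exists>i. 0 < Re (G i (mset_set \<eta>))"
    using * by simp_all
  \<comment> \<open>Functions that differ from \<open>1\<close> by an element of
    \<open>F_fin\<close>. Products stay in the class because \<open>1 - f f'\<close> equals
    \<open>(1 - f) + (1 - f') - (1 - f) (1 - f')\<close>.\<close>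
  let ?D = "{f. (\<lambda>\<eta>. 1 - f \<eta>) \<in> F_fin A}"
  have one: "(\<lambda>_. 1) \<in> ?D" using F_fin_zero[OF A] by simp
  have mult: "(\<lambda>\<eta>. f \<eta> * f' \<eta>) \<in> ?D" if "f \<in> ?D" "f' \<in> ?D" for f f'
  proof -
    have f: "(\<lambda>\<eta>. 1 - f \<eta>) \<in> F_fin A" "(\<lambda>\<eta>. 1 - f' \<eta>) \<in> F_fin A" using that by auto
    have "(\<lambda>\<eta>. ((1 - f \<eta>) + (1 - f' \<eta>)) - (1 - f \<eta>) * (1 - f' \<eta>)) \<in> F_fin A"
      by (rule F_fin_diff[OF A F_fin_add[OF A f] F_fin_mult[OF A f]])
    then show ?thesis by (simp add: algebra_simps)
  qed
  have pow: "(\<lambda>\<eta>. f \<eta> ^ k) \<in> ?D" if "f \<in> ?D" for f k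
  proof (induction k)
    case 0
    then show ?case using one by simp
  next
    case (Suc k)
    then show ?case using mult[OF that Suc] by simp
  qed
  have prod: "(\<lambda>\<eta>. \<Prod>i<m. f i \<eta>) \<in> ?D" if "\<And>i. f i \<in> ?D" for f and m :: nat
  proof (induction m)
    case 0
    then show ?case using one by simp
  next
    case (Suc m)
    then show ?case using mult[OF Suc that[of m]] by simp
  qed
  \<comment> \<open>One index governs both the number of factors and the exponent: the first brings
    in every \<open>G i\<close>, the second drives a factor below \<open>1\<close> to
    \<open>0\<close>.\<close>
  define F where "F k \<eta> = 1 - (\<Prod>i<k. (1 - G i \<eta>) ^ k)" for k \<eta>
  have F: "F k \<in> F_fin A" for k
  proof -
    have "(\<lambda>\<eta>. 1 - G i \<eta>) \<in> ?D" for i using G(1) by simp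
    then have "(\<lambda>\<eta>. \<Prod>i<k. (1 - G i \<eta>) ^ k) \<in> ?D" by (intro prod pow)
    then show ?thesis by (simp add: F_def[abs_def])
  qed
  let ?h = "\<lambda>i \<eta>. 1 - Re (G i (mset_set \<eta>))"
  have h01: "0 \<le> ?h i \<eta>" "?h i \<eta> \<le> 1" for i \<eta> using G(2)[of i] by (auto simp: unit_fun_def)
  have Fre: "F k (mset_set \<eta>) = complex_of_real (1 - (\<Prod>i<k. ?h i \<eta> ^ k))" for k \<eta>
  proof -
    have "G i (mset_set \<eta>) = complex_of_real (Re (G i (mset_set \<eta>)))" for i
      using G(2)[of i] by (simp add: unit_fun_def complex_eq_iff)
    then have "1 - G i (mset_set \<eta>) = complex_of_real (?h i \<eta>)" for i by simp
    then show ?thesis by (simp only: F_def of_real_diff of_real_1 of_real_prod of_real_power)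
  qed
  have p01: "0 \<le> (\<Prod>i<k. ?h i \<eta> ^ m)" "(\<Prod>i<k. ?h i \<eta> ^ m) \<le> 1" for k m \<eta>
    using h01 by (auto intro!: prod_nonneg prod_le_1 power_le_one)
  have "unit_fun (F k)" for k using p01 by (auto simp: unit_fun_def Fre simp del: of_real_diff)
  moreover have "incseq (\<lambda>k. Re (F k (mset_set \<eta>)))" for \<eta>
  proof (rule incseq_SucI)
    fix k
    have "(\<Prod>i<Suc k. ?h i \<eta> ^ Suc k) \<le> (\<Prod>i<k. ?h i \<eta> ^ Suc k) * 1"
      unfolding prod.lessThan_Suc using h01 p01 by (intro mult_left_mono power_le_one) (auto simp del: power_Suc)
    also have "\<dots> \<le> (\<Prod>i<k. ?h i \<eta> ^ k)"
      unfolding mult_1_right using h01 by (intro prod_mono conjI zero_le_power power_decreasing) auto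
    finally show "Re (F k (mset_set \<eta>)) \<le> Re (F (Suc k) (mset_set \<eta>))"
      unfolding Fre Re_complex_of_real by linarith
  qed
  moreover have "(\<lambda>k. Re (F k (mset_set \<eta>))) \<longlonglongrightarrow> indicator U \<eta>" if "finite \<eta>" for \<eta>
  proof (cases "\<eta> \<in> U")
    case True
    obtain j where j: "0 < Re (G j (mset_set \<eta>))" using G(4)[OF True] by blast
    have lim: "(\<lambda>k. ?h j \<eta> ^ k) \<longlonglongrightarrow> 0" using h01[of j \<eta>] j by (intro LIMSEQ_power_zero) auto
    have le: "(\<Prod>i<k. ?h i \<eta> ^ k) \<le> ?h j \<eta> ^ k" if "j < k" for k
    proof -
      have "(\<Prod>i<k. ?h i \<eta> ^ k) = ?h j \<eta> ^ k * (\<Prod>i\<in>{..<k} - {j}. ?h i \<eta> ^ k)"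
        using that by (intro prod.remove) auto
      also have "\<dots> \<le> ?h j \<eta> ^ k * 1"
        using h01 by (intro mult_left_mono prod_le_1 conjI zero_le_power power_le_one) auto
      finally show ?thesis by simp
    qed
    have "(\<lambda>k. \<Prod>i<k. ?h i \<eta> ^ k) \<longlonglongrightarrow> 0"
    proof (rule tendsto_sandwich[OF _ _ tendsto_const lim])
      show "\<forall>\<^sub>F k in sequentially. (\<Prod>i<k. ?h i \<eta> ^ k) \<le> ?h j \<eta> ^ k"
        using eventually_gt_at_top[of j] by eventually_elim (rule le)
    qed (use p01 in simp)
    then have "(\<lambda>k. 1 - (\<Prod>i<k. ?h i \<eta> ^ k)) \<longlonglongrightarrow> 1 - 0" by (intro tendsto_diff tendsto_const)
    then show ?thesis unfolding Fre Re_complex_of_real using True by simp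
  next
    case False
    then show ?thesis unfolding Fre Re_complex_of_real using G(3)[OF that] by simp
  qed
  ultimately show ?thesis using F by blast
qed

section \<open>Spectral measures\<close>

locale spectral_measure =
  fixes A :: "('a::{t2_space, second_countable_topology}, 'd::finite) chart set"
    and \<rho> :: "'a set measure"
    and \<mu> :: "(('a \<Rightarrow> real) \<Rightarrow> real) measure"
    and K :: "(nat \<Rightarrow> ('a multiset \<Rightarrow> complex) set) set \<Rightarrow> ((('a \<Rightarrow> real) \<Rightarrow> real) \<Rightarrow> complex) set"
  assumes A: "smooth_atlas A"
    and sets_rho: "sets \<rho> = sets conf_borel"
    and rho_empty: "emeasure \<rho> (nconf UNIV 0) = 1"
    and rho_bound: "\<And>\<Lambda> :: 'a set. compact \<Lambda> \<Longrightarrow> \<exists>C>0. \<forall>n. emeasure \<rho> (nconf \<Lambda> n) \<le> ennreal (C ^ n)"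
    and a_form_pos: "\<And>G. G \<in> F_fin A \<Longrightarrow> a_form \<rho> G (\<lambda>\<eta>. cnj (G \<eta>)) \<in> \<real>\<^sub>\<ge>\<^sub>0"
    and prob: "prob_space \<mu>"
    and unitary: "unitary_iso (H_rho A \<rho>) (L2 \<mu>) K"
    and K_hat: "\<And>G. G \<in> F_fin A \<Longrightarrow> wick_series A G \<in> sq_integrable \<mu> \<and>
           K (hat A \<rho> G) = L2_class \<mu> (wick_series A G)"
    and K_mult: "\<And>\<phi>. \<phi> \<in> test_fun A \<Longrightarrow>
           op_conj K (op_closure (H_rho A \<rho>) (A_op A \<rho> \<phi>)) = mult_op \<mu> (\<lambda>\<omega>. \<omega> \<phi>)"
    and full: "AE \<omega> in \<mu>. \<omega> \<in> dist_of A ` configs"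
begin

abbreviation form where
  "form \<equiv> \<lambda>G\<^sub>1 G\<^sub>2. a_form \<rho> G\<^sub>1 (\<lambda>\<eta>. cnj (G\<^sub>2 \<eta>))"

lemma F_fin_cc: "G \<in> F_fin A \<Longrightarrow> cc_fun G"
  by (rule F_fin_cc_fun[OF A])

sublocale F: semi_ip "F_fin A" form
proof
  fix G G' H and c :: complex
  assume G: "G \<in> F_fin A" and G': "G' \<in> F_fin A"
  show "(\<lambda>\<eta>. G \<eta> + G' \<eta>) \<in> F_fin A" by (rule F_fin_add[OF A G G'])
  show "form (\<lambda>\<eta>. c * G \<eta>) G' = c * form G G'" by (rule a_form_scale_left[OF sets_rho rho_bound])
  show "form G (\<lambda>\<eta>. c * G' \<eta>) = cnj c * form G G'"
    unfolding complex_cnj_mult by (rule a_form_scale_right[OF sets_rho rho_bound])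
  assume H: "H \<in> F_fin A"
  note cnj = F_fin_cc[OF F_fin_cnj[OF A]]
  show "form (\<lambda>\<eta>. G \<eta> + G' \<eta>) H = form G H + form G' H"
    by (rule a_form_add_left[OF sets_rho rho_bound F_fin_cc[OF G] F_fin_cc[OF G'] cnj[OF H]])
  show "form H (\<lambda>\<eta>. G \<eta> + G' \<eta>) = form H G + form H G'"
    unfolding complex_cnj_add by (rule a_form_add_right[OF sets_rho rho_bound cnj[OF G] cnj[OF G'] F_fin_cc[OF H]])
qed (auto intro: F_fin_zero[OF A] F_fin_scale[OF A] a_form_pos)

sublocale L: semi_ip "sq_integrable \<mu>" "L2_ip \<mu>"
  by (rule semi_ip_L2)

section \<open>Isometry, linearity and multiplication property of the Wick series\<close>

lemma H_rho_eq: "H_rho A \<rho> = F.H"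
  by (simp add: H_rho_def F_hat_def)

lemma hat_eq: "hat A \<rho> G = F.e G"
  by (simp add: hat_def F_hat_def)

abbreviation ws where "ws \<equiv> wick_series A"

lemma ws_sq: "G \<in> F_fin A \<Longrightarrow> ws G \<in> sq_integrable \<mu>"
  using K_hat by blast

lemma ws_measurable: "G \<in> F_fin A \<Longrightarrow> ws G \<in> borel_measurable \<mu>"
  using ws_sq by (auto simp: sq_integrable_def)

lemma K_e: "G \<in> F_fin A \<Longrightarrow> K (F.e G) = L.q (ws G)"
  using K_hat[of G] by (simp add: hat_eq L2_class_def)

lemma ws_ip:
  assumes "G \<in> F_fin A" "G' \<in> F_fin A"
  shows "L2_ip \<mu> (ws G) (ws G') = form G G'"
proof -
  have "vip (L2 \<mu>) (K (F.e G)) (K (F.e G')) = vip (H_rho A \<rho>) (F.e G) (F.e G')"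
    using unitary F.e_in_carr[OF assms(1)] F.e_in_carr[OF assms(2)]
    unfolding unitary_iso_def H_rho_eq by simp
  then show ?thesis
    unfolding K_e[OF assms(1)] K_e[OF assms(2)] H_rho_eq F.vip_H[OF assms] L2_def
    by (simp add: L.vip_Q ws_sq assms)
qed

text \<open>Pointwise linearity is not at hand, as the Wick powers come from a definite description.
  By the isometry the difference is orthogonal to every \<open>ws H\<close>, so to each of the three
  series it is made of, and therefore to itself.\<close>

lemma ws_add_scale:
  assumes G: "G \<in> F_fin A" and G': "G' \<in> F_fin A"
  shows "AE \<omega> in \<mu>. ws (\<lambda>\<eta>. G \<eta> + c * G' \<eta>) \<omega> = ws G \<omega> + c * ws G' \<omega>"
proof -
  let ?S = "\<lambda>\<eta>. G \<eta> + c * G' \<eta>"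
  have cG': "(\<lambda>\<eta>. c * G' \<eta>) \<in> F_fin A" by (rule F.V_scale[OF G'])
  have S: "?S \<in> F_fin A" by (rule F.V_add[OF G cG'])
  have W: "(\<lambda>\<omega>. ws G \<omega> + c * ws G' \<omega>) \<in> sq_integrable \<mu>"
    by (rule L.V_add[OF ws_sq[OF G] L.V_scale[OF ws_sq[OF G']]])
  let ?D = "\<lambda>\<omega>. ws ?S \<omega> - (ws G \<omega> + c * ws G' \<omega>)"
  have D: "?D \<in> sq_integrable \<mu>" by (rule L.V_diff[OF ws_sq[OF S] W])
  have orth: "L2_ip \<mu> ?D (ws H) = 0" if "H \<in> F_fin A" for H
    using G G' S that W cG' ws_sq L.V_scale[of "ws G'" c]
    by (simp add: L.s_diff_left L.s_add_left L.s_scale_left ws_ip F.s_add_left F.s_scale_left)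
  have "L2_ip \<mu> ?D ?D = L2_ip \<mu> ?D (ws ?S) - (L2_ip \<mu> ?D (ws G) + cnj c * L2_ip \<mu> ?D (ws G'))"
    using D ws_sq[OF S] ws_sq[OF G] ws_sq[OF G'] W L.V_scale[of "ws G'" c]
    by (simp add: L.s_diff_right L.s_add_right L.s_scale_right)
  also have "\<dots> = 0" using orth G G' S by simp
  finally have "AE \<omega> in \<mu>. ?D \<omega> = 0" by (rule L2_null[OF D])
  then show ?thesis by eventually_elim simp
qed

lemma ws_zero: "AE \<omega> in \<mu>. ws (\<lambda>_. 0) \<omega> = 0"
  by (rule L2_null[OF ws_sq[OF F.V_zero]])
    (use ws_ip[OF F.V_zero F.V_zero] F.s_scale_left[OF F.V_zero F.V_zero, of 0] in simp)

lemma one_mset_set: "finite \<eta> \<Longrightarrow> one_fun (mset_set \<eta>) = (if \<eta> = {} then 1 else 0)"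
  by (simp add: one_fun_def mset_set_empty_iff)

text \<open>The unit is real and neutral for \<open>\<star>\<close>, so pairing with it is
  integration against \<open>\<rho>\<close>.\<close>

lemma form_one: "G \<in> F_fin A \<Longrightarrow> form G one_fun = (\<integral>\<eta>. G (mset_set \<eta>) \<partial>\<rho>)"
proof -
  have cnj: "(\<lambda>\<eta>. cnj (one_fun \<eta>)) = one_fun" by (auto simp: one_fun_def)
  show "form G one_fun = (\<integral>\<eta>. G (mset_set \<eta>) \<partial>\<rho>)" unfolding cnj a_form_def conv_one ..
qed

lemma form_one_one: "form one_fun one_fun = 1"
proof -
  have "form one_fun one_fun = (\<integral>\<eta>. one_fun (mset_set \<eta>) \<partial>\<rho>)" by (rule form_one[OF one_F_fin[OF A]])
  also have "\<dots> = (\<integral>\<eta>. complex_of_real (indicator (nconf UNIV 0) \<eta>) \<partial>\<rho>)"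
    by (intro Bochner_Integration.integral_cong refl)
      (auto simp: one_mset_set space_rho[OF sets_rho rho_bound] nconf_def indicator_def)
  also have "\<dots> = measure \<rho> (nconf UNIV 0)"
  proof -
    have "nconf UNIV 0 \<in> sets \<rho>" unfolding sets_rho by (rule nconf_closed) simp
    then show ?thesis unfolding integral_complex_of_real by simp
  qed
  also have "measure \<rho> (nconf UNIV 0) = 1" by (simp add: measure_def rho_empty)
  finally show ?thesis by simp
qed

text \<open>The Wick powers of degree at least \<open>2\<close> are only known through a definite description, so a
  priori they need not even vanish at \<open>0\<close>, and the series need not converge.  Comparing the
  series of \<open>1\<close> with that of \<open>0\<close> gives \<open>K 1 \<in> {0, 1}\<close>, and \<open>\<parallel>K 1\<parallel> = 1\<close> excludes \<open>0\<close>.\<close>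

lemma ws_one_cases: "ws one_fun \<omega> = ws (\<lambda>_. 0) \<omega> + 1 \<or> ws one_fun \<omega> = ws (\<lambda>_. 0) \<omega>"
proof -
  let ?a = "\<lambda>n. pairing (part n (one_fun :: 'a multiset \<Rightarrow> complex)) (wick A \<omega> n)"
  let ?b = "\<lambda>n. pairing (part n (\<lambda>_ :: 'a multiset. 0 :: complex)) (wick A \<omega> n)"
  have part_one: "part n (one_fun :: 'a multiset \<Rightarrow> complex) = (if n = 0 then one_fun else (\<lambda>_. 0))" for n
    by (auto simp: part_def one_fun_def fun_eq_iff)
  have part_zero: "part n (\<lambda>_ :: 'a multiset. 0 :: complex) = (\<lambda>_. 0)" for n by (auto simp: part_def)
  have "(\<lambda>x. Re (one_fun (cfg x {..<0::nat}))) \<in> test_power A 0"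
    using one_F_fin[OF A] test_power_linear[OF A _ bounded_linear_Re] unfolding F_fin_iff by blast
  then have re: "(\<lambda>\<eta>. Re (one_fun \<eta>)) \<in> sym_test A 0" by (auto simp: sym_test_def one_fun_def)
  have zero: "(\<lambda>_. 0 :: real) \<in> sym_test A 0" by (simp add: sym_test_def test_power_zero[OF A])
  have im: "(\<lambda>\<eta> :: 'a multiset. Im (one_fun \<eta>)) = (\<lambda>_. 0)" by (auto simp: one_fun_def)
  have a0: "?a 0 = 1" using re zero by (simp add: part_one pairing_def im complex_eq_iff) (simp add: one_fun_def)
  have b0: "?b 0 = 0" using zero by (simp add: part_zero pairing_def complex_eq_iff)
  have ab: "?a = (\<lambda>n. ?b n + (if n = 0 then 1 else 0))"
  proof
    fix n show "?a n = ?b n + (if n = 0 then 1 else 0)"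
      by (cases n) (use a0 b0 in \<open>simp_all add: part_one part_zero\<close>)
  qed
  have d: "(\<lambda>n::nat. if n = 0 then 1 else 0 :: complex) sums 1"
    using sums_single[of 0 "\<lambda>_. 1 :: complex"] by simp
  show ?thesis
  proof (cases "summable ?b")
    case True
    have "suminf ?a = suminf ?b + 1"
      unfolding ab by (rule sums_unique[OF sums_add[OF summable_sums[OF True] d], symmetric])
    then show ?thesis by (simp add: wick_series_def)
  next
    case False
    have "\<not> summable ?a"
    proof
      assume "summable ?a"
      then have "summable (\<lambda>n. ?a n - (if n = 0 then 1 else 0))" by (intro summable_diff sums_summable[OF d])
      moreover have "?a n - (if n = 0 then 1 else 0) = ?b n" for n
        using fun_cong[OF ab, of n] by (simp only: add_diff_cancel_right')
      ultimately show False using False by (simp only:)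
    qed
    \<comment> \<open>Without summability each sum is a definite description over an unsatisfiable
      predicate; the predicates coincide, and so do the values.\<close>
    then have "(\<lambda>s. ?a sums s) = (\<lambda>s. ?b sums s)" using False by (auto simp: summable_def)
    then show ?thesis by (simp add: wick_series_def suminf_def)
  qed
qed

lemma ws_one: "AE \<omega> in \<mu>. ws one_fun \<omega> = 1"
proof -
  interpret prob_space \<mu> by (rule prob)
  have one: "one_fun \<in> F_fin A" by (rule one_F_fin[OF A])
  have cases: "AE \<omega> in \<mu>. ws one_fun \<omega> = 1 \<or> ws one_fun \<omega> = 0"
    using ws_zero
  proof eventually_elim
    case (elim \<omega>)
    then show ?case using ws_one_cases[of \<omega>] by auto
  qed
  have int: "integrable \<mu> (\<lambda>\<omega>. (cmod (ws one_fun \<omega>))\<^sup>2)" using ws_sq[OF one] by (simp add: sq_integrable_def)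
  have "(\<integral>\<omega>. (cmod (ws one_fun \<omega>))\<^sup>2 \<partial>\<mu>) = 1"
    using ws_ip[OF one one] unfolding L2_ip_self form_one_one by (simp only: of_real_eq_1_iff)
  \<comment> \<open>The image of the unit has norm one and \<open>\<mu>\<close> has total mass one,
    so a nonnegative integrand has integral zero; this excludes the value \<open>0\<close> almost
    everywhere.\<close>
  then have "(\<integral>\<omega>. 1 - (cmod (ws one_fun \<omega>))\<^sup>2 \<partial>\<mu>) = 0" using int by (simp add: prob_space)
  moreover have "AE \<omega> in \<mu>. 0 \<le> 1 - (cmod (ws one_fun \<omega>))\<^sup>2" using cases by eventually_elim auto
  moreover have "integrable \<mu> (\<lambda>\<omega>. 1 - (cmod (ws one_fun \<omega>))\<^sup>2)" using int by simp
  ultimately have "AE \<omega> in \<mu>. 1 - (cmod (ws one_fun \<omega>))\<^sup>2 = 0"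
    using integral_nonneg_eq_0_iff_AE by blast
  then show ?thesis using cases by eventually_elim auto
qed

text \<open>The classes of \<open>G\<close> and of its convolution with \<open>\<phi>\<close> form a
  pair in the graph of the operator, hence in its closure by constant sequences. The image under
  \<open>K\<close> lies in the graph of multiplication by \<open>\<omega> \<phi>\<close>, and equal
  classes mean equality almost everywhere.\<close>

lemma ws_conv:
  assumes \<phi>: "\<phi> \<in> test_fun A" and G: "G \<in> F_fin A"
  shows "AE \<omega> in \<mu>. ws (tensor_power (\<lambda>x. complex_of_real (\<phi> x)) 1 \<star> G) \<omega> = complex_of_real (\<omega> \<phi>) * ws G \<omega>"
proof -
  let ?C = "tensor_power (\<lambda>x. complex_of_real (\<phi> x)) 1 \<star> G"
  have C: "?C \<in> F_fin A" by (rule conv_test_F_fin[OF A \<phi> G])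
  have "(F.e G, F.e ?C) \<in> A_op A \<rho> \<phi>" unfolding A_op_def hat_eq using G by blast
  then have "\<exists>u v. (\<forall>n. (u n, v n) \<in> A_op A \<rho> \<phi>) \<and>
      (\<lambda>n. vdist F.H (u n) (F.e G)) \<longlonglongrightarrow> 0 \<and> (\<lambda>n. vdist F.H (v n) (F.e ?C)) \<longlonglongrightarrow> 0"
    using F.vdist_H_self[OF G] F.vdist_H_self[OF C]
    by (intro exI[of _ "\<lambda>_. F.e G"] exI[of _ "\<lambda>_. F.e ?C"]) simp
  then have "(F.e G, F.e ?C) \<in> op_closure (H_rho A \<rho>) (A_op A \<rho> \<phi>)"
    unfolding op_closure_def H_rho_eq using F.e_in_carr[OF G] F.e_in_carr[OF C] by simp
  then have "(K (F.e G), K (F.e ?C)) \<in> op_conj K (op_closure (H_rho A \<rho>) (A_op A \<rho> \<phi>))"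
    unfolding op_conj_def by (intro image_eqI[of _ _ "(F.e G, F.e ?C)"]) simp_all
  then have "(K (F.e G), K (F.e ?C)) \<in> mult_op \<mu> (\<lambda>\<omega>. \<omega> \<phi>)" unfolding K_mult[OF \<phi>] .
  then obtain f where f: "K (F.e G) = L2_class \<mu> f" "K (F.e ?C) = L2_class \<mu> (\<lambda>\<omega>. complex_of_real (\<omega> \<phi>) * f \<omega>)"
    "f \<in> sq_integrable \<mu>" "(\<lambda>\<omega>. complex_of_real (\<omega> \<phi>) * f \<omega>) \<in> sq_integrable \<mu>"
    unfolding mult_op_def by blast
  have "ws G \<in> L2_class \<mu> f" "ws ?C \<in> L2_class \<mu> (\<lambda>\<omega>. complex_of_real (\<omega> \<phi>) * f \<omega>)"
    using self_mem_L2_class[OF ws_sq[OF G]] self_mem_L2_class[OF ws_sq[OF C]] K_hat[OF G] K_hat[OF C] f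
    by (simp_all add: hat_eq)
  then have "AE \<omega> in \<mu>. ws G \<omega> = f \<omega>" "AE \<omega> in \<mu>. ws ?C \<omega> = complex_of_real (\<omega> \<phi>) * f \<omega>"
    using mem_L2_class_AE f(3,4) by blast+
  then show ?thesis by eventually_elim simp
qed

section \<open>Agreement of the Wick series with the K-transform\<close>

abbreviation conf where "conf \<equiv> config_of A"
abbreviation Conf where "Conf \<equiv> dist_of A ` configs"

lemma conf: "\<omega> \<in> Conf \<Longrightarrow> conf \<omega> \<in> configs" "\<omega> \<in> Conf \<Longrightarrow> dist_of A (conf \<omega>) = \<omega>"
  using config_of_dist_of[OF A] by auto

definition good :: "('a multiset \<Rightarrow> complex) \<Rightarrow> bool" where
  "good G \<longleftrightarrow> (AE \<omega> in \<mu>. ws G \<omega> = KT G (conf \<omega>))"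

lemma good_add_scale:
  assumes "G \<in> F_fin A" "G' \<in> F_fin A" "good G" "good G'"
  shows "good (\<lambda>\<eta>. G \<eta> + c * G' \<eta>)"
  using assms(3,4) ws_add_scale[OF assms(1,2), of c] full unfolding good_def
proof eventually_elim
  case (elim \<omega>)
  then show ?case using KT_add_scale[OF A assms(1,2) conf(1), of \<omega> c] by simp
qed

lemma good_sspan: "G \<in> sspan A L n \<Longrightarrow> good G"
proof (rule sspan_induct_algebra[OF A, where P = good])
  show "good one_fun" unfolding good_def KT_one by (rule ws_one)
  show "good (tensor_power (\<lambda>x. complex_of_real (\<phi> x)) 1 \<star> G)"
    if "\<phi> \<in> test_fun A" "G \<in> F_fin A" "good G" for \<phi> G
    using that(3) ws_conv[OF that(1,2)] full unfolding good_def
  proof eventually_elim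
    case (elim \<omega>)
    then show ?case using KT_conv_test[OF A that(1,2) conf(1)[of \<omega>]] conf(2)[of \<omega>] by simp
  qed
qed (use good_add_scale in auto)

lemma part_F_fin:
  assumes "G \<in> F_fin A"
  shows "part n G \<in> F_fin A"
  unfolding F_fin_iff
proof (intro conjI allI)
  fix m
  show "(\<lambda>x. part n G (cfg x {..<m})) \<in> test_power A m"
    using assms test_power_zero[OF A, of m] by (cases "m = n") (auto simp: part_def F_fin_iff)
qed (auto simp: part_def intro!: exI[of _ n])

text \<open>Approximants from the span have common support, so their Wick series converge in mean
  square, by the bound on the form and the isometry, and almost everywhere along a subsequence.
  Their K-transforms converge at every locally finite configuration, and the two limits must
  agree.\<close>

lemma good_part:
  assumes G: "G \<in> F_fin A"
  shows "good (part n G)"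
proof -
  interpret prob_space \<mu> by (rule prob)
  let ?P = "part n G"
  have P: "?P \<in> F_fin A" by (rule part_F_fin[OF G])
  obtain L\<^sub>1 where L\<^sub>1: "compact L\<^sub>1" "\<forall>e>0. approximable A L\<^sub>1 n (\<lambda>\<eta>. ?P (mset_set \<eta>)) e"
    using sspan_dense[OF A G, of n] by blast
  obtain N L\<^sub>2 where L\<^sub>2: "compact L\<^sub>2" "bsupp N L\<^sub>2 ?P" using F_fin_bsupp[OF A P] by blast
  let ?L = "L\<^sub>1 \<union> L\<^sub>2" and ?N = "max n N"
  have "\<exists>H. H \<in> sspan A L\<^sub>1 n \<and> (\<forall>\<eta>. finite \<eta> \<longrightarrow> norm (H (mset_set \<eta>) - ?P (mset_set \<eta>)) \<le> inverse (real (Suc k)))" for k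
    using L\<^sub>1(2)[rule_format, of "inverse (real (Suc k))"] unfolding approximable_def[OF A] by auto
  then obtain H where H: "\<And>k. H k \<in> sspan A L\<^sub>1 n"
    "\<And>k \<eta>. finite \<eta> \<Longrightarrow> norm (H k (mset_set \<eta>) - ?P (mset_set \<eta>)) \<le> inverse (real (Suc k))"
    by metis
  have HF: "H k \<in> F_fin A" for k by (rule sspan_F_fin[OF A H(1)])
  let ?D = "\<lambda>k \<eta>. H k \<eta> + (-1) * ?P \<eta>"
  have D: "?D k \<in> F_fin A" for k by (rule F.V_add[OF HF F.V_scale[OF P]])
  have Hs: "bsupp ?N ?L (H k)" for k by (rule bsupp_mono[OF sspan_bsupp[OF H(1)]]) auto
  have Ps: "bsupp ?N ?L ?P" by (rule bsupp_mono[OF L\<^sub>2(2)]) auto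
  have Ds: "bsupp ?N ?L (?D k)" for k
    unfolding bsupp_def
  proof (intro allI impI)
    fix \<eta> assume "?D k \<eta> \<noteq> 0"
    then have "H k \<eta> \<noteq> 0 \<or> ?P \<eta> \<noteq> 0" by auto
    then show "size \<eta> \<le> ?N \<and> set_mset \<eta> \<subseteq> ?L" using Hs[of k] Ps unfolding bsupp_def by blast
  qed
  have L: "compact ?L" by (rule compact_Un[OF L\<^sub>1(1) L\<^sub>2(1)])
  from a_form_bound[OF sets_rho rho_bound L, of ?N] obtain C where C: "C \<ge> 0"
    "\<forall>D B. mset_cont D \<longrightarrow> bsupp ?N ?L D \<longrightarrow> (\<forall>\<eta>. finite \<eta> \<longrightarrow> norm (D (mset_set \<eta>)) \<le> B) \<longrightarrow>
      norm (form D D) \<le> C * B\<^sup>2" by blast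
  have form_D: "norm (form (?D k) (?D k)) \<le> C * (inverse (real (Suc k)))\<^sup>2" for k
    by (rule C(2)[rule_format, OF F_fin_mset_cont[OF A D] Ds]) (use H(2) in simp)
  let ?u = "\<lambda>k \<omega>. (cmod (ws (?D k) \<omega>))\<^sup>2"
  have int_u: "integrable \<mu> (?u k)" for k using ws_sq[OF D] by (simp add: sq_integrable_def)
  have u_le: "(\<integral>\<omega>. norm (?u k \<omega>) \<partial>\<mu>) \<le> C * (inverse (real (Suc k)))\<^sup>2" for k
  proof -
    have "norm (L2_ip \<mu> (ws (?D k)) (ws (?D k))) \<le> C * (inverse (real (Suc k)))\<^sup>2"
      unfolding ws_ip[OF D D] by (rule form_D)
    then show ?thesis unfolding L2_ip_self norm_of_real by simp
  qed
  have "(\<lambda>k. \<integral>\<omega>. norm (?u k \<omega>) \<partial>\<mu>) \<longlonglongrightarrow> 0"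
  proof (rule tendsto_sandwich[OF _ _ tendsto_const])
    have "(\<lambda>k. C * (inverse (real (Suc k)))\<^sup>2) \<longlonglongrightarrow> C * 0\<^sup>2"
      by (intro tendsto_mult tendsto_const tendsto_power LIMSEQ_inverse_real_of_nat)
    then show "(\<lambda>k. C * (inverse (real (Suc k)))\<^sup>2) \<longlonglongrightarrow> 0" by simp
  qed (use u_le in simp_all)
  from tendsto_L1_AE_subseq[OF int_u this] obtain r where r: "strict_mono r"
    "AE \<omega> in \<mu>. (\<lambda>k. ?u (r k) \<omega>) \<longlonglongrightarrow> 0" by blast
  have Hlim: "(\<lambda>k. H (r k) (mset_set \<eta>)) \<longlonglongrightarrow> ?P (mset_set \<eta>)" if "finite \<eta>" for \<eta>
  proof -
    have "(\<lambda>k. H k (mset_set \<eta>) - ?P (mset_set \<eta>)) \<longlonglongrightarrow> 0"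
      by (rule Lim_null_comparison[OF _ LIMSEQ_inverse_real_of_nat]) (use H(2)[OF that] in simp)
    then have "(\<lambda>k. H k (mset_set \<eta>)) \<longlonglongrightarrow> ?P (mset_set \<eta>)" by (rule LIM_zero_cancel)
    then show ?thesis using LIMSEQ_subseq_LIMSEQ[OF _ r(1)] by (simp add: comp_def)
  qed
  have "AE \<omega> in \<mu>. \<forall>k. ws (?D k) \<omega> = ws (H k) \<omega> + (-1) * ws ?P \<omega>"
    unfolding AE_all_countable by (intro allI ws_add_scale HF P)
  moreover have "AE \<omega> in \<mu>. \<forall>k. ws (H k) \<omega> = KT (H k) (conf \<omega>)"
    unfolding AE_all_countable using good_sspan[OF H(1)] by (simp add: good_def)
  ultimately show ?thesis
    unfolding good_def using r(2) full
  proof eventually_elim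
    case (elim \<omega>)
    have "(\<lambda>k. (cmod (ws (H (r k)) \<omega> - ws ?P \<omega>))\<^sup>2) \<longlonglongrightarrow> 0" using elim(1,3) by simp
    then have "(\<lambda>k. sqrt ((cmod (ws (H (r k)) \<omega> - ws ?P \<omega>))\<^sup>2)) \<longlonglongrightarrow> sqrt 0" by (rule tendsto_real_sqrt)
    then have "(\<lambda>k. ws (H (r k)) \<omega> - ws ?P \<omega>) \<longlonglongrightarrow> 0" by (simp add: tendsto_norm_zero_iff)
    then have "(\<lambda>k. ws (H (r k)) \<omega>) \<longlonglongrightarrow> ws ?P \<omega>" by (rule LIM_zero_cancel)
    moreover have "(\<lambda>k. KT (H (r k)) (conf \<omega>)) \<longlonglongrightarrow> KT ?P (conf \<omega>)"
      by (rule KT_tendsto[OF Hs Ps L conf(1)[OF elim(4)] Hlim])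
    ultimately show ?case using elim(2) LIMSEQ_unique by simp
  qed
qed

lemma good_F_fin:
  assumes G: "G \<in> F_fin A"
  shows "good G"
proof -
  obtain N where N: "\<forall>\<eta>. size \<eta> > N \<longrightarrow> G \<eta> = 0" using G unfolding F_fin_iff by blast
  have "(\<lambda>\<eta>. \<Sum>n<m. part n G \<eta>) \<in> F_fin A \<and> good (\<lambda>\<eta>. \<Sum>n<m. part n G \<eta>)" for m
  proof (induction m)
    case 0
    have "KT (\<lambda>_. 0) \<gamma> = 0" for \<gamma> :: "'a set" by (simp add: KT_def K_transform_def)
    then have "good (\<lambda>_. 0)" unfolding good_def using ws_zero by simp
    then show ?case using F.V_zero by simp
  next
    case (Suc m)
    then have "good (\<lambda>\<eta>. (\<Sum>n<m. part n G \<eta>) + 1 * part m G \<eta>)"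
      by (intro good_add_scale part_F_fin good_part G) simp_all
    moreover have "(\<lambda>\<eta>. (\<Sum>n<m. part n G \<eta>) + part m G \<eta>) \<in> F_fin A"
      using Suc by (intro F.V_add part_F_fin G) simp
    ultimately show ?case by simp
  qed
  moreover have "(\<Sum>n<Suc N. part n G \<eta>) = G \<eta>" for \<eta>
  proof -
    have "(\<Sum>n<Suc N. part n G \<eta>) = (\<Sum>n<Suc N. if n = size \<eta> then G \<eta> else 0)"
      by (intro sum.cong) (auto simp: part_def)
    also have "\<dots> = G \<eta>" using N by (auto simp: sum.delta' not_less)
    finally show ?thesis .
  qed
  ultimately show ?thesis by (metis (no_types, lifting) ext)
qed

lemma K_eq_K_transform:
  assumes "G \<in> F_fin A" "f \<in> K (hat A \<rho> G)"
  shows "AE \<omega> in \<mu>. f \<omega> = K_transform (\<lambda>\<eta>. G (mset_set \<eta>)) (conf \<omega>)"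
proof -
  have "AE \<omega> in \<mu>. f \<omega> = ws G \<omega>"
    using mem_L2_class_AE(2)[OF ws_sq[OF assms(1)]] assms K_hat by blast
  then show ?thesis using good_F_fin[OF assms(1)] unfolding good_def KT_def by eventually_elim simp
qed

subsection \<open>The correlation measure\<close>

abbreviation kt :: "('a set \<Rightarrow> ennreal) \<Rightarrow> (('a \<Rightarrow> real) \<Rightarrow> real) \<Rightarrow> ennreal" where
  "kt G \<equiv> \<lambda>\<omega>. K_transform G (conf \<omega>) * indicator Conf \<omega>"

text \<open>\<open>kt G\<close> agrees with a measurable function only almost everywhere, hence the completion of \<open>\<mu>\<close>.\<close>

abbreviation cmu where "cmu \<equiv> Complete_Measure.completion \<mu>"

text \<open>Measurability is carried along because additivity and monotone convergence of the
  integral require it.\<close>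

definition corr :: "('a set \<Rightarrow> ennreal) \<Rightarrow> bool" where
  "corr G \<longleftrightarrow> kt G \<in> borel_measurable cmu \<and> (\<integral>\<^sup>+\<omega>. kt G \<omega> \<partial>cmu) = (\<integral>\<^sup>+\<eta>. G \<eta> \<partial>\<rho>)"

lemma space_rho_finite: "space \<rho> = {\<eta>. finite \<eta>}"
  by (rule space_rho[OF sets_rho rho_bound])

lemma measurable_rho_iff: "f \<in> borel_measurable \<rho> \<longleftrightarrow> f \<in> borel_measurable conf_borel"
  by (simp add: measurable_cong_sets[OF sets_rho refl])

lemma corrD:
  assumes "corr G"
  shows "kt G \<in> borel_measurable cmu" "(\<integral>\<^sup>+\<omega>. kt G \<omega> \<partial>cmu) = (\<integral>\<^sup>+\<eta>. G \<eta> \<partial>\<rho>)"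
  using assms unfolding corr_def by (rule conjunct1, rule conjunct2)

lemma corr_cong:
  assumes "\<And>\<eta>. finite \<eta> \<Longrightarrow> G \<eta> = G' \<eta>"
  shows "corr G \<longleftrightarrow> corr G'"
proof -
  have "K_transform G \<gamma> = K_transform G' \<gamma>" for \<gamma>
    unfolding K_transform_def by (rule infsum_cong) (use assms in auto)
  moreover have "(\<integral>\<^sup>+\<eta>. G \<eta> \<partial>\<rho>) = (\<integral>\<^sup>+\<eta>. G' \<eta> \<partial>\<rho>)"
    by (rule nn_integral_cong) (simp add: space_rho_finite assms)
  ultimately show ?thesis by (simp add: corr_def)
qed

lemma corr_F_fin:
  assumes G: "G \<in> F_fin A" "unit_fun G"
  shows "corr (\<lambda>\<eta>. ennreal (Re (G (mset_set \<eta>))))"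
proof -
  interpret prob_space \<mu> by (rule prob)
  let ?g = "\<lambda>\<eta>. Re (G (mset_set \<eta>))"
  have g: "G (mset_set \<eta>) = complex_of_real (?g \<eta>)" "0 \<le> ?g \<eta>" for \<eta>
    using G(2) by (auto simp: unit_fun_def complex_eq_iff)
  obtain N L where L: "compact L" "bsupp N L G" using F_fin_bsupp[OF A G(1)] by blast
  have one: "one_fun \<in> F_fin A" by (rule one_F_fin[OF A])
  have AE: "AE \<omega> in \<mu>. ennreal (Re (ws G \<omega>)) = kt (\<lambda>\<eta>. ennreal (?g \<eta>)) \<omega> \<and> 0 \<le> Re (ws G \<omega>)"
    using good_F_fin[OF G(1)] full unfolding good_def
  proof eventually_elim
    case (elim \<omega>)
    then show ?case
      using K_transform_ennreal_of_KT[OF L(2,1) conf(1)[OF elim(2)] g] by simp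
  qed
  have meas: "(\<lambda>\<omega>. ennreal (Re (ws G \<omega>))) \<in> borel_measurable \<mu>"
    using ws_measurable[OF G(1)] by measurable
  have AE1: "AE \<omega> in \<mu>. ennreal (Re (ws G \<omega>)) = kt (\<lambda>\<eta>. ennreal (?g \<eta>)) \<omega>"
    and AE2: "AE \<omega> in \<mu>. 0 \<le> Re (ws G \<omega>)" using AE by (eventually_elim, simp)+
  have kt: "kt (\<lambda>\<eta>. ennreal (?g \<eta>)) \<in> borel_measurable cmu"
    by (rule borel_measurable_completion_AE[OF meas AE1])
  have AE_one: "AE \<omega> in \<mu>. ws G \<omega> * cnj (ws one_fun \<omega>) = ws G \<omega>" using ws_one by eventually_elim simp
  have intG: "integrable \<mu> (ws G)"
    using sq_integrable_mult[OF ws_sq[OF G(1)] ws_sq[OF one]]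
    by (rule integrable_cong_AE_imp[OF _ ws_measurable[OF G(1)]]) (use AE_one in \<open>eventually_elim, simp\<close>)
  \<comment> \<open>As \<open>ws one_fun\<close> is \<open>1\<close> almost everywhere, the integral
    is an inner product with the image of the unit, which the isometry carries back to an integral
    against \<open>\<rho>\<close>.\<close>
  have "(\<integral>\<omega>. ws G \<omega> \<partial>\<mu>) = L2_ip \<mu> (ws G) (ws one_fun)"
    unfolding L2_ip_def
    by (rule integral_cong_AE[OF ws_measurable[OF G(1)]
          borel_measurable_integrable[OF sq_integrable_mult[OF ws_sq[OF G(1)] ws_sq[OF one]]]])
      (use AE_one in \<open>eventually_elim, simp\<close>)
  also have "\<dots> = (\<integral>\<eta>. G (mset_set \<eta>) \<partial>\<rho>)" unfolding ws_ip[OF G(1) one] by (rule form_one[OF G(1)])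
  finally have int_eq: "(\<integral>\<omega>. ws G \<omega> \<partial>\<mu>) = (\<integral>\<eta>. G (mset_set \<eta>) \<partial>\<rho>)" .
  obtain B where B: "\<forall>\<eta>. norm (G \<eta>) \<le> B" using F_fin_bounded[OF A G(1)] by blast
  have intg: "integrable \<rho> (\<lambda>\<eta>. G (mset_set \<eta>))"
    by (rule cc_integral(1)[OF sets_rho rho_bound F_fin_mset_cont[OF A G(1)] L B[rule_format]])
  have "(\<integral>\<^sup>+\<omega>. kt (\<lambda>\<eta>. ennreal (?g \<eta>)) \<omega> \<partial>cmu) = (\<integral>\<^sup>+\<omega>. ennreal (Re (ws G \<omega>)) \<partial>\<mu>)"
    unfolding nn_integral_completion by (rule nn_integral_cong_AE) (use AE1 in \<open>eventually_elim, simp\<close>)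
  also have "\<dots> = ennreal (\<integral>\<omega>. Re (ws G \<omega>) \<partial>\<mu>)"
    by (rule nn_integral_eq_integral[OF integrable_Re[OF intG] AE2])
  also have "(\<integral>\<omega>. Re (ws G \<omega>) \<partial>\<mu>) = Re (\<integral>\<eta>. G (mset_set \<eta>) \<partial>\<rho>)"
    unfolding int_eq[symmetric] by (rule integral_Re[OF intG])
  also have "\<dots> = (\<integral>\<eta>. ?g \<eta> \<partial>\<rho>)" by (rule integral_Re[OF intg, symmetric])
  also have "ennreal \<dots> = (\<integral>\<^sup>+\<eta>. ennreal (?g \<eta>) \<partial>\<rho>)"
    by (rule nn_integral_eq_integral[symmetric, OF integrable_Re[OF intg]]) (use g in simp)
  finally show ?thesis using kt by (simp add: corr_def)
qed

lemma corr_SUP: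
  fixes G :: "nat \<Rightarrow> 'a set \<Rightarrow> ennreal"
  assumes "\<And>k. corr (G k)" "\<And>k. G k \<in> borel_measurable \<rho>" "\<And>\<eta>. incseq (\<lambda>k. G k \<eta>)"
  shows "corr (\<lambda>\<eta>. SUP k. G k \<eta>)"
proof -
  have kt: "kt (\<lambda>\<eta>. SUP k. G k \<eta>) = (\<lambda>\<omega>. SUP k. kt (G k) \<omega>)"
    by (simp add: K_transform_SUP[OF assms(3)] SUP_mult_right_ennreal fun_eq_iff)
  have meas: "kt (G k) \<in> borel_measurable cmu" for k using assms(1) by (simp add: corr_def)
  have inc: "incseq (\<lambda>k. kt (G k))"
  proof (intro incseq_SucI le_funI mult_right_mono K_transform_mono)
    fix k \<eta> show "G k \<eta> \<le> G (Suc k) \<eta>" using assms(3)[of \<eta>] by (rule incseq_SucD)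
  qed simp
  have "(\<integral>\<^sup>+\<omega>. (SUP k. kt (G k) \<omega>) \<partial>cmu) = (SUP k. \<integral>\<^sup>+\<omega>. kt (G k) \<omega> \<partial>cmu)"
    by (rule nn_integral_monotone_convergence_SUP[OF inc meas])
  also have "\<dots> = (SUP k. \<integral>\<^sup>+\<eta>. G k \<eta> \<partial>\<rho>)" using assms(1) by (simp add: corr_def)
  also have "\<dots> = (\<integral>\<^sup>+\<eta>. (SUP k. G k \<eta>) \<partial>\<rho>)"
    by (rule nn_integral_monotone_convergence_SUP[symmetric, OF _ assms(2)])
      (use assms(3) in \<open>auto simp: incseq_def le_fun_def\<close>)
  finally show ?thesis unfolding corr_def kt using meas by simp
qed

lemma corr_add:
  assumes "corr G" "corr H" "G \<in> borel_measurable \<rho>" "H \<in> borel_measurable \<rho>"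
  shows "corr (\<lambda>\<eta>. G \<eta> + H \<eta>)"
proof -
  have kt: "kt (\<lambda>\<eta>. G \<eta> + H \<eta>) = (\<lambda>\<omega>. kt G \<omega> + kt H \<omega>)" by (simp add: K_transform_add distrib_right)
  note m = corrD(1)[OF assms(1)] corrD(1)[OF assms(2)]
  show ?thesis
    unfolding corr_def kt nn_integral_add[OF m] nn_integral_add[OF assms(3,4)] corrD(2)[OF assms(1)] corrD(2)[OF assms(2)]
    by (intro conjI borel_measurable_add m refl)
qed

lemma corr_cmult:
  assumes "corr G" "G \<in> borel_measurable \<rho>"
  shows "corr (\<lambda>\<eta>. c * G \<eta>)"
proof -
  have kt: "kt (\<lambda>\<eta>. c * G \<eta>) = (\<lambda>\<omega>. c * kt G \<omega>)" by (simp add: K_transform_cmult mult.assoc)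
  note m = corrD(1)[OF assms(1)]
  show ?thesis
    unfolding corr_def kt nn_integral_cmult[OF m] nn_integral_cmult[OF assms(2)] corrD(2)[OF assms(1)]
    by (intro conjI borel_measurable_times_ennreal m borel_measurable_const refl)
qed

lemma corr_zero: "corr (\<lambda>_. 0)"
  by (simp add: corr_def K_transform_def)

lemma corr_suminf:
  fixes G :: "nat \<Rightarrow> 'a set \<Rightarrow> ennreal"
  assumes "\<And>k. corr (G k)" "\<And>k. G k \<in> borel_measurable \<rho>"
  shows "corr (\<lambda>\<eta>. \<Sum>k. G k \<eta>)"
proof -
  have kt: "kt (\<lambda>\<eta>. \<Sum>k. G k \<eta>) = (\<lambda>\<omega>. \<Sum>k. kt (G k) \<omega>)"
    by (simp add: K_transform_suminf ennreal_suminf_multc)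
  note m = corrD(1)[OF assms(1)]
  show ?thesis
    unfolding corr_def kt nn_integral_suminf[OF m] nn_integral_suminf[OF assms(2)] corrD(2)[OF assms(1)]
    by (intro conjI borel_measurable_suminf_order m refl)
qed

lemma corr_open:
  assumes "openin conf_topology U"
  shows "corr (indicator U)"
proof -
  from conf_open_approx[OF A assms] obtain F where F: "\<forall>k. F k \<in> F_fin A" "\<forall>k. unit_fun (F k)"
    "\<forall>\<eta>. incseq (\<lambda>k. Re (F k (mset_set \<eta>)))"
    "\<forall>\<eta>. finite \<eta> \<longrightarrow> (\<lambda>k. Re (F k (mset_set \<eta>))) \<longlonglongrightarrow> indicator U \<eta>" by blast
  let ?G = "\<lambda>k \<eta>. ennreal (Re (F k (mset_set \<eta>)))"
  have inc: "incseq (\<lambda>k. ?G k \<eta>)" for \<eta> using F(3) by (auto simp: incseq_def intro!: ennreal_leI)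
  have meas: "?G k \<in> borel_measurable \<rho>" for k
  proof -
    have [measurable]: "(\<lambda>\<eta>. F k (mset_set \<eta>)) \<in> borel_measurable \<rho>"
      unfolding measurable_rho_iff
      by (rule mset_cont_measurable[OF F_fin_mset_cont[OF A]]) (use F(1) in blast)
    show ?thesis by measurable
  qed
  have "corr (\<lambda>\<eta>. SUP k. ?G k \<eta>)" by (rule corr_SUP[OF corr_F_fin meas inc]) (use F(1,2) in auto)
  moreover have "(SUP k. ?G k \<eta>) = indicator U \<eta>" if "finite \<eta>" for \<eta>
  proof -
    have "(\<lambda>k. ?G k \<eta>) \<longlonglongrightarrow> ennreal (indicator U \<eta>)" using F(4) that by (intro tendsto_ennrealI) blast
    then show ?thesis using LIMSEQ_unique[OF LIMSEQ_SUP[OF inc]] by (simp add: ennreal_indicator)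
  qed
  ultimately show ?thesis using corr_cong[of "\<lambda>\<eta>. SUP k. ?G k \<eta>" "indicator U"] by blast
qed

text \<open>Complements require subtraction of finite quantities, while \<open>\<rho>\<close> and
  the number of finite subsets of \<open>\<gamma>\<close> can be infinite. The Dynkin argument
  therefore runs on intersections with \<open>W j\<close>, the configurations of at most
  \<open>j\<close> points in the first \<open>j\<close> sets of a cover by open sets with compact
  supersets; the \<open>W j\<close> increase to all finite configurations.\<close>

lemma corr_sets:
  assumes "B \<in> sets conf_borel"
  shows "corr (indicator B)"
proof -
  obtain V L where VL: "\<forall>i::nat. open (V i :: 'a set) \<and> compact (L i) \<and> V i \<subseteq> L i" "(\<Union>i. V i) = UNIV"
    using compact_exhaustion[OF A] by blast
  define W where "W j = (\<Union>n\<in>{..j}. nconf (\<Union>i<j. V i) n)" for j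
  have W_iff: "\<eta> \<in> W j \<longleftrightarrow> finite \<eta> \<and> card \<eta> \<le> j \<and> \<eta> \<subseteq> (\<Union>i<j. V i)" for \<eta> j
    by (auto simp: W_def nconf_def)
  have W_open: "openin conf_topology (W j)" for j
    unfolding W_def using VL(1) by (intro openin_Union) (auto intro!: nconf_open open_UN)
  have cpt: "compact (\<Union>i<j. L i)" for j using VL(1) by (intro compact_UN) auto
  have VsubL: "(\<Union>i<j. V i) \<subseteq> (\<Union>i<j. L i)" for j using VL(1) by blast
  have W_fin: "emeasure \<rho> (W j) < \<infinity>" for j
  proof -
    have "W j \<subseteq> (\<Union>n\<le>j. nconf (\<Union>i<j. L i) n)" using VsubL[of j] by (auto simp: W_def nconf_def)
    then have "emeasure \<rho> (W j) \<le> emeasure \<rho> (\<Union>n\<le>j. nconf (\<Union>i<j. L i) n)"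
      by (rule emeasure_mono) (rule nconf_Union_sets[OF sets_rho rho_bound cpt])
    also have "\<dots> < \<infinity>" by (rule nconf_Union_finite[OF sets_rho rho_bound cpt])
    finally show ?thesis .
  qed
  have fin_sum: "(\<Sum>\<eta>\<in>S. indicator (W j) \<eta> :: ennreal) < \<infinity>" if "finite S" for S j
    using that by (auto simp: ennreal_sum_less_top split: split_indicator)
  \<comment> \<open>A locally finite configuration has finitely many points in the compact union,
    hence finitely many subsets there.\<close>
  have kt_fin: "kt (indicator (W j)) \<omega> < \<infinity>" for j \<omega>
  proof (cases "\<omega> \<in> Conf")
    case True
    have "K_transform (indicator (W j)) (conf \<omega>) =
        (\<Sum>\<eta>\<in>Pow (conf \<omega> \<inter> (\<Union>i<j. L i)). indicator (W j) \<eta> :: ennreal)"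
    proof (rule K_transform_eq[OF configs_finite[OF conf(1)[OF True] cpt]])
      fix \<eta> assume "(indicator (W j) \<eta> :: ennreal) \<noteq> 0"
      then have "\<eta> \<in> W j" by (simp add: indicator_def split: if_splits)
      then have "\<eta> \<subseteq> (\<Union>i<j. V i)" by (simp only: W_iff)
      then show "\<eta> \<subseteq> (\<Union>i<j. L i)" using VsubL by (rule subset_trans)
    qed (rule Int_lower1 subset_refl)+
    also have "\<dots> < \<infinity>"
      by (rule fin_sum) (unfold finite_Pow_iff, rule configs_finite[OF conf(1)[OF True] cpt])
    finally show ?thesis using True by simp
  qed simp
  have W_sets: "W j \<in> sets \<rho>" for j unfolding sets_rho by (rule conf_open_measurable[OF W_open])
  have sets_eq: "sigma_sets {\<eta>. finite \<eta>} {U. openin conf_topology U} = sets \<rho>"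
    unfolding sets_rho sets_conf_borel ..
  have local: "\<forall>j. corr (indicator (B \<inter> W j))"
  proof (rule sigma_sets_induct_disjoint[of "{U. openin conf_topology U}" "{\<eta>. finite \<eta>}" B])
    show "Int_stable {U :: 'a set set. openin conf_topology U}" by (auto simp: Int_stable_def)
    show "{U :: 'a set set. openin conf_topology U} \<subseteq> Pow {\<eta>. finite \<eta>}" by (auto simp: openin_conf_topology)
    show "B \<in> sigma_sets {\<eta>. finite \<eta>} {U. openin conf_topology U}" using assms by (simp add: sets_conf_borel)
    show "\<forall>j. corr (indicator (U \<inter> W j))" if "U \<in> {U. openin conf_topology U}" for U
      using that W_open by (auto intro!: corr_open)
    show "\<forall>j. corr (indicator ({} \<inter> W j))" using corr_zero by (simp add: indicator_def[abs_def])
  next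
    fix B assume B: "B \<in> sigma_sets {\<eta>. finite \<eta>} {U. openin conf_topology U}" "\<forall>j. corr (indicator (B \<inter> W j))"
    then have Bs: "B \<in> sets \<rho>" by (simp add: sets_eq)
    show "\<forall>j. corr (indicator (({\<eta>. finite \<eta>} - B) \<inter> W j))"
    proof
      fix j
      let ?B = "B \<inter> W j" and ?C = "({\<eta>. finite \<eta>} - B) \<inter> W j"
      have Cs: "?C \<in> sets \<rho>" using Bs W_sets[of j] sets.top[of \<rho>] by (auto simp: space_rho_finite)
      have B's: "?B \<in> sets \<rho>" using Bs W_sets[of j] by auto
      have ind: "indicator (W j) = (\<lambda>\<eta>. indicator ?B \<eta> + indicator ?C \<eta> :: ennreal)"
        using W_iff by (auto simp: fun_eq_iff indicator_def)
      have add: "kt (indicator (W j)) \<omega> = kt (indicator ?B) \<omega> + kt (indicator ?C) \<omega>" for \<omega>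
        unfolding ind by (simp add: K_transform_add distrib_right)
      have fin: "kt (indicator ?B) \<omega> < \<infinity>" for \<omega>
        using add[of \<omega>] kt_fin[of j \<omega>] by (metis add_le_same_cancel1 ennreal_add_less_top infinity_ennreal_def)
      have ktC: "kt (indicator ?C) = (\<lambda>\<omega>. kt (indicator (W j)) \<omega> - kt (indicator ?B) \<omega>)"
        unfolding add using fin by (simp add: fun_eq_iff less_top)
      have mB: "kt (indicator ?B) \<in> borel_measurable cmu" and iB: "(\<integral>\<^sup>+\<omega>. kt (indicator ?B) \<omega> \<partial>cmu) = emeasure \<rho> ?B"
        using B(2) B's by (auto simp: corr_def)
      have mW: "kt (indicator (W j)) \<in> borel_measurable cmu"
        and iW: "(\<integral>\<^sup>+\<omega>. kt (indicator (W j)) \<omega> \<partial>cmu) = emeasure \<rho> (W j)"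
        using corr_open[OF W_open[of j]] W_sets[of j] by (auto simp: corr_def)
      have mC: "kt (indicator ?C) \<in> borel_measurable cmu"
        unfolding ktC using mB mW by (rule borel_measurable_minus_ennreal[rotated])
      have "emeasure \<rho> ?B + (\<integral>\<^sup>+\<omega>. kt (indicator ?C) \<omega> \<partial>cmu) = emeasure \<rho> (W j)"
        unfolding iB[symmetric] iW[symmetric] add by (rule nn_integral_add[OF mB mC, symmetric])
      also have "\<dots> = emeasure \<rho> ?B + emeasure \<rho> ?C"
      proof -
        have "?B \<union> ?C = W j" using W_iff by auto
        moreover have "?B \<inter> ?C = {}" by auto
        ultimately show ?thesis using plus_emeasure[OF B's Cs] by simp
      qed
      finally have sum: "emeasure \<rho> ?B + (\<integral>\<^sup>+\<omega>. kt (indicator ?C) \<omega> \<partial>cmu) = emeasure \<rho> ?B + emeasure \<rho> ?C" .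
      \<comment> \<open>Finiteness of this mass allows it to be cancelled from the sum.\<close>
      have "emeasure \<rho> ?B \<le> emeasure \<rho> (W j)" by (rule emeasure_mono[OF _ W_sets]) auto
      then have "emeasure \<rho> ?B \<noteq> top" using W_fin[of j] by (auto simp: top_unique)
      then have "(\<integral>\<^sup>+\<omega>. kt (indicator ?C) \<omega> \<partial>cmu) = emeasure \<rho> ?C"
        using sum by (simp only: ennreal_add_left_cancel) simp
      then show "corr (indicator ?C)" using mC Cs by (simp add: corr_def)
    qed
  next
    fix D :: "nat \<Rightarrow> 'a set set"
    assume D: "disjoint_family D" "range D \<subseteq> sigma_sets {\<eta>. finite \<eta>} {U. openin conf_topology U}"
      "\<And>i. \<forall>j. corr (indicator (D i \<inter> W j))"
    show "\<forall>j. corr (indicator ((\<Union>i. D i) \<inter> W j))"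
    proof
      fix j
      have Ds: "D i \<inter> W j \<in> sets \<rho>" for i using D(2) W_sets[of j] unfolding sets_eq by auto
      have "disjoint_family (\<lambda>i. D i \<inter> W j)" using D(1) by (auto simp: disjoint_family_on_def)
      then have "(\<Sum>i. indicator (D i \<inter> W j) \<eta> :: ennreal) = indicator (\<Union>i. D i \<inter> W j) \<eta>" for \<eta>
        by (rule suminf_indicator)
      then have eq: "indicator ((\<Union>i. D i) \<inter> W j) = (\<lambda>\<eta>. \<Sum>i. indicator (D i \<inter> W j) \<eta> :: ennreal)"
        by (simp add: fun_eq_iff)
      show "corr (indicator ((\<Union>i. D i) \<inter> W j))"
        unfolding eq using D(3) Ds by (intro corr_suminf) auto
    qed
  qed
  have inc: "incseq (\<lambda>j. indicator (B \<inter> W j) \<eta> :: ennreal)" for \<eta>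
  proof (rule incseq_SucI)
    fix j
    have "W j \<subseteq> W (Suc j)" by (auto simp: W_iff lessThan_Suc)
    then show "(indicator (B \<inter> W j) \<eta> :: ennreal) \<le> indicator (B \<inter> W (Suc j)) \<eta>" by (auto simp: indicator_def)
  qed
  have SUP: "(SUP j. indicator (B \<inter> W j) \<eta> :: ennreal) = indicator B \<eta>" if "finite \<eta>" for \<eta>
  proof (rule antisym)
    show "(SUP j. indicator (B \<inter> W j) \<eta> :: ennreal) \<le> indicator B \<eta>"
      by (intro SUP_least) (auto simp: indicator_def)
    have "\<forall>x\<in>\<eta>. \<exists>i. x \<in> V i" using VL(2) by auto
    then obtain i where i: "\<forall>x\<in>\<eta>. x \<in> V (i x)" by metis
    \<comment> \<open>Large enough for the number of points and for the index of a set
      \<open>V i\<close> around each of them; \<open>Suc\<close> because \<open>W m\<close> uses the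
      indices below \<open>m\<close>.\<close>
    define m where "m = Max (insert (card \<eta>) ((\<lambda>x. Suc (i x)) ` \<eta>))"
    have "card \<eta> \<le> m" "\<And>x. x \<in> \<eta> \<Longrightarrow> i x < m"
      unfolding m_def using that by (auto simp: Max_ge_iff less_eq_Suc_le)
    then have "\<eta> \<in> W m" using that i by (auto simp: W_iff)
    then have "indicator B \<eta> = (indicator (B \<inter> W m) \<eta> :: ennreal)" by (simp add: indicator_def)
    also have "\<dots> \<le> (SUP j. indicator (B \<inter> W j) \<eta>)" by (rule SUP_upper) simp
    finally show "indicator B \<eta> \<le> (SUP j. indicator (B \<inter> W j) \<eta> :: ennreal)" .
  qed
  have "B \<in> sets \<rho>" using assms by (simp add: sets_rho)
  then have "corr (\<lambda>\<eta>. SUP j. indicator (B \<inter> W j) \<eta>)"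
    using local W_sets by (intro corr_SUP inc) auto
  then show ?thesis using corr_cong[OF SUP] by simp
qed

lemma corr_measurable:
  assumes "G \<in> borel_measurable conf_borel"
  shows "corr G"
  using assms
proof (induction rule: borel_measurable_induct)
  case (cong f g)
  then show ?case using corr_cong[of f g] by simp
next
  case (set B)
  then show ?case by (rule corr_sets)
next
  case (mult u c)
  then show ?case using corr_cmult[of u c] by (simp add: measurable_rho_iff)
next
  case (add u v)
  then show ?case using corr_add[of v u] by (simp add: measurable_rho_iff)
next
  case (seq U)
  have "corr (\<lambda>\<eta>. SUP i. U i \<eta>)"
    using seq by (intro corr_SUP) (auto simp: incseq_def le_fun_def measurable_rho_iff)
  moreover have "(SUP i. U i) = (\<lambda>\<eta>. SUP i. U i \<eta>)" by (simp add: fun_eq_iff SUP_apply image_comp)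
  ultimately show ?case by simp
qed

lemma correlation_measure: "is_correlation_measure A \<mu> \<rho>"
  unfolding is_correlation_measure_def
proof (intro conjI allI impI)
  fix G :: "'a set \<Rightarrow> ennreal" assume "G \<in> borel_measurable conf_borel"
  then have "corr G" by (rule corr_measurable)
  then show "(\<integral>\<^sup>+\<omega>\<in>Conf. K_transform G (conf \<omega>) \<partial>\<mu>) = (\<integral>\<^sup>+\<eta>. G \<eta> \<partial>\<rho>)"
    by (simp add: corr_def nn_integral_completion)
qed (rule sets_rho)

end

theorem proposition1:
  fixes A :: "('a::{t2_space, second_countable_topology}, 'd::finite) chart set"
    and g :: "('a, 'd) chart \<Rightarrow> 'a \<Rightarrow> real^'d \<Rightarrow> real^'d \<Rightarrow> real"
    and \<rho> :: "'a set measure"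
    and \<mu> :: "(('a \<Rightarrow> real) \<Rightarrow> real) measure"
    and K :: "(nat \<Rightarrow> ('a multiset \<Rightarrow> complex) set) set \<Rightarrow> ((('a \<Rightarrow> real) \<Rightarrow> real) \<Rightarrow> complex) set"
  assumes "oriented_atlas A" and "riemannian_metric A g"
    and "connected (UNIV :: 'a set)" and "\<not> compact (UNIV :: 'a set)"
    and "sets \<rho> = sets conf_borel"
    and "emeasure \<rho> (nconf UNIV 0) = 1"
    and "\<And>\<Lambda> :: 'a set. compact \<Lambda> \<Longrightarrow> \<exists>C>0. \<forall>n. emeasure \<rho> (nconf \<Lambda> n) \<le> ennreal (C ^ n)"
    and "\<And>G. G \<in> F_fin A \<Longrightarrow> a_form \<rho> G (\<lambda>\<eta>. cnj (G \<eta>)) \<in> \<real>\<^sub>\<ge>\<^sub>0"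
    and "prob_space \<mu>" and "sets \<mu> = sets (cylinder A)"
    and "unitary_iso (H_rho A \<rho>) (L2 \<mu>) K"
    and "\<And>G. G \<in> F_fin A \<Longrightarrow> wick_series A G \<in> sq_integrable \<mu> \<and>
           K (hat A \<rho> G) = L2_class \<mu> (wick_series A G)"
    and "\<And>\<phi>. \<phi> \<in> test_fun A \<Longrightarrow>
           op_conj K (op_closure (H_rho A \<rho>) (A_op A \<rho> \<phi>)) = mult_op \<mu> (\<lambda>\<omega>. \<omega> \<phi>)"
    and "AE \<omega> in \<mu>. \<omega> \<in> dist_of A ` configs"
  shows "(\<forall>G \<in> F_fin A. \<forall>f \<in> K (hat A \<rho> G). AE \<omega> in \<mu>.
            \<omega> \<in> dist_of A ` configs \<longrightarrow>
              f \<omega> = K_transform (\<lambda>\<eta>. G (mset_set \<eta>)) (config_of A \<omega>)) \<and>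
         is_correlation_measure A \<mu> \<rho>"
proof -
  have "smooth_atlas A" using assms(1) by (simp add: oriented_atlas_def)
  then interpret spectral_measure A \<rho> \<mu> K
    by (rule spectral_measure.intro) (fact assms)+
  show ?thesis
  proof (intro conjI ballI correlation_measure)
    fix G f assume "G \<in> F_fin A" "f \<in> K (hat A \<rho> G)"
    from K_eq_K_transform[OF this]
    show "AE \<omega> in \<mu>. \<omega> \<in> dist_of A ` configs \<longrightarrow>
        f \<omega> = K_transform (\<lambda>\<eta>. G (mset_set \<eta>)) (config_of A \<omega>)"
      by eventually_elim simp
  qed
qed

end
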